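(* Let $(l,Q,\omega,\varphi)$ be admissible data (see context). For every $m\in(0,1)$ let $G_m:W^{1,1}((2m-1,1))\to[0,\infty]$ be given by $$G_m(w):=\int_{2m-1}^1\big(\vartheta_m(t)|w'|^2+\omega_m(1-t)\big)^{1/2}dt .$$ Then for every $s\in[0,\infty)$ $$g(s)=\inf_{m\in(0,1)}\ \inf\{G_m(w): w\in\zeta_{m,s}+W^{1,1}_0((2m-1,1))\}.$$
   Context: Convention: $0\cdot\infty=0$. Admissible data: $l,Q\in C^0([0,1],[0,\infty))$ with $l(1)=1$, $l^{-1}(\{0\})=Q^{-1}(\{0\})=\{0\}$, $Q$ increasing in a right neighbourhood of $0$, and $t\mapsto (l(t)/Q(1-t))^{1/2}$ (on $[0,1)$) increasing in a right neighbourhood of $0$; $\omega\in C^0([0,1],[0,\infty))$ with $\omega^{-1}(\{0\})=\{0\}$ such that the limit $\bar\varsigma:=\lim_{t\to0^+}(\omega(t)/Q(t))^{1/2}\in[0,\infty]$ exists; $\varphi\in C^0([0,\infty),[0,\infty))$ non-decreasing with $\lim_{t\to\infty}\varphi(t)\in(0,\infty)$, $\varphi^{-1}(0)=\{0\}$, right-differentiable at $0$ with $\varphi'(0^+)=1$; and the function $\vartheta(t):=\frac{\omega(1-t)}{Q(1-t)}l(t)$ is strictly increasing on $[0,1)$. Then $\vartheta$ is continuous, $\vartheta(0)=0$ and $\vartheta(1^-)=\bar\varsigma^2\in(0,\infty]$; set $\vartheta(1):=\vartheta(1^-)$. For $s\ge0$, $g(s):=\inf\int_0^1\big(\vartheta(v)|u'|^2+\omega(1-v)|v'|^2\big)^{1/2}dx$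 over $u,v\in H^1((0,1))$ with $u(0)=0$, $u(1)=s$, $0\le v\le1$, $v(0)=v(1)=1$. For $m\in(0,1)$, $t\in[2m-1,1]$: $\vartheta_m(t):=\vartheta(m+|t-m|)$ and $\omega_m(1-t):=\omega(1-m-|t-m|)$, i.e. the even extensions with respect to $t=m$ of $\vartheta|_{[m,1]}$ and $\omega(1-\cdot)|_{[m,1]}$. $\zeta_{m,s}$ is the affine function with $\zeta_{m,s}(2m-1)=0$ and $\zeta_{m,s}(1)=s$. *)

theory Defs
  imports "HOL-Analysis.Analysis"
begin

section \<open>Sobolev functions on a bounded interval\<close>

text \<open>Functions are real functions on the whole line, of which only the restriction to
  the open interval \<open>(a,b)\<close> matters. Elements of the Lebesgue and Sobolev spaces are represented by
  functions, not by classes modulo null sets. As usual in dimension one, test functions are of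
  class \<open>C\<^sup>1\<close> with compact support.\<close>

definition Lp_on :: "real \<Rightarrow> real \<Rightarrow> real \<Rightarrow> (real \<Rightarrow> real) set" where
  "Lp_on p a b = {u. u \<in> borel_measurable (lebesgue_on {a<..<b}) \<and>
     integrable (lebesgue_on {a<..<b}) (\<lambda>x. \<bar>u x\<bar> powr p)}"

definition test_functions :: "real \<Rightarrow> real \<Rightarrow> (real \<Rightarrow> real) set" where
  "test_functions a b = {\<psi>. \<psi> C1_differentiable_on UNIV \<and> closure {x. \<psi> x \<noteq> 0} \<subseteq> {a<..<b}}"

definition has_weak_deriv :: "real \<Rightarrow> real \<Rightarrow> (real \<Rightarrow> real) \<Rightarrow> (real \<Rightarrow> real) \<Rightarrow> bool" where
  "has_weak_deriv a b u u' \<longleftrightarrow>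
     (\<forall>\<psi>\<in>test_functions a b.
        (LINT x|lebesgue_on {a<..<b}. u x * deriv \<psi> x) = - (LINT x|lebesgue_on {a<..<b}. u' x * \<psi> x))"

definition sobolev1 :: "real \<Rightarrow> real \<Rightarrow> real \<Rightarrow> (real \<Rightarrow> real) set" where
  "sobolev1 p a b = {u \<in> Lp_on p a b. \<exists>u'\<in>Lp_on p a b. has_weak_deriv a b u u'}"

text \<open>A representative of the weak derivative, which is unique up to null sets. Since
  \<open>(a,b)\<close> is bounded, looking for it in \<open>L\<^sup>1\<close> is enough for all exponents \<open>p \<ge> 1\<close>.\<close>

definition weak_deriv :: "real \<Rightarrow> real \<Rightarrow> (real \<Rightarrow> real) \<Rightarrow> real \<Rightarrow> real" where
  "weak_deriv a b u = (SOME u'. u' \<in> Lp_on 1 a b \<and> has_weak_deriv a b u u')"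

abbreviation W11 :: "real \<Rightarrow> real \<Rightarrow> (real \<Rightarrow> real) set" where
  "W11 \<equiv> sobolev1 1"

abbreviation H1 :: "real \<Rightarrow> real \<Rightarrow> (real \<Rightarrow> real) set" where
  "H1 \<equiv> sobolev1 2"

definition W11_norm :: "real \<Rightarrow> real \<Rightarrow> (real \<Rightarrow> real) \<Rightarrow> real" where
  "W11_norm a b u =
     (LINT x|lebesgue_on {a<..<b}. \<bar>u x\<bar>) + (LINT x|lebesgue_on {a<..<b}. \<bar>weak_deriv a b u x\<bar>)"

text \<open>The closure of the test functions in \<open>W\<^sup>1\<^sup>,\<^sup>1\<close>.\<close>

definition W11_0 :: "real \<Rightarrow> real \<Rightarrow> (real \<Rightarrow> real) set" where
  "W11_0 a b = {w \<in> W11 a b. \<exists>\<psi>. (\<forall>n::nat. \<psi> n \<in> test_functions a b) \<and>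
     (\<lambda>n. W11_norm a b (\<lambda>x. w x - \<psi> n x)) \<longlonglongrightarrow> 0}"


section \<open>The data and the functionals\<close>

definition ennreal_sqrt :: "ennreal \<Rightarrow> ennreal" where
  "ennreal_sqrt x = (if x = \<infinity> then \<infinity> else ennreal (sqrt (enn2real x)))"

definition increasing_near_0 :: "(real \<Rightarrow> real) \<Rightarrow> bool" where
  "increasing_near_0 f \<longleftrightarrow> (\<exists>\<delta>. 0 < \<delta> \<and> \<delta> \<le> 1 \<and> mono_on {0..<\<delta>} f)"

definition theta0 :: "(real \<Rightarrow> real) \<Rightarrow> (real \<Rightarrow> real) \<Rightarrow> (real \<Rightarrow> real) \<Rightarrow> real \<Rightarrow> real" where
  "theta0 l Q \<omega> t = \<omega> (1 - t) / Q (1 - t) * l t"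

locale admissible_data =
  fixes l Q \<omega> \<phi> :: "real \<Rightarrow> real"
  assumes l_cont: "continuous_on {0..1} l"
    and l_nonneg: "\<And>t. t \<in> {0..1} \<Longrightarrow> 0 \<le> l t"
    and l_one: "l 1 = 1"
    and l_zero: "{t \<in> {0..1}. l t = 0} = {0}"
    and Q_cont: "continuous_on {0..1} Q"
    and Q_nonneg: "\<And>t. t \<in> {0..1} \<Longrightarrow> 0 \<le> Q t"
    and Q_zero: "{t \<in> {0..1}. Q t = 0} = {0}"
    and Q_incr: "increasing_near_0 Q"
    and lQ_incr: "increasing_near_0 (\<lambda>t. sqrt (l t / Q (1 - t)))"
    and omega_cont: "continuous_on {0..1} \<omega>"
    and omega_nonneg: "\<And>t. t \<in> {0..1} \<Longrightarrow> 0 \<le> \<omega> t"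
    and omega_zero: "{t \<in> {0..1}. \<omega> t = 0} = {0}"
    and omega_Q_lim: "\<exists>\<sigma>::ennreal. ((\<lambda>t. ennreal (sqrt (\<omega> t / Q t))) \<longlongrightarrow> \<sigma>) (at_right 0)"
    and phi_cont: "continuous_on {0..} \<phi>"
    and phi_nonneg: "\<And>t. 0 \<le> t \<Longrightarrow> 0 \<le> \<phi> t"
    and phi_mono: "mono_on {0..} \<phi>"
    and phi_lim: "\<exists>L>0. (\<phi> \<longlongrightarrow> L) at_top"
    and phi_zero: "{t \<in> {0..}. \<phi> t = 0} = {0}"
    and phi_deriv: "(\<phi> has_real_derivative 1) (at_right 0)"
    and theta0_strict: "strict_mono_on {0..<1} (theta0 l Q \<omega>)"

text \<open>The extension of \<^const>\<open>theta0\<close> to \<open>[0,1]\<close>, whose value at \<open>1\<close> is the (possibly infinite)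
  left limit.\<close>

definition theta :: "(real \<Rightarrow> real) \<Rightarrow> (real \<Rightarrow> real) \<Rightarrow> (real \<Rightarrow> real) \<Rightarrow> real \<Rightarrow> ennreal" where
  "theta l Q \<omega> t =
     (if t < 1 then ennreal (theta0 l Q \<omega> t)
      else Lim (at_left 1) (\<lambda>\<tau>. ennreal (theta0 l Q \<omega> \<tau>)))"

text \<open>For \<open>u, v \<in> H\<^sup>1((0,1))\<close> the boundary conditions and the composition \<open>\<theta>(v)\<close> refer to the
  representatives that are continuous on \<open>[0,1]\<close>.\<close>

definition g_competitors :: "real \<Rightarrow> ((real \<Rightarrow> real) \<times> (real \<Rightarrow> real)) set" where
  "g_competitors s = {(u, v). u \<in> H1 0 1 \<and> v \<in> H1 0 1 \<and>
     continuous_on {0..1} u \<and> continuous_on {0..1} v \<and>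
     u 0 = 0 \<and> u 1 = s \<and> (\<forall>x\<in>{0..1}. 0 \<le> v x \<and> v x \<le> 1) \<and> v 0 = 1 \<and> v 1 = 1}"

text \<open>Here \<open>0 * \<infinity> = 0\<close>, as always in \<^typ>\<open>ennreal\<close>.\<close>

definition g :: "(real \<Rightarrow> real) \<Rightarrow> (real \<Rightarrow> real) \<Rightarrow> (real \<Rightarrow> real) \<Rightarrow> real \<Rightarrow> ennreal" where
  "g l Q \<omega> s = (INF (u, v)\<in>g_competitors s.
     \<integral>\<^sup>+ x. ennreal_sqrt (theta l Q \<omega> (v x) * ennreal (\<bar>weak_deriv 0 1 u x\<bar>\<^sup>2)
                         + ennreal (\<omega> (1 - v x) * \<bar>weak_deriv 0 1 v x\<bar>\<^sup>2))
       \<partial>lebesgue_on {0<..<1})"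

definition theta_ext ::
    "(real \<Rightarrow> real) \<Rightarrow> (real \<Rightarrow> real) \<Rightarrow> (real \<Rightarrow> real) \<Rightarrow> real \<Rightarrow> real \<Rightarrow> ennreal" where
  "theta_ext l Q \<omega> m t = theta l Q \<omega> (m + \<bar>t - m\<bar>)"

text \<open>The argument is \<open>r = 1 - t\<close>, so that \<open>\<omega>\<^sub>m(1 - t) = \<omega>(1 - m - \<bar>t - m\<bar>)\<close>.\<close>

definition omega_ext :: "(real \<Rightarrow> real) \<Rightarrow> real \<Rightarrow> real \<Rightarrow> real" where
  "omega_ext \<omega> m r = \<omega> (1 - m - \<bar>(1 - r) - m\<bar>)"

definition zeta :: "real \<Rightarrow> real \<Rightarrow> real \<Rightarrow> real" where
  "zeta m s t = s * (t - (2 * m - 1)) / (1 - (2 * m - 1))"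

definition G ::
    "(real \<Rightarrow> real) \<Rightarrow> (real \<Rightarrow> real) \<Rightarrow> (real \<Rightarrow> real) \<Rightarrow> real \<Rightarrow> (real \<Rightarrow> real) \<Rightarrow> ennreal" where
  "G l Q \<omega> m w =
     (\<integral>\<^sup>+ t. ennreal_sqrt (theta_ext l Q \<omega> m t * ennreal (\<bar>weak_deriv (2 * m - 1) 1 w t\<bar>\<^sup>2)
                          + ennreal (omega_ext \<omega> m (1 - t)))
        \<partial>lebesgue_on {2 * m - 1<..<1})"

end

theory Submission
  imports Defs
begin

text \<open>
  Given a competitor \<open>w\<close> of \<open>G\<^sub>m\<close>, truncate \<open>w'\<close> and repair its integral by a constant on an interval
  where \<open>\<theta>\<close> is bounded; the curve \<open>(w(t), m + |t - m|)\<close>, parametrized affinely on \<open>(0,1)\<close>, is then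
  admissible for \<open>g\<close> and has the same energy.

  Conversely, let \<open>\<Omega>\<close> be a primitive of \<open>\<omega>(1 - t)\<^sup>1\<^sup>/\<^sup>2\<close>. If \<open>v \<ge> \<tau>\<close> on \<open>[x,y]\<close>, then the energy of \<open>(u,v)\<close> on
  \<open>[x,y]\<close> is at least the norm of \<open>(\<theta>(\<tau>)\<^sup>1\<^sup>/\<^sup>2 (u(y) - u(x)), \<Omega>(v(y)) - \<Omega>(v(x)))\<close>. Cut the two branches of the curve
  at the first (last) times at which \<open>v\<close> reaches levels that are equidistant with respect to \<open>\<Omega>\<close>, and let a
  competitor of \<open>G\<^sub>m\<close> realize each increment of \<open>u\<close> on the level interval just below the one where
  it occurred. Since \<open>\<theta>\<close> increases, this costs no more than the curve, except for one additional
  level interval on each branch. This rearrangement needs neither monotonicity of \<open>v\<close> nor differentiability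
  almost everywhere. If \<open>v\<close> reaches \<open>0\<close>, the part of the curve below a small level \<open>\<mu>\<close> is replaced by a
  jump of cost \<open>O(\<theta>(\<mu>)\<^sup>1\<^sup>/\<^sup>2)\<close>.
\<close>

section \<open>Weak derivatives in dimension one\<close>

text \<open>The root in \<open>g\<close> is positively homogeneous of degree one in (u', v'), so the
  energy belongs to the curve and not to its parametrization; with v as parameter on either side of
  its minimum m, a curve becomes a graph over the levels, and its energy becomes \<open>G\<close> at
  m. The obstacle is that v need not be monotone on either side, so that u is no function of the
  level, and that \<theta> may be unbounded near 1. Shifting increments down by one level interval
  answers both: the topmost interval carries no slope, and every other one has an upper end below 1,
  at which \<theta> is finite. The price is a spare level below the minimum, which has to stay
  positive. Both branches use the same levels, hence end at the same m, as the even extension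
  requires. Since m = 0 and m = 1 are excluded, curves that touch 0 and curves with v identically 1
  are treated by a limit in the level. Truncation enters because \<open>g\<close> asks for u in H^1,
  whereas the derivative of a competitor of \<open>G\<close> is merely integrable.\<close>

lemma LINT_open_interval:
  fixes f :: "real \<Rightarrow> real"
  assumes "f \<in> borel_measurable borel"
  shows "(LINT x|lebesgue_on {a<..<b}. f x) = (LINT x|lborel. indicator {a<..<b} x * f x)"
proof -
  have "(LINT x|lebesgue_on {a<..<b}. f x) = (LINT x|lebesgue. indicator {a<..<b} x * f x)"
    by (subst integral_restrict_space) auto
  also have "\<dots> = (LINT x|lborel. indicator {a<..<b} x * f x)"
    using assms by (intro integral_completion) measurable
  finally show ?thesis .
qed

lemma AE_open_interval:
  "(AE x in lebesgue_on {a<..<b::real}. P x) \<longleftrightarrow> (AE x in lborel. x \<in> {a<..<b} \<longrightarrow> P x)"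
  by (subst AE_restrict_space_iff) (auto simp: AE_completion_iff)

lemma borel_measurable_lebesgue_on_borel:
  fixes f :: "real \<Rightarrow> real"
  assumes "f \<in> borel_measurable borel"
  shows "f \<in> borel_measurable (lebesgue_on S)"
proof -
  have "f \<in> borel_measurable lborel" using assms by simp
  then have "f \<in> borel_measurable lebesgue" by (rule measurable_completion)
  then show ?thesis by (rule measurable_restrict_space1)
qed

lemma Lp_on_1_iff: "p \<in> Lp_on 1 a b \<longleftrightarrow> integrable (lebesgue_on {a<..<b}) p"
  unfolding Lp_on_def by (auto intro: integrable_norm simp: integrable_abs_iff)

text \<open>Passing to a Borel function on the whole line that vanishes off the interval moves all
  later work to \<open>lborel\<close>, where Fubini, the fundamental theorem and affine substitution
  apply directly.\<close>

lemma Lp_on_1_representative: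
  assumes "p \<in> Lp_on 1 a b"
  obtains k where "integrable lborel k" "\<And>x. x \<notin> {a<..<b} \<Longrightarrow> k x = 0"
    "AE x in lebesgue_on {a<..<b}. p x = k x"
proof -
  define p0 where "p0 = (\<lambda>x. indicator {a<..<b} x * p x)"
  have "integrable lebesgue p0"
    using assms unfolding Lp_on_1_iff p0_def by (subst (asm) integrable_restrict_space) auto
  then obtain k0 where k0: "k0 \<in> borel_measurable lborel" "AE x in lborel. p0 x = k0 x"
    using completion_ex_borel_measurable_real by blast
  define k where "k = (\<lambda>x. indicator {a<..<b} x * k0 x)"
  have [measurable]: "k \<in> borel_measurable borel"
    using k0(1) unfolding k_def by simp
  have AE: "AE x in lborel. p0 x = k x"
    using k0(2) by eventually_elim (auto simp: k_def p0_def split: split_indicator_asm split_indicator)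
  have "integrable lebesgue k"
    using \<open>integrable lebesgue p0\<close>
  proof (rule integrable_cong_AE_imp)
    show "k \<in> borel_measurable lebesgue" by (rule measurable_completion) simp
    show "AE x in lebesgue. p0 x = k x" 
      using AE_completion[OF AE] by eventually_elim simp
  qed
  then have int: "integrable lborel k"
    using integrable_completion[of k lborel] by simp
  show thesis
  proof (rule that[OF int])
    show "AE x in lebesgue_on {a<..<b}. p x = k x"
      unfolding AE_open_interval using AE by eventually_elim (auto simp: k_def p0_def indicator_def)
  qed (auto simp: k_def)
qed

lemma test_function_deriv:
  assumes "\<psi> \<in> test_functions a b"
  obtains D where "continuous_on UNIV D" "\<And>x. (\<psi> has_real_derivative D x) (at x)" "deriv \<psi> = D"
    "\<And>x. x \<notin> {a<..<b} \<Longrightarrow> \<psi> x = 0" "\<And>x. x \<notin> {a<..<b} \<Longrightarrow> D x = 0"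
proof -
  from assms have C: "\<psi> C1_differentiable_on UNIV" and cl: "closure {x. \<psi> x \<noteq> 0} \<subseteq> {a<..<b}"
    unfolding test_functions_def by auto
  obtain D where D: "\<And>x. (\<psi> has_vector_derivative D x) (at x)" "continuous_on UNIV D"
    using C unfolding C1_differentiable_on_def by auto
  have d: "(\<psi> has_real_derivative D x) (at x)" for x
    using D(1)[of x] by (simp add: has_real_derivative_iff_has_vector_derivative)
  have z: "\<psi> x = 0" if "x \<notin> {a<..<b}" for x
    using that cl closure_subset[of "{x. \<psi> x \<noteq> 0}"] by auto
  have "D x = 0" if "x \<notin> {a<..<b}" for x
  proof -
    have "((\<lambda>x. 0) has_real_derivative D x) (at x)"
    proof (rule has_field_derivative_transform_within_open[OF d])
      show "open (- closure {x. \<psi> x \<noteq> 0})" by auto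
      show "x \<in> - closure {x. \<psi> x \<noteq> 0}" using that cl by auto
      show "\<And>x. x \<in> - closure {x. \<psi> x \<noteq> 0} \<Longrightarrow> \<psi> x = 0"
        using closure_subset[of "{x. \<psi> x \<noteq> 0}"] by auto
    qed
    then show ?thesis using DERIV_unique DERIV_const by blast
  qed
  moreover have "deriv \<psi> = D" using d by (auto intro: DERIV_imp_deriv)
  ultimately show thesis using that D(2) d z by blast
qed

lemma continuous_support_bounded:
  fixes D :: "real \<Rightarrow> real"
  assumes "continuous_on UNIV D" "\<And>x. x \<notin> {a<..<b} \<Longrightarrow> D x = 0"
  obtains B where "0 \<le> B" "\<And>x. \<bar>D x\<bar> \<le> B"
proof -
  have "compact (D ` {a..b})"
    using assms(1) by (intro compact_continuous_image continuous_on_subset[OF assms(1)]) auto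
  then obtain B where B: "\<And>x. x \<in> {a..b} \<Longrightarrow> \<bar>D x\<bar> \<le> B"
    by (force dest!: compact_imp_bounded simp: bounded_iff)
  have "\<bar>D x\<bar> \<le> max B 0" for x
    using B[of x] assms(2)[of x] by (cases "x \<in> {a<..<b}") (auto simp: max_def intro: order_trans)
  then show thesis using that[of "max B 0"] by auto
qed

section \<open>Integrability of products, primitives and integration by parts\<close>

lemma integrable_bounded_mult:
  fixes f k :: "'a \<Rightarrow> real"
  assumes "integrable M k" "f \<in> borel_measurable M" "\<And>x. \<bar>f x\<bar> \<le> B"
  shows "integrable M (\<lambda>x. f x * k x)"
proof (rule Bochner_Integration.integrable_bound)
  show "integrable M (\<lambda>x. B * k x)" using assms by simp
  have "\<bar>f x * k x\<bar> \<le> \<bar>B * k x\<bar>" for x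
    using mult_right_mono[OF order_trans[OF assms(3)[of x] abs_ge_self], of "\<bar>k x\<bar>"] by (simp add: abs_mult)
  then show "AE x in M. norm (f x * k x) \<le> norm (B * k x)" by simp
qed (use assms in auto)

lemma integrable_indicator_continuous:
  fixes f :: "real \<Rightarrow> real"
  assumes "continuous_on {a..b} f"
  shows "integrable lborel (\<lambda>x. indicator {a<..<b} x * f x)"
proof -
  have "set_integrable lborel {a..b} f"
    using assms unfolding set_integrable_def by (intro borel_integrable_compact) auto
  then have "set_integrable lborel {a<..<b} f"
    by (rule set_integrable_subset) auto
  then show ?thesis by (simp add: set_integrable_def)
qed

text \<open>Integrating from minus infinity avoids any dependence on an interval or on the order of
  end points. For k supported in (a,b) the primitive is 0 up to a and equals the total integral from
  b on.\<close>

definition primitive :: "(real \<Rightarrow> real) \<Rightarrow> real \<Rightarrow> real" where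
  "primitive k t = (LINT x|lborel. indicator {..t} x * k x)"

lemma integrable_indicator_mult:
  fixes k :: "real \<Rightarrow> real"
  assumes "integrable lborel k" "A \<in> sets borel"
  shows "integrable lborel (\<lambda>x. indicator A x * k x)"
  by (rule integrable_bounded_mult[where B=1 and f="indicator A" and k=k]) (use assms in \<open>auto simp: indicator_def\<close>)

lemma primitive_diff:
  assumes "integrable lborel k" "x \<le> y"
  shows "primitive k y - primitive k x = (LINT t|lborel. indicator {x<..y} t * k t)"
  unfolding primitive_def
  by (subst Bochner_Integration.integral_diff[symmetric])
     (use assms in \<open>auto intro!: integrable_indicator_mult Bochner_Integration.integral_cong split: split_indicator\<close>)

lemma primitive_continuous:
  assumes "integrable lborel k"
  shows "continuous_on UNIV (primitive k)"
proof -
  have "(\<lambda>n. primitive k (X n)) \<longlonglongrightarrow> primitive k x" if X: "X \<longlonglongrightarrow> x" for X x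
    unfolding primitive_def
  proof (rule integral_dominated_convergence[where w="\<lambda>x. \<bar>k x\<bar>"])
    \<comment> \<open>At t = x the indicator may keep switching along the sequence, but a single
      point is a null set.\<close>
    have lim: "(\<lambda>n. indicator {..X n} t * k t) \<longlonglongrightarrow> indicator {..x} t * k t" if "t \<noteq> x" for t
    proof (cases "t < x")
      case True
      then have "eventually (\<lambda>n. t < X n) sequentially" using X by (simp add: order_tendsto_iff)
      then have "eventually (\<lambda>n. indicator {..X n} t * k t = indicator {..x} t * k t) sequentially"
        by eventually_elim (use True in auto)
      then show ?thesis by (rule tendsto_eventually)
    next
      case False
      then have "eventually (\<lambda>n. X n < t) sequentially" using X that by (simp add: order_tendsto_iff)
      then have "eventually (\<lambda>n. indicator {..X n} t * k t = indicator {..x} t * k t) sequentially"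
        by eventually_elim (use False that in auto)
      then show ?thesis by (rule tendsto_eventually)
    qed
    show "AE t in lborel. (\<lambda>n. indicator {..X n} t * k t) \<longlonglongrightarrow> indicator {..x} t * k t"
      using AE_lborel_singleton[of x] by eventually_elim (rule lim)
  qed (use assms in \<open>auto intro!: borel_measurable_integrable integrable_indicator_mult split: split_indicator\<close>)
  then show ?thesis
    by (simp add: continuous_on_sequentially o_def)
qed

text \<open>Integration by parts as an application of Fubini's theorem on the triangle \<open>x \<le> t\<close>.\<close>

lemma has_weak_deriv_prim:
  assumes k: "integrable lborel k" "\<And>x. x \<notin> {a<..<b} \<Longrightarrow> k x = 0" and "a < b"
    and u: "\<And>x. x \<in> {a<..<b} \<Longrightarrow> u x = c + primitive k x"
  shows "has_weak_deriv a b u k"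
  unfolding has_weak_deriv_def
proof
  fix \<psi> assume "\<psi> \<in> test_functions a b"
  then obtain D where D: "continuous_on UNIV D" "\<And>x. (\<psi> has_real_derivative D x) (at x)" "deriv \<psi> = D"
    "\<And>x. x \<notin> {a<..<b} \<Longrightarrow> \<psi> x = 0" "\<And>x. x \<notin> {a<..<b} \<Longrightarrow> D x = 0"
    by (blast elim: test_function_deriv)
  obtain B where B: "0 \<le> B" "\<And>x. \<bar>D x\<bar> \<le> B" using continuous_support_bounded[OF D(1,5)] by auto
  have [measurable]: "D \<in> borel_measurable borel" "k \<in> borel_measurable borel" "primitive k \<in> borel_measurable borel"
    using D(1) k primitive_continuous[OF k(1)] by (auto intro: borel_measurable_continuous_onI)
  have [measurable]: "\<psi> \<in> borel_measurable borel"
    using D(2) by (intro borel_measurable_continuous_onI continuous_at_imp_continuous_on)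
      (auto intro: DERIV_isCont)
  have Dint: "integrable lborel D"
    using integrable_indicator_continuous[of a b D] D(1,5)
    by (rule_tac Bochner_Integration.integrable_cong[THEN iffD1, rotated 2, OF integrable_indicator_continuous[of a b D]])
       (auto simp: indicator_def intro: continuous_on_subset)
  have FTC: "(LINT t|lborel. indicator {x..} t * D t) = - \<psi> x" if "x \<in> {a<..<b}" for x
  proof -
    have "(LINT t|lborel. indicator {x..} t * D t) = (LINT t|lborel. D t * indicator {x..b} t)"
      using D(5) that by (intro Bochner_Integration.integral_cong) (auto simp: indicator_def)
    also have "\<dots> = \<psi> b - \<psi> x"
      using that D(1) by (intro integral_FTC_Icc_real D(2)) (auto simp: continuous_on_eq_continuous_at)
    finally show ?thesis using D(4)[of b] by simp
  qed
  \<comment> \<open>Mean zero of D is what removes the constant c, about which k contains no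
    information.\<close>
  have D0: "(LINT t|lborel. D t) = 0"
  proof -
    have "(LINT t|lborel. D t) = (LINT t|lborel. D t * indicator {a..b} t)"
      by (intro Bochner_Integration.integral_cong refl) (use D(5) in \<open>fastforce split: split_indicator\<close>)
    also have "\<dots> = \<psi> b - \<psi> a"
      using \<open>a < b\<close> D(1) by (intro integral_FTC_Icc_real D(2)) (auto simp: continuous_on_eq_continuous_at)
    finally show ?thesis using D(4)[of b] D(4)[of a] by simp
  qed
  let ?F = "\<lambda>x t. indicator {..t} x * (k x * D t)"
  have F: "integrable (lborel \<Otimes>\<^sub>M lborel) (case_prod ?F)"
  proof (rule Bochner_Integration.integrable_bound)
    show "integrable (lborel \<Otimes>\<^sub>M lborel) (\<lambda>(x, t). k x * D t)"
    proof (rule lborel_pair.Fubini_integrable)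
      show "AE x in lborel. integrable lborel (\<lambda>y. case (x, y) of (x, t) \<Rightarrow> k x * D t)"
        using Dint by auto
      show "integrable lborel (\<lambda>x. LINT y|lborel. norm (case (x, y) of (x, t) \<Rightarrow> k x * D t))"
        using k Dint by (simp add: abs_mult)
    qed measurable
    have "(\<lambda>z::real\<times>real. indicator {z. fst z \<le> snd z} z * (k (fst z) * D (snd z)) :: real)
       \<in> borel_measurable (lborel \<Otimes>\<^sub>M lborel)"
      by measurable
    also have "(\<lambda>z::real\<times>real. indicator {z. fst z \<le> snd z} z * (k (fst z) * D (snd z))) = case_prod ?F"
      by (auto simp: fun_eq_iff indicator_def)
    finally show "case_prod ?F \<in> borel_measurable (lborel \<Otimes>\<^sub>M lborel)" .
  qed (auto simp: indicator_def)
  have "(LINT x|lebesgue_on {a<..<b}. u x * deriv \<psi> x) = (LINT x|lebesgue_on {a<..<b}. (c + primitive k x) * D x)"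
    unfolding D(3) by (intro Bochner_Integration.integral_cong) (auto simp: u)
  also have "\<dots> = (LINT t|lborel. indicator {a<..<b} t * ((c + primitive k t) * D t))"
    by (rule LINT_open_interval) measurable
  also have "\<dots> = (LINT t|lborel. c * D t + (LINT x|lborel. ?F x t))"
  proof (rule Bochner_Integration.integral_cong[OF refl])
    fix t
    have "(LINT x|lborel. ?F x t) = (LINT x|lborel. D t * (indicator {..t} x * k x))"
      by (intro Bochner_Integration.integral_cong) auto
    also have "\<dots> = D t * primitive k t" unfolding primitive_def by simp
    finally show "indicator {a<..<b} t * ((c + primitive k t) * D t) = c * D t + (LINT x|lborel. ?F x t)"
      using D(5)[of t] by (auto simp: indicator_def algebra_simps)
  qed
  also have "\<dots> = (LINT t|lborel. (LINT x|lborel. ?F x t))"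
    using lborel_pair.integrable_snd[OF F] Dint D0 by simp
  also have "\<dots> = (LINT x|lborel. (LINT t|lborel. ?F x t))"
    by (rule lborel_pair.Fubini_integral[OF F])
  also have "\<dots> = (LINT x|lborel. - (indicator {a<..<b} x * (k x * \<psi> x)))"
  proof (rule Bochner_Integration.integral_cong[OF refl])
    fix x
    have "(LINT t|lborel. ?F x t) = (LINT t|lborel. k x * (indicator {x..} t * D t))"
      by (intro Bochner_Integration.integral_cong) (auto simp: indicator_def)
    also have "\<dots> = k x * (LINT t|lborel. indicator {x..} t * D t)" by simp
    finally show "(LINT t|lborel. ?F x t) = - (indicator {a<..<b} x * (k x * \<psi> x))"
      using FTC[of x] k(2)[of x] by (auto simp: indicator_def)
  qed
  also have "\<dots> = - (LINT x|lebesgue_on {a<..<b}. k x * \<psi> x)"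
    by (subst LINT_open_interval) auto
  finally show "(LINT x|lebesgue_on {a<..<b}. u x * deriv \<psi> x) = - (LINT x|lebesgue_on {a<..<b}. k x * \<psi> x)" .
qed

section \<open>The lemma of du Bois-Reymond\<close>

lemma integrable_continuous_support:
  fixes f :: "real \<Rightarrow> real"
  assumes "continuous_on UNIV f" "\<And>x. x \<notin> {c..d} \<Longrightarrow> f x = 0"
  shows "integrable lborel f"
proof -
  have "integrable lborel (\<lambda>x. indicator {c-1<..<d+1} x * f x)"
    using assms(1) by (intro integrable_indicator_continuous) (auto intro: continuous_on_subset)
  also have "(\<lambda>x. indicator {c-1<..<d+1} x * f x) = f"
    using assms(2) by (force split: split_indicator)
  finally show ?thesis .
qed

text \<open>The primitive vanishes to the left of the support of q by construction and to its right
  because q has mean zero. Test functions are thus built from their derivatives.\<close>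

lemma test_function_of_deriv:
  assumes q: "continuous_on UNIV q" "\<And>x. x \<notin> {c..d} \<Longrightarrow> q x = 0" "(LINT x|lborel. q x) = 0"
    and cd: "a < c" "d < b"
  shows "primitive q \<in> test_functions a b" "\<And>x. (primitive q has_real_derivative q x) (at x)"
proof -
  have int: "integrable lborel q" using q(1,2) by (rule integrable_continuous_support)
  have "\<exists>F. \<forall>x :: real. - \<infinity> < ereal x \<longrightarrow> ereal x < \<infinity> \<longrightarrow> (F has_vector_derivative q x) (at x)"
    using q(1) by (intro einterval_antiderivative) (auto simp: continuous_on_eq_continuous_at)
  then obtain F where F: "\<And>x. (F has_real_derivative q x) (at x)"
    by (auto simp: has_real_derivative_iff_has_vector_derivative)
  have inc: "primitive q y - primitive q x = F y - F x" if "x \<le> y" for x y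
  proof -
    have "primitive q y - primitive q x = (LINT t|lborel. indicator {x<..y} t * q t)"
      by (rule primitive_diff[OF int that])
    also have "\<dots> = (LINT t|lborel. q t * indicator {x..y} t)"
    proof (rule integral_cong_AE)
      show "AE t in lborel. indicator {x<..y} t * q t = q t * indicator {x..y} t"
        using AE_lborel_singleton[of x] by eventually_elim (auto split: split_indicator)
    qed (use int in auto)
    also have "\<dots> = F y - F x"
      using that q(1) by (intro integral_FTC_Icc_real F) (auto simp: continuous_on_eq_continuous_at)
    finally show ?thesis .
  qed
  have "primitive q = (\<lambda>x. F x + (primitive q c - F c))"
  proof
    fix x show "primitive q x = F x + (primitive q c - F c)"
      using inc[of x c] inc[of c x] by (cases "x \<le> c") auto
  qed
  moreover have "((\<lambda>x. F x + (primitive q c - F c)) has_real_derivative q x) (at x)" for x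
    using F by (auto intro!: derivative_eq_intros)
  ultimately show d: "(primitive q has_real_derivative q x) (at x)" for x
    by simp
  have z1: "primitive q x = 0" if "x < c" for x
  proof -
    have "indicator {..x} t * q t = 0" for t using that q(2)[of t] by (auto split: split_indicator)
    then show ?thesis unfolding primitive_def by (simp only: Bochner_Integration.integral_zero)
  qed
  have z2: "primitive q x = 0" if "d < x" for x
  proof -
    have "indicator {..x} t * q t = q t" for t using that q(2)[of t] by (auto split: split_indicator)
    then show ?thesis unfolding primitive_def using q(3) by (simp only:)
  qed
  have "closure {x. primitive q x \<noteq> 0} \<subseteq> {c..d}"
    by (rule closure_minimal) (use z1 z2 in \<open>force simp: not_le\<close>)+
  then have "closure {x. primitive q x \<noteq> 0} \<subseteq> {a<..<b}" using cd by auto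
  moreover have "primitive q C1_differentiable_on UNIV"
    unfolding C1_differentiable_on_def using d q(1)
    by (auto simp: has_real_derivative_iff_has_vector_derivative)
  ultimately show "primitive q \<in> test_functions a b" by (simp add: test_functions_def)
qed

lemma continuous_nonneg_integral_0:
  fixes f :: "real \<Rightarrow> real"
  assumes "continuous_on UNIV f" "\<And>x. 0 \<le> f x" "\<And>x. x \<notin> {c..d} \<Longrightarrow> f x = 0"
    "(LINT x|lborel. f x) = 0"
  shows "f x = 0"
proof (cases "c < d \<and> x \<in> {c..d}")
  case True
  have "(LINT x|lborel. f x) = (LINT x:{c..d}|lborel. f x)"
    unfolding set_lebesgue_integral_def using assms(3)
    by (intro Bochner_Integration.integral_cong) (auto split: split_indicator)
  also have "\<dots> = integral {c..d} f"
  proof (rule set_borel_integral_eq_integral(2))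
    show "set_integrable lborel {c..d} f"
      unfolding set_integrable_def using assms(1)
      by (intro borel_integrable_compact) (auto intro: continuous_on_subset)
  qed
  finally have "integral (cbox c d) f = 0" using assms(4) by simp
  then have "\<forall>x\<in>cbox c d. f x = 0"
    using integral_cbox_eq_0_iff[of c d f] assms(1,2) True by (auto intro: continuous_on_subset)
  then show ?thesis using True by auto
next
  case False
  \<comment> \<open>This case covers points outside the interval and a degenerate interval: f
    vanishes on a right neighbourhood of x, hence at x by continuity.\<close>
  have off: "f y = 0" if "y < c \<or> d < y" for y using assms(3)[of y] that by auto
  have le: "d \<le> c \<or> x \<notin> {c..d}" using False by auto
  have "isCont f x" using assms(1) by (auto simp: continuous_on_eq_continuous_at)
  then have "(f \<longlongrightarrow> f x) (at_right x)" by (auto simp: isCont_def intro: filterlim_at_split[THEN iffD1, THEN conjunct2])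
  moreover have "eventually (\<lambda>y. f y = 0) (at_right x)"
    using le off by (intro eventually_at_rightI[of x "if x < c then c else x+1"]) (auto split: if_splits)
  then have "(f \<longlongrightarrow> 0) (at_right x)" by (rule tendsto_eventually)
  ultimately show ?thesis using tendsto_unique trivial_limit_at_right_real by blast
qed

text \<open>Continuity suffices: the bump only enters derivatives of test functions, and these
  functions have to be of class C^1 only.\<close>

definition bump :: "real \<Rightarrow> real \<Rightarrow> real \<Rightarrow> real" where
  "bump c d t = max 0 ((t - c) * (d - t))"

lemma bump_continuous: "continuous_on A (bump c d)"
  unfolding bump_def by (intro continuous_intros)

lemma bump_support: "x \<notin> {c..d} \<Longrightarrow> c \<le> d \<Longrightarrow> bump c d x = 0"
  unfolding bump_def by (auto simp: max_def mult_less_0_iff zero_le_mult_iff not_le)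

lemma bump_pos: "c < x \<Longrightarrow> x < d \<Longrightarrow> 0 < bump c d x"
  unfolding bump_def by (auto simp: max_def not_le)

lemma bump_nonneg: "0 \<le> bump c d x" by (simp add: bump_def)

lemma bump_integral: assumes "c < d" shows "(LINT x|lborel. bump c d x) > 0"
proof -
  have "(LINT x|lborel. bump c d x) \<noteq> 0"
  proof
    assume "(LINT x|lborel. bump c d x) = 0"
    then have "bump c d ((c+d)/2) = 0"
      using assms by (intro continuous_nonneg_integral_0[OF bump_continuous bump_nonneg bump_support]) auto
    then show False using assms bump_pos[of c "(c+d)/2" d] by auto
  qed
  moreover have "(LINT x|lborel. bump c d x) \<ge> 0" by (intro integral_nonneg_AE) (auto simp: bump_nonneg)
  ultimately show ?thesis by simp
qed

text \<open>The classical argument of du Bois-Reymond: the test function whose derivative is a weight times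
  the deviation of \<open>u - U\<close> from its weighted mean shows that this deviation vanishes.\<close>

lemma weak_deriv_increment:
  assumes u: "continuous_on {a..b} u" "has_weak_deriv a b u k"
    and k: "integrable lborel k" "\<And>x. x \<notin> {a<..<b} \<Longrightarrow> k x = 0"
    and xy: "x \<in> {a..b}" "y \<in> {a..b}"
  shows "u y - u x = primitive k y - primitive k x"
proof (cases "a < b")
  case False
  then have "x = y" using xy by auto
  then show ?thesis by simp
next
  case True
  define d where "d t = u t - primitive k t" for t
  have dc: "continuous_on {a..b} d"
    unfolding d_def using u(1) primitive_continuous[OF k(1)]
    by (auto intro!: continuous_intros intro: continuous_on_subset)
  have eq: "d x = d y" if "a < x" "x < y" "y < b" for x y
  proof -
    define a' where "a' = (a + x) / 2"
    define b' where "b' = (y + b) / 2"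
    have ab: "a < a'" "a' < x" "y < b'" "b' < b" using that by (auto simp: a'_def b'_def)
    then have "a' < b'" using that by linarith
    \<comment> \<open>Clamping the argument extends d continuously to the line, so that q below is
      continuous everywhere; nothing changes on [a,b].\<close>
    define e where "e t = d (max a (min b t))" for t
    have ec: "continuous_on UNIV e"
      unfolding e_def using True
      by (intro continuous_on_compose2[OF dc] continuous_intros) auto
    have ed: "e t = d t" if "t \<in> {a..b}" for t using that by (simp add: e_def)
    let ?\<chi> = "bump a' b'"
    \<comment> \<open>The mean of e with weight \<open>bump a' b'\<close>, chosen to give q mean
      zero.\<close>
    define c where "c = (LINT t|lborel. ?\<chi> t * e t) / (LINT t|lborel. ?\<chi> t)"
    define q where "q t = ?\<chi> t * (e t - c)" for t
    have \<chi>i: "integrable lborel ?\<chi>" "integrable lborel (\<lambda>t. ?\<chi> t * e t)"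
      using \<open>a' < b'\<close> bump_support[of _ a' b']
      by (auto intro!: integrable_continuous_support[of _ a' b'] continuous_intros bump_continuous ec)
    have qc: "continuous_on UNIV q" unfolding q_def by (intro continuous_intros bump_continuous ec)
    have q0: "q t = 0" if "t \<notin> {a'..b'}" for t
      using bump_support[OF that] \<open>a' < b'\<close> by (simp add: q_def)
    have "(LINT t|lborel. q t) = (LINT t|lborel. ?\<chi> t * e t) - c * (LINT t|lborel. ?\<chi> t)"
      using \<chi>i by (simp add: q_def algebra_simps)
    also have "\<dots> = 0" using bump_integral[OF \<open>a' < b'\<close>] by (simp add: c_def)
    finally have qi: "(LINT t|lborel. q t) = 0" .
    note T = test_function_of_deriv[OF qc q0 qi ab(1,4)]
    have dq: "deriv (primitive q) = q" using T(2) by (auto intro: DERIV_imp_deriv)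
    have qm [measurable]: "q \<in> borel_measurable borel" using qc by (rule borel_measurable_continuous_onI)
    have 1: "(LINT t|lebesgue_on {a<..<b}. u t * q t) = (LINT t|lebesgue_on {a<..<b}. primitive k t * q t)"
    proof -
      have "has_weak_deriv a b (primitive k) k" using has_weak_deriv_prim[OF k True, of "primitive k" 0] by simp
      then show ?thesis using u(2) T(1) dq unfolding has_weak_deriv_def by metis
    qed
    have pm [measurable]: "primitive k \<in> borel_measurable borel"
      using primitive_continuous[OF k(1)] by (rule borel_measurable_continuous_onI)
    have em [measurable]: "e \<in> borel_measurable borel" using ec by (rule borel_measurable_continuous_onI)
    have 2: "(LINT t|lebesgue_on {a<..<b}. u t * q t) = (LINT t|lborel. e t * q t + primitive k t * q t)"
    proof -
      have "(LINT t|lebesgue_on {a<..<b}. u t * q t) = (LINT t|lebesgue_on {a<..<b}. (e t + primitive k t) * q t)"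
        by (intro Bochner_Integration.integral_cong refl) (auto simp: ed d_def)
      also have "\<dots> = (LINT t|lborel. indicator {a<..<b} t * ((e t + primitive k t) * q t))"
        by (rule LINT_open_interval) measurable
      also have "\<dots> = (LINT t|lborel. e t * q t + primitive k t * q t)"
        by (intro Bochner_Integration.integral_cong refl)
           (use q0 ab in \<open>auto split: split_indicator simp: algebra_simps\<close>)
      finally show ?thesis .
    qed
    have 3: "(LINT t|lebesgue_on {a<..<b}. primitive k t * q t) = (LINT t|lborel. primitive k t * q t)"
    proof -
      have "(LINT t|lebesgue_on {a<..<b}. primitive k t * q t) = (LINT t|lborel. indicator {a<..<b} t * (primitive k t * q t))"
        by (rule LINT_open_interval) measurable
      also have "\<dots> = (LINT t|lborel. primitive k t * q t)"
        by (intro Bochner_Integration.integral_cong refl)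
           (use q0 ab in \<open>auto split: split_indicator simp: algebra_simps\<close>)
      finally show ?thesis .
    qed
    have i: "integrable lborel (\<lambda>t. e t * q t)" "integrable lborel (\<lambda>t. primitive k t * q t)" "integrable lborel q"
      using q0 by (auto intro!: integrable_continuous_support[of _ a' b'] continuous_intros qc ec primitive_continuous k)
    have "(LINT t|lborel. e t * q t) = 0" using 1 2 3 i by simp
    then have "(LINT t|lborel. e t * q t - c * q t) = 0" using i qi by simp
    \<comment> \<open>Both \<open>e * q\<close> and q integrate to 0, and this combination is the
      weight times a square, hence vanishes pointwise.\<close>
    moreover have "e t * q t - c * q t = ?\<chi> t * (e t - c)^2" for t
      by (simp add: q_def power2_eq_square algebra_simps)
    ultimately have z: "(LINT t|lborel. ?\<chi> t * (e t - c)^2) = 0" by (simp only:)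
    have *: "?\<chi> t * (e t - c)^2 = 0" for t
    proof (rule continuous_nonneg_integral_0[OF _ _ _ z])
      show "continuous_on UNIV (\<lambda>t. ?\<chi> t * (e t - c)^2)"
        by (intro continuous_intros bump_continuous ec)
      show "0 \<le> ?\<chi> t * (e t - c)^2" for t by (simp add: bump_nonneg)
      show "?\<chi> t * (e t - c)^2 = 0" if "t \<notin> {a'..b'}" for t
        using bump_support[OF that] \<open>a' < b'\<close> by simp
    qed
    have "e x = c" using *[of x] bump_pos[of a' x b'] ab that by auto
    moreover have "e y = c" using *[of y] bump_pos[of a' y b'] ab that by auto
    ultimately show ?thesis using ed that by auto
  qed
  have "d x = d y" if "x \<in> {a<..<b}" "y \<in> {a<..<b}" for x y
    using eq[of x y] eq[of y x] that by (cases x y rule: linorder_cases) auto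
  moreover have "(a+b)/2 \<in> {a<..<b}" using True by simp
  ultimately have "d t = d ((a+b)/2)" if "t \<in> {a<..<b}" for t using that by blast
  note const = this
  have "d t = d ((a+b)/2)" if "t \<in> closure {a<..<b}" for t
  proof (rule continuous_constant_on_closure[OF _ const that])
    show "continuous_on (closure {a<..<b}) d" using dc True by simp
  qed
  moreover have "x \<in> closure {a<..<b}" "y \<in> closure {a<..<b}" using xy True by auto
  ultimately have "d x = d y" by metis
  then show ?thesis by (simp add: d_def)
qed

section \<open>Uniqueness of weak derivatives and Sobolev representatives\<close>

lemma AE_zero_of_prim:
  assumes k: "integrable lborel k" "\<And>x. primitive k x = 0"
  shows "AE x in lborel. k x = 0"
proof -
  let ?p = "\<lambda>x. ennreal (max 0 (k x))" and ?n = "\<lambda>x. ennreal (max 0 (- k x))"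
  have [measurable]: "k \<in> borel_measurable borel" using k by auto
  have ip: "integrable lborel (\<lambda>x. max 0 (k x))" "integrable lborel (\<lambda>x. max 0 (- k x))"
    using k by auto
  \<comment> \<open>The uniqueness criterion for measures used below tests half lines {y<..}, the
    complements of those in \<open>primitive\<close>; this needs the total integral as well.\<close>
  have tot: "(LINT x|lborel. k x) = 0"
  proof -
    have "(\<lambda>n. LINT t|lborel. indicator {..real n} t * k t) \<longlonglongrightarrow> (LINT t|lborel. k t)"
    proof (rule integral_dominated_convergence[where w="\<lambda>x. \<bar>k x\<bar>"])
      have "(\<lambda>n. indicator {..real n} t * k t) \<longlonglongrightarrow> k t" for t
      proof (rule tendsto_eventually)
        show "eventually (\<lambda>n. indicator {..real n} t * k t = k t) sequentially"
          using eventually_ge_at_top[of "nat \<lceil>t\<rceil>"]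
          by eventually_elim (auto split: split_indicator simp: nat_le_iff ceiling_le_iff)
      qed
      then show "AE t in lborel. (\<lambda>n. indicator {..real n} t * k t) \<longlonglongrightarrow> k t"
        by blast
    qed (use k in \<open>auto split: split_indicator\<close>)
    then have "(\<lambda>n. 0) \<longlonglongrightarrow> (LINT t|lborel. k t)" using k(2) by (simp add: primitive_def)
    then show ?thesis by (simp add: LIMSEQ_const_iff)
  qed
  have em: "emeasure (density lborel (\<lambda>x. ennreal (max 0 (h x)))) {y<..} =
      ennreal (LINT x|lborel. indicator {y<..} x * max 0 (h x))"
    if "integrable lborel h" for y and h :: "real \<Rightarrow> real"
  proof -
    have [measurable]: "h \<in> borel_measurable borel" using that by auto
    have "emeasure (density lborel (\<lambda>x. ennreal (max 0 (h x)))) {y<..} =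
      (\<integral>\<^sup>+x. ennreal (indicator {y<..} x * max 0 (h x)) \<partial>lborel)"
      by (subst emeasure_density) (auto intro!: nn_integral_cong split: split_indicator)
    also have "\<dots> = ennreal (LINT x|lborel. indicator {y<..} x * max 0 (h x))"
      by (intro nn_integral_eq_integral integrable_indicator_mult) (use that in auto)
    finally show ?thesis .
  qed
  have eq: "(LINT x|lborel. indicator {y<..} x * max 0 (k x)) = (LINT x|lborel. indicator {y<..} x * max 0 (- k x))" for y
  proof -
    have "(LINT x|lborel. indicator {y<..} x * max 0 (k x)) - (LINT x|lborel. indicator {y<..} x * max 0 (- k x))
       = (LINT x|lborel. k x - indicator {..y} x * k x)"
      by (subst Bochner_Integration.integral_diff[symmetric])
         (use ip in \<open>auto intro!: integrable_indicator_mult Bochner_Integration.integral_cong split: split_indicator\<close>)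
    also have "\<dots> = (LINT x|lborel. k x) - primitive k y"
      unfolding primitive_def using k by (intro Bochner_Integration.integral_diff integrable_indicator_mult) auto
    finally show ?thesis using tot k(2) by simp
  qed
  \<comment> \<open>The positive and the negative part of k, taken as densities, give the same
    finite mass to every half line, hence define the same measure, and densities are unique almost
    everywhere.\<close>
  have "density lborel ?p = density lborel ?n"
    by (rule measure_eqI_lessThan) (use em[OF k(1)] em[of "\<lambda>x. - k x"] k(1) eq in auto)
  then have "AE x in lborel. ?p x = ?n x"
    by (intro sigma_finite_measure.density_unique[OF lborel.sigma_finite_measure_axioms]) auto
  then show ?thesis
  proof eventually_elim
    case (elim x)
    then have "max 0 (k x) = max 0 (- k x)" by (subst (asm) ennreal_inj) auto
    then show ?case by linarith
  qed
qed

text \<open>The zero function has weak derivative k - k', so the primitive of the difference is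
  constant on [a,b]. The support condition makes it 0 on the whole line.\<close>

lemma weak_deriv_unique:
  assumes "a < b" "has_weak_deriv a b u k" "has_weak_deriv a b u k'"
    and k: "integrable lborel k" "\<And>x. x \<notin> {a<..<b} \<Longrightarrow> k x = 0"
    and k': "integrable lborel k'" "\<And>x. x \<notin> {a<..<b} \<Longrightarrow> k' x = 0"
  shows "AE x in lborel. k x = k' x"
proof -
  define f where "f x = k x - k' x" for x
  have f: "integrable lborel f" "\<And>x. x \<notin> {a<..<b} \<Longrightarrow> f x = 0" using k k' by (auto simp: f_def[abs_def])
  have "has_weak_deriv a b (\<lambda>x. 0) f"
    unfolding has_weak_deriv_def
  proof
    fix \<psi> assume \<psi>: "\<psi> \<in> test_functions a b"
    obtain D where D: "\<And>x. (\<psi> has_real_derivative D x) (at x)" "\<And>x. x \<notin> {a<..<b} \<Longrightarrow> \<psi> x = 0"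
      using test_function_deriv[OF \<psi>] by metis
    have c: "continuous_on UNIV \<psi>" using D(1) by (auto intro!: continuous_at_imp_continuous_on DERIV_isCont)
    then have [measurable]: "\<psi> \<in> borel_measurable borel" by (rule borel_measurable_continuous_onI)
    obtain B where B: "0 \<le> B" "\<And>x. \<bar>\<psi> x\<bar> \<le> B" using continuous_support_bounded[OF c D(2)] by auto
    have [measurable]: "k \<in> borel_measurable borel" "k' \<in> borel_measurable borel" using k k' by auto
    have i: "integrable lborel (\<lambda>x. \<psi> x * k x)" "integrable lborel (\<lambda>x. \<psi> x * k' x)"
      using k k' B by (auto intro!: integrable_bounded_mult[where B=B])
    have "(LINT x|lebesgue_on {a<..<b}. k x * \<psi> x) = (LINT x|lebesgue_on {a<..<b}. k' x * \<psi> x)"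
      using assms(2,3) \<psi> unfolding has_weak_deriv_def by auto
    then have "(LINT x|lborel. indicator {a<..<b} x * (k x * \<psi> x)) = (LINT x|lborel. indicator {a<..<b} x * (k' x * \<psi> x))"
      by (subst (asm) (1 2) LINT_open_interval) auto
    moreover have "indicator {a<..<b} x * (k x * \<psi> x) = \<psi> x * k x"
      "indicator {a<..<b} x * (k' x * \<psi> x) = \<psi> x * k' x" "indicator {a<..<b} x * (f x * \<psi> x) = \<psi> x * k x - \<psi> x * k' x" for x
      using k(2)[of x] k'(2)[of x] by (auto simp: f_def algebra_simps split: split_indicator)
    ultimately have "(LINT x|lborel. indicator {a<..<b} x * (f x * \<psi> x)) = 0"
      using i by simp
    moreover have [measurable]: "f \<in> borel_measurable borel" using f by auto
    ultimately show "(LINT x|lebesgue_on {a<..<b}. 0 * deriv \<psi> x) = - (LINT x|lebesgue_on {a<..<b}. f x * \<psi> x)"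
      by (subst LINT_open_interval) auto
  qed
  then have eq: "primitive f y = primitive f x" if "x \<in> {a..b}" "y \<in> {a..b}" for x y
    using weak_deriv_increment[of a b "\<lambda>x. 0" f x y] f that by auto
  have a0: "primitive f x = 0" if "x \<le> a" for x
  proof -
    have "indicator {..x} t * f t = 0" for t using that f(2)[of t] by (auto split: split_indicator)
    then show ?thesis unfolding primitive_def by (simp only: Bochner_Integration.integral_zero)
  qed
  have b0: "primitive f x = primitive f b" if "x \<ge> b" for x
  proof -
    have "indicator {..x} t * f t = indicator {..b} t * f t" for t using that f(2)[of t] by (auto split: split_indicator)
    then show ?thesis unfolding primitive_def by (simp only: Bochner_Integration.integral_zero)
  qed
  have "primitive f x = 0" for x
  proof -
    have "primitive f x = primitive f (max a (min b x))"
      using a0[of x] a0[of a] b0[of x] \<open>a < b\<close> by (auto simp: max_def min_def)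
    also have "\<dots> = primitive f a" using \<open>a < b\<close> by (intro eq) auto
    finally show ?thesis using a0[of a] by simp
  qed
  then have "AE x in lborel. f x = 0" by (rule AE_zero_of_prim[OF f(1)])
  then show ?thesis by eventually_elim (simp add: f_def)
qed

lemma Lp_on_bounded:
  assumes "h \<in> borel_measurable borel" "\<And>x. x \<in> {a<..<b} \<Longrightarrow> \<bar>h x\<bar> \<le> B" "0 \<le> p"
  shows "h \<in> Lp_on p a b"
proof -
  have [measurable]: "h \<in> borel_measurable (lebesgue_on {a<..<b})"
    using assms(1) by (rule borel_measurable_lebesgue_on_borel)
  interpret finite_measure "lebesgue_on {a<..<b}"
    by (rule finite_measure_lebesgue_on) auto
  have "integrable (lebesgue_on {a<..<b}) (\<lambda>x. \<bar>h x\<bar> powr p)"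
  proof (rule integrable_const_bound[where B="B powr p"])
    show "AE x in lebesgue_on {a<..<b}. norm (\<bar>h x\<bar> powr p) \<le> B powr p"
      using assms by (auto intro!: AE_I2 powr_mono2)
  qed measurable
  then show ?thesis unfolding Lp_on_def by simp
qed

lemma Lp_on_2_subset: "Lp_on 2 a b \<subseteq> Lp_on 1 a b"
proof
  fix f assume f: "f \<in> Lp_on 2 a b"
  interpret finite_measure "lebesgue_on {a<..<b}"
    by (rule finite_measure_lebesgue_on) auto
  have "integrable (lebesgue_on {a<..<b}) f"
  proof (rule Bochner_Integration.integrable_bound)
    show "integrable (lebesgue_on {a<..<b}) (\<lambda>x. 1 + \<bar>f x\<bar> powr 2)"
      using f unfolding Lp_on_def by auto
    have "\<bar>t\<bar> \<le> 1 + \<bar>t\<bar> powr 2" for t :: real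
    proof -
      have "0 \<le> (\<bar>t\<bar> - 1)^2 + \<bar>t\<bar>^2 + 1" by simp
      then show ?thesis by (simp add: power2_eq_square algebra_simps)
    qed
    then show "AE x in lebesgue_on {a<..<b}. norm (f x) \<le> norm (1 + \<bar>f x\<bar> powr 2)"
      by (intro AE_I2) (auto intro: order_trans)
  qed (use f in \<open>auto simp: Lp_on_def\<close>)
  then show "f \<in> Lp_on 1 a b" by (simp add: Lp_on_1_iff)
qed

lemma integrable_in_Lp_on_1:
  assumes "integrable lborel k" shows "k \<in> Lp_on 1 a b"
proof -
  have "integrable lebesgue k" using assms integrable_completion[of k lborel] by simp
  then have "integrable lebesgue (\<lambda>x. indicator {a<..<b} x *\<^sub>R k x)"
    by (intro integrable_mult_indicator) auto
  then show ?thesis unfolding Lp_on_1_iff by (subst integrable_restrict_space) auto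
qed

lemma has_weak_deriv_cong_AE:
  assumes "has_weak_deriv a b u p" "p \<in> Lp_on 1 a b" "k \<in> Lp_on 1 a b"
    "AE x in lebesgue_on {a<..<b}. p x = k x"
  shows "has_weak_deriv a b u k"
  unfolding has_weak_deriv_def
proof
  fix \<psi> assume \<psi>: "\<psi> \<in> test_functions a b"
  obtain D where D: "\<And>x. (\<psi> has_real_derivative D x) (at x)"
    using test_function_deriv[OF \<psi>] by metis
  have c: "continuous_on UNIV \<psi>" using D(1) by (auto intro!: continuous_at_imp_continuous_on DERIV_isCont)
  then have "\<psi> \<in> borel_measurable borel" by (rule borel_measurable_continuous_onI)
  then have [measurable]: "\<psi> \<in> borel_measurable (lebesgue_on {a<..<b})"
    by (rule borel_measurable_lebesgue_on_borel)
  have [measurable]: "p \<in> borel_measurable (lebesgue_on {a<..<b})" "k \<in> borel_measurable (lebesgue_on {a<..<b})"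
    using assms by (auto simp: Lp_on_def)
  have "(LINT x|lebesgue_on {a<..<b}. p x * \<psi> x) = (LINT x|lebesgue_on {a<..<b}. k x * \<psi> x)"
    using assms(4) by (intro integral_cong_AE) auto
  then show "(LINT x|lebesgue_on {a<..<b}. u x * deriv \<psi> x) = - (LINT x|lebesgue_on {a<..<b}. k x * \<psi> x)"
    using assms(1) \<psi> by (auto simp: has_weak_deriv_def)
qed

lemma has_weak_deriv_diff:
  assumes "u \<in> Lp_on 1 a b" "u' \<in> Lp_on 1 a b" "k \<in> Lp_on 1 a b" "k' \<in> Lp_on 1 a b"
    "has_weak_deriv a b u k" "has_weak_deriv a b u' k'"
  shows "has_weak_deriv a b (\<lambda>x. u x - u' x) (\<lambda>x. k x - k' x)"
  unfolding has_weak_deriv_def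
proof
  fix \<phi> assume \<phi>: "\<phi> \<in> test_functions a b"
  obtain E where E: "continuous_on UNIV E" "\<And>x. (\<phi> has_real_derivative E x) (at x)" "deriv \<phi> = E"
    "\<And>x. x \<notin> {a<..<b} \<Longrightarrow> \<phi> x = 0" "\<And>x. x \<notin> {a<..<b} \<Longrightarrow> E x = 0"
    using test_function_deriv[OF \<phi>] by blast
  have c: "continuous_on UNIV \<phi>" using E(2) by (auto intro!: continuous_at_imp_continuous_on DERIV_isCont)
  have "E \<in> borel_measurable borel" "\<phi> \<in> borel_measurable borel"
    using c E(1) by (auto intro: borel_measurable_continuous_onI)
  then have mE: "E \<in> borel_measurable (lebesgue_on {a<..<b})" "\<phi> \<in> borel_measurable (lebesgue_on {a<..<b})"
    by (auto intro!: borel_measurable_lebesgue_on_borel)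
  obtain B where B: "\<And>x. \<bar>E x\<bar> \<le> B" using continuous_support_bounded[OF E(1,5)] by blast
  obtain B' where B': "\<And>x. \<bar>\<phi> x\<bar> \<le> B'" using continuous_support_bounded[OF c E(4)] by blast
  have L: "f \<in> Lp_on 1 a b \<Longrightarrow> integrable (lebesgue_on {a<..<b}) (\<lambda>x. E x * f x)" 
    "f \<in> Lp_on 1 a b \<Longrightarrow> integrable (lebesgue_on {a<..<b}) (\<lambda>x. \<phi> x * f x)" for f
    using integrable_bounded_mult[OF _ mE(1) B] integrable_bounded_mult[OF _ mE(2) B']
    by (simp_all add: Lp_on_1_iff)
  note LL = L[OF assms(1)] L[OF assms(2)] L[OF assms(3)] L[OF assms(4)]
  have "(LINT x|lebesgue_on {a<..<b}. E x * u x) = - (LINT x|lebesgue_on {a<..<b}. \<phi> x * k x)"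
    using bspec[OF assms(5)[unfolded has_weak_deriv_def] \<phi>] E(3) by (simp add: mult.commute)
  moreover have "(LINT x|lebesgue_on {a<..<b}. E x * u' x) = - (LINT x|lebesgue_on {a<..<b}. \<phi> x * k' x)"
    using bspec[OF assms(6)[unfolded has_weak_deriv_def] \<phi>] E(3) by (simp add: mult.commute)
  ultimately have "(LINT x|lebesgue_on {a<..<b}. E x * u x - E x * u' x) = - (LINT x|lebesgue_on {a<..<b}. \<phi> x * k x - \<phi> x * k' x)"
    using LL by simp
  then show "(LINT x|lebesgue_on {a<..<b}. (u x - u' x) * deriv \<phi> x) = - (LINT x|lebesgue_on {a<..<b}. (k x - k' x) * \<phi> x)"
    by (simp add: E(3) algebra_simps)
qed

text \<open>\<open>weak_deriv\<close> is an arbitrary choice in L^1. The function k shows that the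
  choice is not void, and uniqueness identifies the chosen function up to a null set. Every energy
  is evaluated through this lemma.\<close>

lemma weak_deriv_AE:
  assumes "a < b" "has_weak_deriv a b u k"
    and k: "integrable lborel k" "\<And>x. x \<notin> {a<..<b} \<Longrightarrow> k x = 0"
  shows "weak_deriv a b u \<in> Lp_on 1 a b" "AE x in lebesgue_on {a<..<b}. weak_deriv a b u x = k x"
proof -
  define p where "p = weak_deriv a b u"
  have p: "p \<in> Lp_on 1 a b \<and> has_weak_deriv a b u p"
    unfolding p_def weak_deriv_def
    by (rule someI[of "\<lambda>u'. u' \<in> Lp_on 1 a b \<and> has_weak_deriv a b u u'" k])
       (use assms integrable_in_Lp_on_1 in auto)
  then show "weak_deriv a b u \<in> Lp_on 1 a b" by (simp add: p_def)
  obtain k' where k': "integrable lborel k'" "\<And>x. x \<notin> {a<..<b} \<Longrightarrow> k' x = 0"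
    "AE x in lebesgue_on {a<..<b}. p x = k' x"
    using p Lp_on_1_representative by blast
  have "has_weak_deriv a b u k'"
    using p k' integrable_in_Lp_on_1 by (blast intro: has_weak_deriv_cong_AE)
  then have "AE x in lborel. k' x = k x"
    using assms k' by (intro weak_deriv_unique[of a b u]) auto
  with k'(3) show "AE x in lebesgue_on {a<..<b}. weak_deriv a b u x = k x"
    unfolding AE_open_interval p_def by eventually_elim auto
qed

lemma sobolev1_representative:
  assumes "a < b" "u \<in> sobolev1 p a b" "p = 1 \<or> p = 2"
  obtains k where "integrable lborel k" "\<And>x. x \<notin> {a<..<b} \<Longrightarrow> k x = 0"
    "has_weak_deriv a b u k" "AE x in lebesgue_on {a<..<b}. weak_deriv a b u x = k x"
proof -
  obtain u' where u': "u' \<in> Lp_on 1 a b" "has_weak_deriv a b u u'"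
    using assms(2,3) Lp_on_2_subset unfolding sobolev1_def by blast
  obtain k where k: "integrable lborel k" "\<And>x. x \<notin> {a<..<b} \<Longrightarrow> k x = 0"
    "AE x in lebesgue_on {a<..<b}. u' x = k x"
    using u' Lp_on_1_representative by blast
  have h: "has_weak_deriv a b u k"
    using u' k integrable_in_Lp_on_1 by (blast intro: has_weak_deriv_cong_AE)
  show thesis using that[OF k(1,2) h] weak_deriv_AE[OF assms(1) h k(1,2)] by blast
qed

section \<open>Functions with bounded derivative and the space W^{1,1}_0\<close>

lemma bounded_support_integrable:
  fixes f :: "real \<Rightarrow> real"
  assumes "f \<in> borel_measurable borel" "\<And>x. \<bar>f x\<bar> \<le> B" "\<And>x. x \<notin> {a<..<b} \<Longrightarrow> f x = 0"
  shows "integrable lborel f"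
proof (rule Bochner_Integration.integrable_bound)
  show "integrable lborel (\<lambda>x. indicator {a<..<b} x * B)"
    by (rule integrable_indicator_continuous) (intro continuous_intros)
  show "AE x in lborel. norm (f x) \<le> norm (indicator {a<..<b} x * B)"
    using assms(2,3) by (intro AE_I2) (force split: split_indicator intro: order_trans)
qed (use assms in auto)

lemma primitive_abs_le:
  assumes "integrable lborel f" shows "\<bar>primitive f x\<bar> \<le> (LINT x|lborel. \<bar>f x\<bar>)"
proof -
  have "\<bar>primitive f x\<bar> \<le> (LINT t|lborel. \<bar>indicator {..x} t * f t\<bar>)"
    unfolding primitive_def by (rule integral_abs_bound)
  also have "\<dots> \<le> (LINT x|lborel. \<bar>f x\<bar>)"
    using assms by (intro integral_mono_AE AE_I2 integrable_abs integrable_indicator_mult) (auto split: split_indicator)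
  finally show ?thesis .
qed

text \<open>Boundedness of f removes any distinction between exponents, so the same construction
  provides elements of \<open>H1\<close> and of \<open>W11\<close>.\<close>

lemma sobolev1_prim:
  assumes f: "f \<in> borel_measurable borel" "\<And>x. \<bar>f x\<bar> \<le> B" "\<And>x. x \<notin> {a<..<b} \<Longrightarrow> f x = 0"
    and "a < b" "0 \<le> p"
  shows "(\<lambda>x. c + primitive f x) \<in> sobolev1 p a b"
proof -
  have i: "integrable lborel f" using bounded_support_integrable[OF f] .
  have [measurable]: "primitive f \<in> borel_measurable borel"
    using primitive_continuous[OF i] by (rule borel_measurable_continuous_onI)
  have "(\<lambda>x. c + primitive f x) \<in> Lp_on p a b"
  proof (rule Lp_on_bounded)
    show "\<bar>c + primitive f x\<bar> \<le> \<bar>c\<bar> + (LINT x|lborel. \<bar>f x\<bar>)" for x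
      using primitive_abs_le[OF i, of x] by linarith
  qed (use assms in auto)
  moreover have "f \<in> Lp_on p a b" using f assms(5) by (intro Lp_on_bounded) auto
  moreover have "has_weak_deriv a b (\<lambda>x. c + primitive f x) f"
    using i f assms(4) by (intro has_weak_deriv_prim) auto
  ultimately show ?thesis unfolding sobolev1_def by blast
qed

text \<open>A measurable function is an almost everywhere limit of continuous ones. Clamping the
  values to [-B, B] and cutting off near a and b preserve this limit.\<close>

lemma bounded_approx:
  fixes f :: "real \<Rightarrow> real"
  assumes f: "f \<in> borel_measurable borel" "\<And>x. \<bar>f x\<bar> \<le> B" "\<And>x. x \<notin> {a<..<b} \<Longrightarrow> f x = 0"
  obtains h where "\<And>n. continuous_on UNIV (h n)" 
    "\<And>n x. x \<notin> {a + 1 / real (Suc n) .. b - 1 / real (Suc n)} \<Longrightarrow> h n x = 0"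
    "\<And>n x. \<bar>h n x\<bar> \<le> B" "AE x in lborel. (\<lambda>n. h n x) \<longlonglongrightarrow> f x"
proof -
  have "f \<in> borel_measurable lebesgue" using f by (intro measurable_completion) simp
  then have "f measurable_on UNIV" by (intro lebesgue_measurable_imp_measurable_on_real) auto
  then obtain N g where N: "negligible N" and g: "\<And>n. continuous_on UNIV (g n)"
     "\<And>x. x \<notin> N \<Longrightarrow> (\<lambda>n. g n x) \<longlonglongrightarrow> f x"
    unfolding measurable_on_def by auto
  have B0: "0 \<le> B" using f(2)[of 0] by linarith
  \<comment> \<open>Zero up to distance 1/(n+1) from the end points and one from distance 2/(n+1)
    on.\<close>
  define cut where "cut n x = max 0 (min 1 (real (Suc n) * min (x - a) (b - x) - 1))" for n x
  define h where "h n x = cut n x * max (-B) (min B (g n x))" for n x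
  have cut: "0 \<le> cut n x" "cut n x \<le> 1" for n x by (auto simp: cut_def)
  show thesis
  proof (rule that)
    show "continuous_on UNIV (h n)" for n
      unfolding h_def cut_def by (intro continuous_intros g)
    show "h n x = 0" if "x \<notin> {a + 1 / real (Suc n) .. b - 1 / real (Suc n)}" for n x
    proof -
      have "min (x - a) (b - x) \<le> 1 / real (Suc n)" using that by (auto simp: min_def)
      then have "real (Suc n) * min (x - a) (b - x) \<le> 1" by (simp add: field_simps del: of_nat_Suc)
      then show ?thesis by (auto simp: h_def cut_def)
    qed
    show "\<bar>h n x\<bar> \<le> B" for n x
    proof -
      have "\<bar>h n x\<bar> = cut n x * \<bar>max (-B) (min B (g n x))\<bar>" using cut by (simp add: h_def abs_mult)
      also have "\<dots> \<le> 1 * B" using cut B0 by (intro mult_mono) auto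
      finally show ?thesis by simp
    qed
    have "(\<lambda>n. h n x) \<longlonglongrightarrow> f x" if "x \<notin> N" for x
    proof (cases "x \<in> {a<..<b}")
      case True
      define r where "r = min (x - a) (b - x)"
      have "r > 0" using True by (simp add: r_def)
      have "eventually (\<lambda>n. cut n x = 1) sequentially"
        using eventually_ge_at_top[of "nat \<lceil>2 / r\<rceil>"]
      proof eventually_elim
        case (elim n)
        then have "2 / r \<le> real n" by (simp add: nat_le_iff ceiling_le_iff)
        then have "2 \<le> real (Suc n) * r" using \<open>r > 0\<close> by (simp add: field_simps)
        then show ?case by (simp add: cut_def r_def)
      qed
      then have "(\<lambda>n. cut n x) \<longlonglongrightarrow> 1" by (rule tendsto_eventually)
      moreover have "(\<lambda>n. max (-B) (min B (g n x))) \<longlonglongrightarrow> max (-B) (min B (f x))"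
        using g(2)[OF that] by (intro tendsto_intros)
      moreover have "max (-B) (min B (f x)) = f x" using f(2)[of x] by auto
      ultimately show ?thesis unfolding h_def using tendsto_mult by fastforce
    next
      case False
      have "min (x - a) (b - x) \<le> 0" using False by (auto simp: min_def)
      then have "real (Suc n) * min (x - a) (b - x) \<le> 0" for n
        by (simp add: mult_nonneg_nonpos del: of_nat_Suc)
      then have "cut n x = 0" for n by (smt (verit) cut_def)
      then show ?thesis using f(3)[OF False] by (simp add: h_def)
    qed
    moreover have "AE x in lborel. x \<notin> N"
    proof -
      have "AE x in lebesgue. x \<notin> N" using N by (simp add: negligible_iff_null_sets AE_not_in)
      then show ?thesis by (simp add: AE_completion_iff)
    qed
    ultimately show "AE x in lborel. (\<lambda>n. h n x) \<longlonglongrightarrow> f x" by auto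
  qed
qed

text \<open>The means c n of the approximants tend to 0 without being 0, so their primitives need
  not vanish near b. Subtracting c n / I times a fixed bump restores mean zero and changes the L^1
  norm by |c n| only. Convergence of the derivatives in L^1 controls the functions too, because all
  primitives start from 0.\<close>

lemma primitive_in_W11_0:
  assumes f: "f \<in> borel_measurable borel" "\<And>x. \<bar>f x\<bar> \<le> B" "\<And>x. x \<notin> {a<..<b} \<Longrightarrow> f x = 0"
    and "(LINT x|lborel. f x) = 0" and "a < b"
  shows "primitive f \<in> W11_0 a b"
proof -
  have i: "integrable lborel f" using f by (rule bounded_support_integrable)
  obtain h where h: "\<And>n. continuous_on UNIV (h n)" 
    "\<And>n x. x \<notin> {a + 1 / real (Suc n) .. b - 1 / real (Suc n)} \<Longrightarrow> h n x = 0"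
    "\<And>n x. \<bar>h n x\<bar> \<le> B" "AE x in lborel. (\<lambda>n. h n x) \<longlonglongrightarrow> f x"
    using bounded_approx[OF f] by blast
  have B0: "0 \<le> B" using f(2)[of 0] by linarith
  have hz: "h n x = 0" if "x \<notin> {a<..<b}" for n x
  proof (rule h(2))
    have "0 < 1 / real (Suc n)" by simp
    then show "x \<notin> {a + 1 / real (Suc n) .. b - 1 / real (Suc n)}"
      using that unfolding atLeastAtMost_iff greaterThanLessThan_iff by linarith
  qed
  have [measurable]: "h n \<in> borel_measurable borel" for n
    using h(1) by (rule borel_measurable_continuous_onI)
  have ih: "integrable lborel (h n)" for n
    using h(3) hz by (rule bounded_support_integrable[rotated]) measurable
  have iB: "integrable lborel (\<lambda>x. indicator {a<..<b} x * B)"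
    by (rule integrable_indicator_continuous) (intro continuous_intros)
  define c where "c n = (LINT x|lborel. h n x)" for n
  have "c \<longlonglongrightarrow> (LINT x|lborel. f x)"
    unfolding c_def
  proof (rule integral_dominated_convergence[OF _ _ iB h(4)])
    show "AE x in lborel. norm (h n x) \<le> indicator {a<..<b} x * B" for n
      using h(3) hz by (intro AE_I2) (auto split: split_indicator)
  qed (use f in auto)
  then have c0: "c \<longlonglongrightarrow> 0" using assms by simp
  have "(\<lambda>n. LINT x|lborel. \<bar>h n x - f x\<bar>) \<longlonglongrightarrow> (LINT x::real|lborel. 0)"
  proof (rule integral_dominated_convergence[where w="\<lambda>x. 2 * (indicator {a<..<b} x * B)"])
    show "integrable lborel (\<lambda>x. 2 * (indicator {a<..<b} x * B))" using iB by simp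
    show "AE x in lborel. norm \<bar>h n x - f x\<bar> \<le> 2 * (indicator {a<..<b} x * B)" for n
    proof (rule AE_I2)
      fix x show "norm \<bar>h n x - f x\<bar> \<le> 2 * (indicator {a<..<b} x * B)"
        using h(3)[of n x] hz[of x n] f(2,3)[of x] by (auto split: split_indicator)
    qed
    show "AE x in lborel. (\<lambda>n. \<bar>h n x - f x\<bar>) \<longlonglongrightarrow> 0"
      using h(4)
    proof eventually_elim
      case (elim x)
      then have "(\<lambda>n. \<bar>h n x - f x\<bar>) \<longlonglongrightarrow> \<bar>f x - f x\<bar>" by (intro tendsto_intros)
      then show ?case by simp
    qed
  qed (use f in auto)
  then have hL1: "(\<lambda>n. LINT x|lborel. \<bar>h n x - f x\<bar>) \<longlonglongrightarrow> 0" by simp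
  define a' where "a' = (2*a + b) / 3"
  define b' where "b' = (a + 2*b) / 3"
  have ab: "a < a'" "a' < b'" "b' < b" using \<open>a < b\<close> by (auto simp: a'_def b'_def)
  define I where "I = (LINT x|lborel. bump a' b' x)"
  have I: "I > 0" using bump_integral[of a' b'] ab by (simp add: I_def)
  have ib: "integrable lborel (bump a' b')"
    using bump_support[of _ a' b'] ab by (auto intro!: integrable_continuous_support[of _ a' b'] bump_continuous)
  define q where "q n x = h n x - c n / I * bump a' b' x" for n x
  have iq: "integrable lborel (q n)" for n unfolding q_def[abs_def] using ih ib by auto
  have test: "primitive (q n) \<in> test_functions a b" for n
  proof (rule test_function_of_deriv(1))
    show "continuous_on UNIV (q n)" unfolding q_def by (intro continuous_intros h bump_continuous)
    \<comment> \<open>The convex hull of the two supports, of h n and of the bump, is still compact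
      in (a,b).\<close>
    show "q n x = 0" if "x \<notin> {min a' (a + 1 / real (Suc n)) .. max b' (b - 1 / real (Suc n))}" for x
    proof -
      have "x \<notin> {a'..b'}" "x \<notin> {a + 1 / real (Suc n) .. b - 1 / real (Suc n)}" using that by auto
      then show ?thesis using h(2) bump_support[of x a' b'] ab by (simp add: q_def)
    qed
    have "(LINT x|lborel. q n x) = c n - c n / I * I"
      unfolding q_def c_def I_def using ih ib by simp
    then show "(LINT x|lborel. q n x) = 0" using I by simp
  qed (use ab in auto)
  have qz: "q n x = 0" if "x \<notin> {a<..<b}" for n x
    using hz[OF that] bump_support[of x a' b'] that ab by (auto simp: q_def)
  define e where "e n = (LINT x|lborel. \<bar>f x - q n x\<bar>)" for n
  have "e \<longlonglongrightarrow> 0"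
  proof (rule tendsto_sandwich[where f="\<lambda>_. 0"])
    show "(\<lambda>n. (LINT x|lborel. \<bar>h n x - f x\<bar>) + \<bar>c n\<bar>) \<longlonglongrightarrow> 0"
      using tendsto_add[OF hL1 tendsto_rabs[OF c0]] by simp
    have "e n \<le> (LINT x|lborel. \<bar>h n x - f x\<bar> + \<bar>c n\<bar> / I * bump a' b' x)" for n
      unfolding e_def
    proof (rule integral_mono)
      fix x
      have "f x - q n x = - (h n x - f x) + c n / I * bump a' b' x" by (simp add: q_def)
      then have "\<bar>f x - q n x\<bar> \<le> \<bar>h n x - f x\<bar> + \<bar>c n / I * bump a' b' x\<bar>" by linarith
      then show "\<bar>f x - q n x\<bar> \<le> \<bar>h n x - f x\<bar> + \<bar>c n\<bar> / I * bump a' b' x"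
        using I bump_nonneg by (simp add: abs_mult)
    qed (use i iq ih ib in auto)
    also have "\<dots> n = (LINT x|lborel. \<bar>h n x - f x\<bar>) + \<bar>c n\<bar> / I * I" for n
      unfolding I_def using i ih ib by simp
    finally show "eventually (\<lambda>n. e n \<le> (LINT x|lborel. \<bar>h n x - f x\<bar>) + \<bar>c n\<bar>) sequentially"
      using I by auto
    show "eventually (\<lambda>n. 0 \<le> e n) sequentially" by (simp add: e_def)
  qed auto
  have norm: "W11_norm a b (\<lambda>x. primitive f x - primitive (q n) x) \<le> (b - a) * e n + e n" for n
  proof -
    have p: "primitive f x - primitive (q n) x = 0 + primitive (\<lambda>x. f x - q n x) x" for x
      unfolding primitive_def using i iq
      by (subst Bochner_Integration.integral_diff[symmetric]) (auto simp: integrable_indicator_mult right_diff_distrib)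
    have ifq: "integrable lborel (\<lambda>x. f x - q n x)" using i iq by auto
    have zfq: "f x - q n x = 0" if "x \<notin> {a<..<b}" for x using f(3) qz that by simp
    have W: "has_weak_deriv a b (\<lambda>x. primitive f x - primitive (q n) x) (\<lambda>x. f x - q n x)"
      by (rule has_weak_deriv_prim[OF ifq zfq \<open>a < b\<close> p])
    note wd = weak_deriv_AE[OF \<open>a < b\<close> W ifq zfq]
    have [measurable]: "f \<in> borel_measurable borel" "q n \<in> borel_measurable borel" using i iq by auto
    have m: "(\<lambda>x. f x - q n x) \<in> borel_measurable (lebesgue_on {a<..<b})"
      by (intro borel_measurable_lebesgue_on_borel) measurable
    have 1: "(LINT x|lebesgue_on {a<..<b}. \<bar>weak_deriv a b (\<lambda>x. primitive f x - primitive (q n) x) x\<bar>) = e n"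
    proof -
      have "(LINT x|lebesgue_on {a<..<b}. \<bar>weak_deriv a b (\<lambda>x. primitive f x - primitive (q n) x) x\<bar>)
        = (LINT x|lebesgue_on {a<..<b}. \<bar>f x - q n x\<bar>)"
        using wd m by (intro integral_cong_AE) (auto simp: Lp_on_def)
      also have "\<dots> = (LINT x|lborel. indicator {a<..<b} x * \<bar>f x - q n x\<bar>)"
        by (rule LINT_open_interval) measurable
      also have "\<dots> = e n" unfolding e_def
        by (intro Bochner_Integration.integral_cong refl) (use zfq in \<open>auto split: split_indicator\<close>)
      finally show ?thesis .
    qed
    have [measurable]: "primitive f \<in> borel_measurable borel" "primitive (q n) \<in> borel_measurable borel"
      using primitive_continuous[OF i] primitive_continuous[OF iq] by (auto intro: borel_measurable_continuous_onI)
    have "(LINT x|lebesgue_on {a<..<b}. \<bar>primitive f x - primitive (q n) x\<bar>) = (LINT x|lborel. indicator {a<..<b} x * \<bar>primitive f x - primitive (q n) x\<bar>)"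
      by (rule LINT_open_interval) measurable
    also have "\<dots> \<le> (LINT x|lborel. indicator {a<..<b} x * e n)"
    proof (rule integral_mono)
      show "integrable lborel (\<lambda>x. indicator {a<..<b} x * \<bar>primitive f x - primitive (q n) x\<bar>)"
        by (intro integrable_indicator_continuous continuous_intros continuous_on_subset[OF primitive_continuous] i iq) auto
      show "integrable lborel (\<lambda>x. indicator {a<..<b} x * e n)"
        by (intro integrable_indicator_continuous continuous_intros)
      fix x show "indicator {a<..<b} x * \<bar>primitive f x - primitive (q n) x\<bar> \<le> indicator {a<..<b} x * e n"
        using primitive_abs_le[OF ifq, of x] p[of x] by (auto simp: e_def split: split_indicator)
    qed
    also have "\<dots> = (b - a) * e n" using \<open>a < b\<close> by simp
    finally show ?thesis unfolding W11_norm_def using 1 by simp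
  qed
  have "(\<lambda>n. W11_norm a b (\<lambda>x. primitive f x - primitive (q n) x)) \<longlonglongrightarrow> 0"
  proof (rule tendsto_sandwich[where f="\<lambda>_. 0"])
    have "(\<lambda>n. (b - a) * e n + e n) \<longlonglongrightarrow> (b - a) * 0 + 0"
      using \<open>e \<longlonglongrightarrow> 0\<close> by (intro tendsto_intros)
    then show "(\<lambda>n. (b - a) * e n + e n) \<longlonglongrightarrow> 0" by simp
    show "eventually (\<lambda>n. W11_norm a b (\<lambda>x. primitive f x - primitive (q n) x) \<le> (b - a) * e n + e n) sequentially"
      using norm by simp
    show "eventually (\<lambda>n. 0 \<le> W11_norm a b (\<lambda>x. primitive f x - primitive (q n) x)) sequentially"
      by (simp add: W11_norm_def)
  qed auto
  moreover have "primitive f \<in> W11 a b"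
    using sobolev1_prim[OF f \<open>a < b\<close>, of 1 0] by simp
  ultimately show ?thesis unfolding W11_0_def using test by (auto intro!: exI[of _ "\<lambda>n. primitive (q n)"])
qed

text \<open>The total increment is continuous along the \<open>W\<^sup>1\<^sup>,\<^sup>1\<close> norm and vanishes on test functions.\<close>

lemma W11_0_integral:
  assumes "a < b" "h \<in> W11_0 a b" "has_weak_deriv a b h k"
    and k: "integrable lborel k" "\<And>x. x \<notin> {a<..<b} \<Longrightarrow> k x = 0"
  shows "(LINT x|lborel. k x) = 0"
proof -
  obtain \<psi> where \<psi>: "\<And>n::nat. \<psi> n \<in> test_functions a b"
    "(\<lambda>n. W11_norm a b (\<lambda>x. h x - \<psi> n x)) \<longlonglongrightarrow> 0"
    using assms(2) unfolding W11_0_def by auto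
  have h1: "h \<in> Lp_on 1 a b" using assms(2) unfolding W11_0_def sobolev1_def by auto
  have "\<bar>LINT x|lborel. k x\<bar> \<le> W11_norm a b (\<lambda>x. h x - \<psi> n x)" for n
  proof -
    obtain D where D: "continuous_on UNIV D" "\<And>x. (\<psi> n has_real_derivative D x) (at x)"
      "\<And>x. x \<notin> {a<..<b} \<Longrightarrow> \<psi> n x = 0" "\<And>x. x \<notin> {a<..<b} \<Longrightarrow> D x = 0"
      using test_function_deriv[OF \<psi>(1)[of n]] by metis
    have [measurable]: "D \<in> borel_measurable borel" using D(1) by (rule borel_measurable_continuous_onI)
    have c: "continuous_on UNIV (\<psi> n)" using D(2) by (auto intro!: continuous_at_imp_continuous_on DERIV_isCont)
    have iD: "integrable lborel D"
      using D by (intro integrable_continuous_support[of D a b]) auto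
    have i\<psi>: "integrable lborel (\<psi> n)"
      using D c by (intro integrable_continuous_support[of _ a b]) auto
    have FTC: "(LINT t|lborel. indicator {..x} t * D t) = \<psi> n x" if "x \<in> {a..b}" for x
    proof -
      have "(LINT t|lborel. indicator {..x} t * D t) = (LINT t|lborel. D t * indicator {a..x} t)"
        by (intro Bochner_Integration.integral_cong refl) (use D(4) that in \<open>fastforce split: split_indicator\<close>)
      also have "\<dots> = \<psi> n x - \<psi> n a"
        using that D(1) by (intro integral_FTC_Icc_real D(2)) (auto simp: continuous_on_eq_continuous_at)
      finally show ?thesis using D(3)[of a] by simp
    qed
    have D0: "(LINT t|lborel. D t) = 0"
    proof -
      have "(LINT t|lborel. D t) = (LINT t|lborel. indicator {..b} t * D t)"
        by (intro Bochner_Integration.integral_cong refl) (use D(4) in \<open>fastforce split: split_indicator\<close>)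
      also have "\<dots> = \<psi> n b" using assms(1) by (intro FTC) auto
      finally show ?thesis using D(3)[of b] by simp
    qed
    have w\<psi>: "has_weak_deriv a b (\<psi> n) D"
      using iD D(4) assms(1) by (rule has_weak_deriv_prim[where c=0]) (use FTC in \<open>auto simp: primitive_def\<close>)
    have W: "has_weak_deriv a b (\<lambda>x. h x - \<psi> n x) (\<lambda>x. k x - D x)"
      by (rule has_weak_deriv_diff[OF h1 integrable_in_Lp_on_1[OF i\<psi>]
          integrable_in_Lp_on_1[OF k(1)] integrable_in_Lp_on_1[OF iD] assms(3) w\<psi>])
    have ikD: "integrable lborel (\<lambda>x. k x - D x)" using k iD by auto
    have zkD: "k x - D x = 0" if "x \<notin> {a<..<b}" for x using k(2) D(4) that by simp
    note wd = weak_deriv_AE[OF \<open>a < b\<close> W ikD zkD]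
    have [measurable]: "k \<in> borel_measurable borel" using k by auto
    have m: "(\<lambda>x. k x - D x) \<in> borel_measurable (lebesgue_on {a<..<b})"
      by (intro borel_measurable_lebesgue_on_borel) measurable
    have "(LINT x|lborel. k x) = (LINT x|lborel. k x - D x)" using D0 k iD by simp
    also have "\<bar>\<dots>\<bar> \<le> (LINT x|lborel. \<bar>k x - D x\<bar>)" by (rule integral_abs_bound)
    also have "\<dots> = (LINT x|lborel. indicator {a<..<b} x * \<bar>k x - D x\<bar>)"
      by (intro Bochner_Integration.integral_cong refl) (use zkD in \<open>auto split: split_indicator\<close>)
    also have "\<dots> = (LINT x|lebesgue_on {a<..<b}. \<bar>k x - D x\<bar>)"
      by (rule LINT_open_interval[symmetric]) measurable
    also have "\<dots> = (LINT x|lebesgue_on {a<..<b}. \<bar>weak_deriv a b (\<lambda>x. h x - \<psi> n x) x\<bar>)"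
      using wd m by (intro integral_cong_AE) (auto simp: Lp_on_def)
    also have "\<dots> \<le> W11_norm a b (\<lambda>x. h x - \<psi> n x)" unfolding W11_norm_def by simp
    finally show ?thesis .
  qed
  then have "\<bar>LINT x|lborel. k x\<bar> \<le> 0"
    using \<psi>(2) by (intro LIMSEQ_le_const) auto
  then show ?thesis by simp
qed

section \<open>Explicit primitives, perturbed roots and integral inequalities\<close>

lemma primitive_indicator:
  assumes "p \<le> q"
  shows "primitive (\<lambda>x. c * indicator {p<..<q} x) t = c * max 0 (min t q - p)"
proof -
  have "primitive (\<lambda>x. c * indicator {p<..<q} x) t = (LINT x|lborel. c * indicator ({..t} \<inter> {p<..<q}) x)"
    unfolding primitive_def by (intro Bochner_Integration.integral_cong) (auto split: split_indicator)
  also have "\<dots> = c * measure lborel ({..t} \<inter> {p<..<q})" by simp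
  also have "{..t} \<inter> {p<..<q} = (if t < q then {p<..t} else {p<..<q})" by auto
  also have "measure lborel \<dots> = max 0 (min t q - p)"
    using assms by (auto simp: max_def)
  finally show ?thesis .
qed

lemma primitive_sub:
  assumes "integrable lborel k" "integrable lborel k'"
  shows "primitive (\<lambda>x. k x - k' x) t = primitive k t - primitive k' t"
  unfolding primitive_def using assms
  by (subst Bochner_Integration.integral_diff[symmetric]) (auto simp: integrable_indicator_mult right_diff_distrib)

text \<open>The triangle inequality in the plane for the vectors (sqrt a * y, sqrt c) and (sqrt a *
  d, 0). It prices every later change of a derivative.\<close>

lemma sqrt_add_le_perturb:
  assumes "0 \<le> a" "0 \<le> c"
  shows "sqrt (a * (y + d)\<^sup>2 + c) \<le> sqrt (a * y\<^sup>2 + c) + sqrt a * \<bar>d\<bar>"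
proof -
  have "sqrt (a * (y + d)\<^sup>2 + c) = sqrt ((sqrt a * y + sqrt a * d)\<^sup>2 + (sqrt c + 0)\<^sup>2)"
    using assms by (simp add: power_mult_distrib flip: distrib_left)
  also have "\<dots> \<le> sqrt ((sqrt a * y)\<^sup>2 + (sqrt c)\<^sup>2) + sqrt ((sqrt a * d)\<^sup>2 + 0\<^sup>2)"
    by (rule real_sqrt_sum_squares_triangle_ineq)
  also have "\<dots> = sqrt (a * y\<^sup>2 + c) + sqrt a * \<bar>d\<bar>"
    using assms by (simp add: power_mult_distrib real_sqrt_mult)
  finally show ?thesis .
qed

text \<open>F is only required to agree almost everywhere with a Borel function because the
  functionals contain \<open>weak_deriv\<close>, an arbitrary element of its class.\<close>

lemma nn_integral_open_interval:
  assumes "f \<in> borel_measurable borel" "AE x in lebesgue_on {a<..<b::real}. F x = f x"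
  shows "(\<integral>\<^sup>+x. F x \<partial>lebesgue_on {a<..<b}) = (\<integral>\<^sup>+x. f x * indicator {a<..<b} x \<partial>lborel)"
proof -
  have "(\<integral>\<^sup>+x. F x \<partial>lebesgue_on {a<..<b}) = (\<integral>\<^sup>+x. f x \<partial>lebesgue_on {a<..<b})"
    using assms(2) by (rule nn_integral_cong_AE)
  also have "\<dots> = (\<integral>\<^sup>+x. f x * indicator {a<..<b} x \<partial>lebesgue)"
    by (rule nn_integral_restrict_space) auto
  also have "\<dots> = (\<integral>\<^sup>+x. f x * indicator {a<..<b} x \<partial>lborel)"
    using assms(1) by (intro nn_integral_completion)
  finally show ?thesis .
qed

lemma ennreal_sqrt_ennreal: "0 \<le> x \<Longrightarrow> ennreal_sqrt (ennreal x) = ennreal (sqrt x)"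
  by (simp add: ennreal_sqrt_def)

lemma LINT_reflect:
  fixes k :: "real \<Rightarrow> real"
  shows "(LINT t|lborel. k (c - t)) = (LINT t|lborel. k t)"
  using lborel_integral_real_affine[of "-1" k c] by simp

text \<open>Telescoping over a uniform partition of mesh at most \<delta>: a bound by increments of
  K adds up, so it need only be known on short intervals.\<close>

lemma increment_le_of_local:
  fixes f K :: "real \<Rightarrow> real"
  assumes "a \<le> b" "0 < \<delta>"
    and loc: "\<And>x y. a \<le> x \<Longrightarrow> x \<le> y \<Longrightarrow> y \<le> b \<Longrightarrow> y \<le> x + \<delta> \<Longrightarrow> \<bar>f y - f x\<bar> \<le> K y - K x"
  shows "\<bar>f b - f a\<bar> \<le> K b - K a"
proof -
  obtain N :: nat where N: "(b - a) / \<delta> < real N" using reals_Archimedean2 by blast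
  have N0: "0 < N" using N assms by (metis diff_ge_0_iff_ge divide_nonneg_pos gr0I not_less of_nat_0)
  define x where "x i = a + real i * ((b - a) / real N)" for i :: nat
  have xN: "x N = b" "x 0 = a" using N0 by (auto simp: x_def)
  have step: "x (Suc i) - x i = (b - a) / real N" for i by (simp add: x_def algebra_simps add_divide_distrib diff_divide_distrib)
  have st: "0 \<le> (b - a) / real N" "(b - a) / real N \<le> \<delta>"
    using N N0 assms by (auto simp: field_simps)
  have xle: "x i \<le> b" if "i \<le> N" for i
  proof -
    have "real i * ((b - a) / real N) \<le> real N * ((b - a) / real N)" using that st by (intro mult_right_mono) auto
    then show ?thesis using xN by (simp add: x_def)
  qed
  have xge: "a \<le> x i" for i unfolding x_def using mult_nonneg_nonneg[OF of_nat_0_le_iff[of i] st(1)] by linarith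
  have "f b - f a = (\<Sum>i<N. f (x (Suc i)) - f (x i))"
    using sum_lessThan_telescope[of "\<lambda>i. f (x i)" N] xN by simp
  also have "\<bar>\<dots>\<bar> \<le> (\<Sum>i<N. \<bar>f (x (Suc i)) - f (x i)\<bar>)" by (rule sum_abs)
  also have "\<dots> \<le> (\<Sum>i<N. K (x (Suc i)) - K (x i))"
  proof (intro sum_mono loc)
    fix i assume "i \<in> {..<N}"
    then show "x (Suc i) \<le> b" using xle[of "Suc i"] by simp
    show "a \<le> x i" by (rule xge)
    show "x i \<le> x (Suc i)" "x (Suc i) \<le> x i + \<delta>" using step[of i] st by auto
  qed
  also have "\<dots> = K b - K a"
    using sum_lessThan_telescope[of "\<lambda>i. K (x i)" N] xN by simp
  finally show ?thesis .
qed

lemma LINT_freeze_coefficient: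
  fixes h k :: "real \<Rightarrow> real"
  assumes k: "integrable lborel k" "integrable lborel (\<lambda>t. h t * k t)" "A \<in> sets borel"
    and h: "\<And>t. t \<in> A \<Longrightarrow> \<bar>h t - c\<bar> \<le> \<epsilon>"
  shows "\<bar>(LINT t|lborel. indicator A t * (h t * k t)) - c * (LINT t|lborel. indicator A t * k t)\<bar>
    \<le> \<epsilon> * (LINT t|lborel. indicator A t * \<bar>k t\<bar>)"
proof -
  have i: "integrable lborel (\<lambda>t. indicator A t * (h t * k t))" "integrable lborel (\<lambda>t. indicator A t * k t)"
    "integrable lborel (\<lambda>t. indicator A t * \<bar>k t\<bar>)"
    using k by (auto intro!: integrable_indicator_mult)
  have "(LINT t|lborel. indicator A t * (h t * k t)) - c * (LINT t|lborel. indicator A t * k t)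
    = (LINT t|lborel. indicator A t * (h t * k t) - c * (indicator A t * k t))"
    using i by simp
  also have "\<bar>\<dots>\<bar> \<le> (LINT t|lborel. \<bar>indicator A t * (h t * k t) - c * (indicator A t * k t)\<bar>)"
    by (rule integral_abs_bound)
  also have "\<dots> \<le> (LINT t|lborel. \<epsilon> * (indicator A t * \<bar>k t\<bar>))"
  proof (rule integral_mono)
    fix t
    show "\<bar>indicator A t * (h t * k t) - c * (indicator A t * k t)\<bar> \<le> \<epsilon> * (indicator A t * \<bar>k t\<bar>)"
    proof (cases "t \<in> A")
      case True
      have "\<bar>h t * k t - c * k t\<bar> = \<bar>h t - c\<bar> * \<bar>k t\<bar>" by (simp add: abs_mult[symmetric] algebra_simps)
      also have "\<dots> \<le> \<epsilon> * \<bar>k t\<bar>" using h[OF True] by (intro mult_right_mono) auto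
      finally show ?thesis using True by simp
    qed simp
  qed (use i in auto)
  also have "\<dots> = \<epsilon> * (LINT t|lborel. indicator A t * \<bar>k t\<bar>)" by simp
  finally show ?thesis .
qed

lemma cauchy_schwarz_2: "x * a + y * b \<le> sqrt (x\<^sup>2 + y\<^sup>2) * sqrt (a\<^sup>2 + b\<^sup>2)" for x y a b :: real
proof -
  have "0 \<le> (x * b - y * a)\<^sup>2" by simp
  then have "(x * a + y * b)\<^sup>2 \<le> (x\<^sup>2 + y\<^sup>2) * (a\<^sup>2 + b\<^sup>2)" by (simp add: power2_eq_square algebra_simps)
  then show ?thesis unfolding real_sqrt_mult[symmetric] by (rule real_le_rsqrt)
qed

text \<open>The norm of an integral is at most the integral of the norm: Cauchy-Schwarz against the
  constant vector (X, Y) of the two integrals, then division by its norm N unless N = 0.\<close>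

lemma sqrt_integral_le:
  assumes a: "integrable M a" and b: "integrable M b"
  shows "sqrt ((integral\<^sup>L M a)\<^sup>2 + (integral\<^sup>L M b)\<^sup>2) \<le> (LINT t|M. sqrt ((a t)\<^sup>2 + (b t)\<^sup>2))"
    and "integrable M (\<lambda>t. sqrt ((a t)\<^sup>2 + (b t)\<^sup>2))"
proof -
  show i: "integrable M (\<lambda>t. sqrt ((a t)\<^sup>2 + (b t)\<^sup>2))"
  proof (rule Bochner_Integration.integrable_bound)
    show "integrable M (\<lambda>t. \<bar>a t\<bar> + \<bar>b t\<bar>)" using a b by auto
    show "AE t in M. norm (sqrt ((a t)\<^sup>2 + (b t)\<^sup>2)) \<le> norm (\<bar>a t\<bar> + \<bar>b t\<bar>)"
      using sqrt_sum_squares_le_sum_abs by auto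
  qed (use a b in \<open>auto dest!: borel_measurable_integrable\<close>)
  define X where "X = integral\<^sup>L M a"
  define Y where "Y = integral\<^sup>L M b"
  define N where "N = sqrt (X\<^sup>2 + Y\<^sup>2)"
  have N0: "0 \<le> N" by (simp add: N_def)
  have "N * N = X * X + Y * Y" by (simp add: N_def power2_eq_square)
  also have "\<dots> = (LINT t|M. X * a t + Y * b t)" using a b by (simp add: X_def Y_def)
  also have "\<dots> \<le> (LINT t|M. N * sqrt ((a t)\<^sup>2 + (b t)\<^sup>2))"
    unfolding N_def using a b i by (intro integral_mono) (auto intro: cauchy_schwarz_2)
  also have "\<dots> = N * (LINT t|M. sqrt ((a t)\<^sup>2 + (b t)\<^sup>2))" by simp
  finally have "N * N \<le> N * (LINT t|M. sqrt ((a t)\<^sup>2 + (b t)\<^sup>2))" .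
  moreover have "0 \<le> (LINT t|M. sqrt ((a t)\<^sup>2 + (b t)\<^sup>2))" by (intro Bochner_Integration.integral_nonneg) auto
  ultimately have "N \<le> (LINT t|M. sqrt ((a t)\<^sup>2 + (b t)\<^sup>2))"
    using N0 by (cases "N = 0") auto
  then show "sqrt ((integral\<^sup>L M a)\<^sup>2 + (integral\<^sup>L M b)\<^sup>2) \<le> (LINT t|M. sqrt ((a t)\<^sup>2 + (b t)\<^sup>2))"
    by (simp add: N_def X_def Y_def)
qed

lemma ennreal_sqrt_mono: "x \<le> y \<Longrightarrow> ennreal_sqrt x \<le> ennreal_sqrt y"
  by (auto simp: ennreal_sqrt_def top_unique intro!: ennreal_leI enn2real_mono simp: less_top)

lemma ennreal_sqrt_measurable [measurable]: "ennreal_sqrt \<in> borel_measurable borel"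
  unfolding ennreal_sqrt_def[abs_def] by measurable

section \<open>The two variational problems\<close>

context admissible_data
begin

text \<open>Zero outside [0,1) and in particular at 1, where \<theta> may be infinite; this yields a
  real Borel function on the line. Level 1 is treated separately wherever it can occur.\<close>

definition theta_fin :: "real \<Rightarrow> real" where "theta_fin t = indicator {0..<1} t * theta0 l Q \<omega> t"
definition omega_refl :: "real \<Rightarrow> real" where "omega_refl t = indicator {0..1} t * \<omega> (1 - t)"
text \<open>The integrand of \<open>G\<close> at level t and slope y. As the coefficients are even
  about m, it serves both halves, with m + |t - m| as level.\<close>

definition cost :: "real \<Rightarrow> real \<Rightarrow> real" where "cost t y = sqrt (theta_fin t * y\<^sup>2 + omega_refl t)"
definition Omega :: "real \<Rightarrow> real" where "Omega = primitive (\<lambda>t. sqrt (omega_refl t))"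

section \<open>Signs, continuity and monotonicity of the coefficients\<close>

lemma Q_pos: "0 < t \<Longrightarrow> t \<le> 1 \<Longrightarrow> 0 < Q t"
  using Q_nonneg[of t] Q_zero by (force simp: order_less_le)

lemma omega_pos: "0 < t \<Longrightarrow> t \<le> 1 \<Longrightarrow> 0 < \<omega> t"
  using omega_nonneg[of t] omega_zero by (force simp: order_less_le)

lemma theta0_cont: "continuous_on {0..<1} (theta0 l Q \<omega>)"
proof -
  have "Q (1 - t) \<noteq> 0" if "t \<in> {0..<1}" for t
    using Q_pos[of "1 - t"] that by simp
  then show ?thesis
    unfolding theta0_def
    by (intro continuous_intros continuous_on_compose2[OF omega_cont] continuous_on_compose2[OF Q_cont]
      continuous_on_subset[OF l_cont]) auto
qed

lemma theta0_nonneg: "0 \<le> t \<Longrightarrow> t < 1 \<Longrightarrow> 0 \<le> theta0 l Q \<omega> t"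
  unfolding theta0_def using omega_nonneg[of "1-t"] Q_nonneg[of "1-t"] l_nonneg[of t] by auto

lemma theta0_0: "theta0 l Q \<omega> 0 = 0"
  using l_zero by (auto simp: theta0_def)

lemma theta_fin_eq: "0 \<le> t \<Longrightarrow> t < 1 \<Longrightarrow> theta_fin t = theta0 l Q \<omega> t" by (simp add: theta_fin_def)

lemma theta_fin_nonneg: "0 \<le> theta_fin t"
  using theta0_nonneg[of t] by (auto simp: theta_fin_def split: split_indicator)

lemma theta_fin_mono: "0 \<le> x \<Longrightarrow> x \<le> y \<Longrightarrow> y < 1 \<Longrightarrow> theta_fin x \<le> theta_fin y"
  using strict_mono_onD[OF theta0_strict, of x y] by (cases "x = y") (auto simp: theta_fin_def)

lemma omega_refl_nonneg: "0 \<le> omega_refl t"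
  using omega_nonneg[of "1-t"] by (auto simp: omega_refl_def split: split_indicator)

lemma omega_refl_pos: "0 \<le> t \<Longrightarrow> t < 1 \<Longrightarrow> 0 < omega_refl t"
  using omega_pos[of "1-t"] by (auto simp: omega_refl_def)

lemma omega_refl_eq: "0 \<le> t \<Longrightarrow> t \<le> 1 \<Longrightarrow> omega_refl t = \<omega> (1 - t)" by (simp add: omega_refl_def)

lemma omega_refl_cont: "continuous_on {0..1} omega_refl"
proof -
  have "continuous_on {0..1} (\<lambda>t. \<omega> (1 - t))"
    by (intro continuous_on_compose2[OF omega_cont] continuous_intros) auto
  then show ?thesis by (rule continuous_on_cong[THEN iffD1, rotated 2]) (auto simp: omega_refl_def)
qed

lemma theta_fin_measurable [measurable]: "theta_fin \<in> borel_measurable borel"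
  unfolding theta_fin_def[abs_def]
  using borel_measurable_continuous_on_indicator[OF _ theta0_cont] by simp

lemma omega_refl_measurable [measurable]: "omega_refl \<in> borel_measurable borel"
proof -
  have "continuous_on {0..1} (\<lambda>t. \<omega> (1 - t))"
    by (intro continuous_on_compose2[OF omega_cont] continuous_intros) auto
  then show ?thesis
    unfolding omega_refl_def[abs_def]
    using borel_measurable_continuous_on_indicator[of "{0..1::real}" "\<lambda>t. \<omega> (1 - t)"] by simp
qed

lemma cost_measurable [measurable]:
  assumes [measurable]: "f \<in> borel_measurable M" "k \<in> borel_measurable M"
  shows "(\<lambda>t. cost (f t) (k t)) \<in> borel_measurable M"
  unfolding cost_def by measurable

lemma cost_nonneg: "0 \<le> cost t y"
  unfolding cost_def by (simp add: theta_fin_nonneg omega_refl_nonneg)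

lemma cost_perturb: "cost t (y + d) \<le> cost t y + sqrt (theta_fin t) * \<bar>d\<bar>"
  unfolding cost_def by (rule sqrt_add_le_perturb[OF theta_fin_nonneg omega_refl_nonneg])

lemma omega_refl_bounded: obtains B where "0 \<le> B" "\<And>t. sqrt (omega_refl t) \<le> B"
proof -
  have "compact (omega_refl ` {0..1})" by (intro compact_continuous_image omega_refl_cont) auto
  then obtain B where B: "\<And>x. x \<in> {0..1} \<Longrightarrow> \<bar>omega_refl x\<bar> \<le> B"
    by (force dest!: compact_imp_bounded simp: bounded_iff)
  have "omega_refl x \<le> max B 0" for x
    using B[of x] by (cases "x \<in> {0..1}") (auto simp: omega_refl_def)
  then show thesis by (intro that[of "sqrt (max B 0)"]) auto
qed

lemma sqrt_omega_refl_integrable: "integrable lborel (\<lambda>t. sqrt (omega_refl t))"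
proof -
  obtain B where B: "0 \<le> B" "\<And>t. sqrt (omega_refl t) \<le> B" using omega_refl_bounded by blast
  show ?thesis
  proof (rule bounded_support_integrable)
    show "\<bar>sqrt (omega_refl t)\<bar> \<le> B" for t using B(2)[of t] omega_refl_nonneg[of t] by simp
    show "sqrt (omega_refl t) = 0" if "t \<notin> {-1<..<2}" for t
      using that by (auto simp: omega_refl_def split: split_indicator)
  qed measurable
qed

lemma Omega_diff:
  assumes "x \<le> y"
  shows "Omega y - Omega x = (LINT t|lborel. indicator {x<..y} t * sqrt (omega_refl t))"
  unfolding Omega_def by (rule primitive_diff[OF sqrt_omega_refl_integrable assms])

lemma Omega_diff_open:
  assumes "x \<le> y"
  shows "Omega y - Omega x = (LINT t|lborel. indicator {x<..<y} t * sqrt (omega_refl t))"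
  unfolding Omega_diff[OF assms]
proof (rule integral_cong_AE)
  show "AE t in lborel. indicator {x<..y} t * sqrt (omega_refl t) = indicator {x<..<y} t * sqrt (omega_refl t)"
    using AE_lborel_singleton[of y] by eventually_elim (auto split: split_indicator)
qed measurable

lemma Omega_cont: "continuous_on A Omega"
  unfolding Omega_def using primitive_continuous[OF sqrt_omega_refl_integrable] continuous_on_subset by blast

lemma Omega_mono: "x \<le> y \<Longrightarrow> Omega x \<le> Omega y"
proof -
  assume "x \<le> y"
  have "0 \<le> (LINT t|lborel. indicator {x<..y} t * sqrt (omega_refl t))"
    by (intro Bochner_Integration.integral_nonneg) (simp add: omega_refl_nonneg)
  then show ?thesis using Omega_diff[OF \<open>x \<le> y\<close>] by simp
qed

lemma Omega_0: "Omega 0 = 0"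
proof -
  have "AE t in lborel. indicator {..0} t * sqrt (omega_refl t) = 0"
    using AE_lborel_singleton[of "0::real"] by eventually_elim (auto simp: omega_refl_def split: split_indicator)
  then have "(LINT t|lborel. indicator {..0} t * sqrt (omega_refl t)) = (LINT t::real|lborel. 0)"
    by (intro integral_cong_AE) auto
  then show ?thesis by (simp add: Omega_def primitive_def)
qed

text \<open>\<omega> vanishes only at 0, so \<open>omega_refl\<close> is positive on [0,1).
  Strictness lets values of \<open>Omega\<close> determine levels.\<close>

lemma Omega_strict: "0 \<le> x \<Longrightarrow> x < y \<Longrightarrow> y \<le> 1 \<Longrightarrow> Omega x < Omega y"
proof -
  assume xy: "0 \<le> x" "x < y" "y \<le> 1"
  have i: "integrable lborel (\<lambda>t. indicator {x<..<y} t * sqrt (omega_refl t))"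
    by (intro integrable_indicator_mult sqrt_omega_refl_integrable) auto
  have "Omega y - Omega x \<noteq> 0"
  proof
    assume "Omega y - Omega x = 0"
    then have "AE t in lborel. indicator {x<..<y} t * sqrt (omega_refl t) = 0"
      using i xy by (subst (asm) Omega_diff_open, simp, subst (asm) integral_nonneg_eq_0_iff_AE) (auto simp: omega_refl_nonneg)
    then have "AE t in lborel. t \<notin> {x<..<y}"
    proof eventually_elim
      case (elim t)
      then show ?case using omega_refl_pos[of t] xy by (auto split: split_indicator_asm)
    qed
    then have "emeasure lborel {x<..<y} = 0"
      by (subst (asm) AE_iff_measurable[of "{x<..<y}"]) auto
    then show False using xy by simp
  qed
  then show "Omega x < Omega y" using Omega_mono[of x y] xy by simp
qed

lemma Omega_strict_iff: "x \<in> {0..1} \<Longrightarrow> y \<in> {0..1} \<Longrightarrow> Omega x < Omega y \<longleftrightarrow> x < y"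
  using Omega_strict[of x y] Omega_mono[of y x] by force

lemma theta_eq: "0 \<le> t \<Longrightarrow> t < 1 \<Longrightarrow> theta l Q \<omega> t = ennreal (theta_fin t)"
  by (simp add: theta_def theta_fin_def)

text \<open>\<open>Lim\<close> is meaningful only if the limit exists. Monotonicity makes the
  supremum over [0,1) the left limit at 1, finite or not, and thereby identifies \<theta> at
  1.\<close>

lemma theta_1_ge:
  assumes "0 \<le> \<tau>" "\<tau> < 1" shows "ennreal (theta_fin \<tau>) \<le> theta l Q \<omega> 1"
proof -
  define S where "S = (SUP t\<in>{0..<1}. ennreal (theta_fin t))"
  have "((\<lambda>t. ennreal (theta0 l Q \<omega> t)) \<longlongrightarrow> S) (at_left 1)"
  proof (rule order_tendstoI)
    fix a assume "a < S"
    then obtain t0 where t0: "t0 \<in> {0..<1}" "a < ennreal (theta_fin t0)"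
      unfolding S_def by (auto simp: less_SUP_iff)
    show "\<forall>\<^sub>F x in at_left 1. a < ennreal (theta0 l Q \<omega> x)"
    proof (rule eventually_at_leftI[of t0])
      fix x assume "x \<in> {t0<..<1}"
      then have "theta_fin t0 \<le> theta0 l Q \<omega> x" using t0 theta_fin_mono[of t0 x] theta_fin_eq[of x] by auto
      then show "a < ennreal (theta0 l Q \<omega> x)" using t0(2) by (meson ennreal_leI less_le_trans)
    qed (use t0 in auto)
  next
    fix a assume "S < a"
    show "\<forall>\<^sub>F x in at_left 1. ennreal (theta0 l Q \<omega> x) < a"
    proof (rule eventually_at_leftI[of 0])
      fix x :: real assume x: "x \<in> {0<..<1}"
      then have "ennreal (theta_fin x) \<le> S" unfolding S_def by (intro SUP_upper) auto
      then show "ennreal (theta0 l Q \<omega> x) < a" using \<open>S < a\<close> x theta_fin_eq[of x] by auto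
    qed auto
  qed
  then have "Lim (at_left 1) (\<lambda>t. ennreal (theta0 l Q \<omega> t)) = S"
    by (intro tendsto_Lim) auto
  then have "theta l Q \<omega> 1 = S" by (simp add: theta_def)
  moreover have "ennreal (theta_fin \<tau>) \<le> S" unfolding S_def using assms by (intro SUP_upper) auto
  ultimately show ?thesis by simp
qed

lemma theta_ge:
  assumes "0 \<le> \<tau>" "\<tau> < 1" "\<tau> \<le> t" "t \<le> 1" shows "ennreal (theta_fin \<tau>) \<le> theta l Q \<omega> t"
  using theta_1_ge[OF assms(1,2)] theta_eq[of t] theta_fin_mono[of \<tau> t] assms
  by (cases "t = 1") (auto intro: ennreal_leI)

section \<open>Branches and the operations on them\<close>

text \<open>\<open>k\<close> is the derivative of one half of a competitor of \<open>G\<^sub>m\<close>, restricted to the levels in \<open>(\<alpha>,\<beta>)\<close>.\<close>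

definition branch :: "real \<Rightarrow> real \<Rightarrow> real \<Rightarrow> real \<Rightarrow> bool" where
  "branch \<alpha> \<beta> D c \<longleftrightarrow> 0 \<le> c \<and> (\<exists>k\<in>borel_measurable borel. (\<exists>B. \<forall>x. \<bar>k x\<bar> \<le> B) \<and> (\<forall>x. x \<notin> {\<alpha><..<\<beta>} \<longrightarrow> k x = 0) \<and>
     (LINT x|lborel. k x) = D \<and> (\<integral>\<^sup>+t. ennreal (cost t (k t)) * indicator {\<alpha><..<\<beta>} t \<partial>lborel) \<le> ennreal c)"

lemma branch_zero:
  assumes "\<alpha> \<le> \<beta>"
  shows "branch \<alpha> \<beta> 0 (Omega \<beta> - Omega \<alpha>)"
proof -
  have "(\<integral>\<^sup>+t. ennreal (cost t 0) * indicator {\<alpha><..<\<beta>} t \<partial>lborel) =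
     (\<integral>\<^sup>+t. ennreal (indicator {\<alpha><..<\<beta>} t * sqrt (omega_refl t)) \<partial>lborel)"
    by (intro nn_integral_cong) (auto simp: cost_def split: split_indicator)
  also have "\<dots> = ennreal (Omega \<beta> - Omega \<alpha>)"
    unfolding Omega_diff_open[OF assms]
    by (intro nn_integral_eq_integral integrable_indicator_mult sqrt_omega_refl_integrable) (auto simp: omega_refl_nonneg)
  finally show ?thesis unfolding branch_def using Omega_mono[OF assms]
    by (auto intro!: bexI[of _ "\<lambda>_. 0"])
qed

text \<open>A derivative proportional to that of \<open>Omega\<close> attains the bound exactly, for intervals of any length.\<close>

lemma branch_seg:
  assumes "0 \<le> \<alpha>" "\<alpha> < \<beta>" "\<beta> < 1"
  shows "branch \<alpha> \<beta> D (sqrt (theta_fin \<beta> * D\<^sup>2 + (Omega \<beta> - Omega \<alpha>)\<^sup>2))"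
proof -
  define \<Delta> where "\<Delta> = Omega \<beta> - Omega \<alpha>"
  have \<Delta>: "\<Delta> > 0" using Omega_strict[of \<alpha> \<beta>] assms by (simp add: \<Delta>_def)
  \<comment> \<open>Both terms under the root become multiples of \<open>omega_refl\<close>. With
    \<theta> replaced by its value at the upper end \<beta>, the integrand is at most
    \<open>r * sqrt (omega_refl t)\<close>, whose integral is \<open>r * \<Delta>\<close>.\<close>
  define k where "k t = D / \<Delta> * (indicator {\<alpha><..<\<beta>} t * sqrt (omega_refl t))" for t
  define r where "r = sqrt (theta_fin \<beta> * (D/\<Delta>)\<^sup>2 + 1)"
  have \<Delta>_int: "\<Delta> = (LINT t|lborel. indicator {\<alpha><..<\<beta>} t * sqrt (omega_refl t))"
    unfolding \<Delta>_def using assms by (intro Omega_diff_open) auto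
  have i: "integrable lborel (\<lambda>t. indicator {\<alpha><..<\<beta>} t * sqrt (omega_refl t))"
    by (intro integrable_indicator_mult sqrt_omega_refl_integrable) auto
  have r0: "0 \<le> r" using theta_fin_nonneg by (simp add: r_def)
  have "(LINT x|lborel. k x) = D / \<Delta> * \<Delta>"
    unfolding k_def using \<Delta>_int by simp
  then have D: "(LINT x|lborel. k x) = D" using \<Delta> by simp
  have "(\<integral>\<^sup>+t. ennreal (cost t (k t)) * indicator {\<alpha><..<\<beta>} t \<partial>lborel) \<le>
     (\<integral>\<^sup>+t. ennreal (r * (indicator {\<alpha><..<\<beta>} t * sqrt (omega_refl t))) \<partial>lborel)"
  proof (rule nn_integral_mono)
    fix t
    show "ennreal (cost t (k t)) * indicator {\<alpha><..<\<beta>} t \<le> ennreal (r * (indicator {\<alpha><..<\<beta>} t * sqrt (omega_refl t)))"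
    proof (cases "t \<in> {\<alpha><..<\<beta>}")
      case True
      then have "theta_fin t \<le> theta_fin \<beta>" using theta_fin_mono assms by auto
      then have "theta_fin t * (k t)\<^sup>2 + omega_refl t \<le> theta_fin \<beta> * (k t)\<^sup>2 + omega_refl t" by (intro add_right_mono mult_right_mono) auto
      also have "\<dots> = (theta_fin \<beta> * (D/\<Delta>)\<^sup>2 + 1) * omega_refl t"
        using True omega_refl_nonneg[of t] by (simp add: k_def power_mult_distrib power_divide distrib_right)
      finally have "cost t (k t) \<le> r * sqrt (omega_refl t)"
        unfolding cost_def r_def by (simp add: real_sqrt_mult[symmetric])
      then show ?thesis using True by (auto intro: ennreal_leI)
    qed auto
  qed
  also have "\<dots> = ennreal (r * \<Delta>)"
    unfolding \<Delta>_int using r0 i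
    by (subst nn_integral_eq_integral) (auto simp: omega_refl_nonneg)
  also have "r * \<Delta> = sqrt ((theta_fin \<beta> * (D/\<Delta>)\<^sup>2 + 1) * \<Delta>\<^sup>2)"
    using \<Delta> by (simp add: r_def real_sqrt_mult)
  also have "(theta_fin \<beta> * (D/\<Delta>)\<^sup>2 + 1) * \<Delta>\<^sup>2 = theta_fin \<beta> * D\<^sup>2 + \<Delta>\<^sup>2"
    using \<Delta> by (simp add: field_simps)
  finally have c: "(\<integral>\<^sup>+t. ennreal (cost t (k t)) * indicator {\<alpha><..<\<beta>} t \<partial>lborel)
    \<le> ennreal (sqrt (theta_fin \<beta> * D\<^sup>2 + (Omega \<beta> - Omega \<alpha>)\<^sup>2))" by (simp add: \<Delta>_def)
  obtain B where B: "0 \<le> B" "\<And>t. sqrt (omega_refl t) \<le> B" using omega_refl_bounded by blast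
  have "\<bar>k t\<bar> \<le> \<bar>D / \<Delta>\<bar> * B" for t
  proof -
    have "\<bar>indicator {\<alpha><..<\<beta>} t * sqrt (omega_refl t)\<bar> \<le> B"
      using B(1) B(2)[of t] omega_refl_nonneg[of t] by (auto split: split_indicator)
    then show ?thesis unfolding k_def abs_mult[of "D / \<Delta>"] by (rule mult_left_mono) simp
  qed
  moreover have "k \<in> borel_measurable borel" unfolding k_def[abs_def] by measurable
  moreover have "k t = 0" if "t \<notin> {\<alpha><..<\<beta>}" for t using that by (simp add: k_def)
  ultimately show ?thesis unfolding branch_def using c D theta_fin_nonneg[of \<beta>]
    by (intro conjI bexI[of _ k]) auto
qed

lemma branch_glue:
  assumes "\<alpha> \<le> \<beta>" "\<beta> \<le> \<gamma>" "branch \<alpha> \<beta> D c" "branch \<beta> \<gamma> D' c'"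
  shows "branch \<alpha> \<gamma> (D + D') (c + c')"
proof -
  obtain k B where k [measurable]: "k \<in> borel_measurable borel" and "\<And>x. \<bar>k x\<bar> \<le> B" "\<And>x. x \<notin> {\<alpha><..<\<beta>} \<Longrightarrow> k x = 0"
    "(LINT x|lborel. k x) = D" "(\<integral>\<^sup>+t. ennreal (cost t (k t)) * indicator {\<alpha><..<\<beta>} t \<partial>lborel) \<le> ennreal c" "0 \<le> c"
    using assms(3) unfolding branch_def by auto
  note k = this
  obtain k' B' where k' [measurable]: "k' \<in> borel_measurable borel" and "\<And>x. \<bar>k' x\<bar> \<le> B'" "\<And>x. x \<notin> {\<beta><..<\<gamma>} \<Longrightarrow> k' x = 0"
    "(LINT x|lborel. k' x) = D'" "(\<integral>\<^sup>+t. ennreal (cost t (k' t)) * indicator {\<beta><..<\<gamma>} t \<partial>lborel) \<le> ennreal c'" "0 \<le> c'"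
    using assms(4) unfolding branch_def by auto
  note k' = this
  have i: "integrable lborel k" "integrable lborel k'"
    using bounded_support_integrable[OF k(1,2,3)] bounded_support_integrable[OF k'(1,2,3)] by blast+
  have "(\<integral>\<^sup>+t. ennreal (cost t (k t + k' t)) * indicator {\<alpha><..<\<gamma>} t \<partial>lborel) =
    (\<integral>\<^sup>+t. ennreal (cost t (k t)) * indicator {\<alpha><..<\<beta>} t + ennreal (cost t (k' t)) * indicator {\<beta><..<\<gamma>} t \<partial>lborel)"
  proof (rule nn_integral_cong_AE)
    show "AE t in lborel. ennreal (cost t (k t + k' t)) * indicator {\<alpha><..<\<gamma>} t =
        ennreal (cost t (k t)) * indicator {\<alpha><..<\<beta>} t + ennreal (cost t (k' t)) * indicator {\<beta><..<\<gamma>} t"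
      using AE_lborel_singleton[of \<beta>]
    proof eventually_elim
      case (elim t)
      then show ?case using k(3)[of t] k'(3)[of t] assms(1,2) by (auto split: split_indicator)
    qed
  qed
  also have "\<dots> = (\<integral>\<^sup>+t. ennreal (cost t (k t)) * indicator {\<alpha><..<\<beta>} t \<partial>lborel) + (\<integral>\<^sup>+t. ennreal (cost t (k' t)) * indicator {\<beta><..<\<gamma>} t \<partial>lborel)"
    by (rule nn_integral_add) measurable
  also have "\<dots> \<le> ennreal c + ennreal c'" by (intro add_mono k k')
  finally have "(\<integral>\<^sup>+t. ennreal (cost t (k t + k' t)) * indicator {\<alpha><..<\<gamma>} t \<partial>lborel) \<le> ennreal (c + c')"
    using k(6) k'(6) by simp
  moreover have "(LINT x|lborel. k x + k' x) = D + D'" using i k(4) k'(4) by simp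
  moreover have "\<bar>k x + k' x\<bar> \<le> B + B'" for x using k(2)[of x] k'(2)[of x] by linarith
  moreover have "k x + k' x = 0" if "x \<notin> {\<alpha><..<\<gamma>}" for x
    using k(3)[of x] k'(3)[of x] that assms(1,2) by auto
  ultimately show ?thesis unfolding branch_def using k(6) k'(6)
    by (intro conjI bexI[of _ "\<lambda>x. k x + k' x"]) auto
qed

lemma branch_mono: "branch \<alpha> \<beta> D c \<Longrightarrow> c \<le> c' \<Longrightarrow> branch \<alpha> \<beta> D c'"
  unfolding branch_def by (meson ennreal_leI order_trans)

text \<open>A constant slope on (p,q) raises the total increment by D, at a price that does not
  depend on the length q - p. The level function f is the identity on a branch and m + |t - m| for a
  full competitor.\<close>

lemma nn_integral_perturb:
  assumes [measurable]: "k \<in> borel_measurable borel" "f \<in> borel_measurable borel" "A \<in> sets borel"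
    and \<beta>: "p < q" "{p<..<q} \<subseteq> A" "\<And>t. t \<in> {p<..<q} \<Longrightarrow> sqrt (theta_fin (f t)) \<le> T" 
  shows "(\<integral>\<^sup>+t. ennreal (cost (f t) (k t + D / (q - p) * indicator {p<..<q} t)) * indicator A t \<partial>lborel)
     \<le> (\<integral>\<^sup>+t. ennreal (cost (f t) (k t)) * indicator A t \<partial>lborel) + ennreal (T * \<bar>D\<bar>)"
proof -
  have "0 \<le> sqrt (theta_fin (f ((p+q)/2)))" using theta_fin_nonneg by simp
  also have "\<dots> \<le> T" using \<beta>(1) by (intro \<beta>(3)) simp
  finally have T: "0 \<le> T" .
  have "(\<integral>\<^sup>+t. ennreal (cost (f t) (k t + D / (q - p) * indicator {p<..<q} t)) * indicator A t \<partial>lborel)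
     \<le> (\<integral>\<^sup>+t. ennreal (cost (f t) (k t)) * indicator A t + ennreal (T * (\<bar>D\<bar> / (q - p))) * indicator {p<..<q} t \<partial>lborel)"
  proof (rule nn_integral_mono)
    fix t
    show "ennreal (cost (f t) (k t + D / (q - p) * indicator {p<..<q} t)) * indicator A t
      \<le> ennreal (cost (f t) (k t)) * indicator A t + ennreal (T * (\<bar>D\<bar> / (q - p))) * indicator {p<..<q} t"
    proof (cases "t \<in> {p<..<q}")
      case True
      have "cost (f t) (k t + D / (q - p)) \<le> cost (f t) (k t) + sqrt (theta_fin (f t)) * \<bar>D / (q - p)\<bar>" by (rule cost_perturb)
      also have "\<dots> \<le> cost (f t) (k t) + T * (\<bar>D\<bar> / (q - p))"
        using \<beta>(1) by (intro add_left_mono mult_mono \<beta>(3) True) (auto simp: T)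
      finally show ?thesis using True \<beta>(1,2) T
        by (auto simp: cost_nonneg subset_iff simp flip: ennreal_plus intro!: ennreal_leI)
    qed auto
  qed
  also have "\<dots> = (\<integral>\<^sup>+t. ennreal (cost (f t) (k t)) * indicator A t \<partial>lborel) + ennreal (T * (\<bar>D\<bar> / (q - p))) * emeasure lborel {p<..<q}"
    by (subst nn_integral_add) (auto simp: nn_integral_cmult_indicator)
  also have "ennreal (T * (\<bar>D\<bar> / (q - p))) * emeasure lborel {p<..<q} = ennreal (T * \<bar>D\<bar>)"
    using \<beta>(1) T by (simp add: ennreal_mult'[symmetric])
  finally show ?thesis .
qed

text \<open>The extra slope sits on the lowest levels (\<alpha>, \<beta>), where \<theta> is at most
  its value at \<beta>. This models a jump of the curve, at a cost that disappears together with
  \<open>theta_fin \<beta>\<close>.\<close>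

lemma branch_perturb:
  assumes "branch \<alpha> \<gamma> D c" "0 \<le> \<alpha>" "\<alpha> < \<beta>" "\<beta> \<le> \<gamma>" "\<beta> < 1"
  shows "branch \<alpha> \<gamma> (D + D') (c + sqrt (theta_fin \<beta>) * \<bar>D'\<bar>)"
proof -
  obtain k B where k [measurable]: "k \<in> borel_measurable borel" and "\<And>x. \<bar>k x\<bar> \<le> B" "\<And>x. x \<notin> {\<alpha><..<\<gamma>} \<Longrightarrow> k x = 0"
    "(LINT x|lborel. k x) = D" "(\<integral>\<^sup>+t. ennreal (cost t (k t)) * indicator {\<alpha><..<\<gamma>} t \<partial>lborel) \<le> ennreal c" "0 \<le> c"
    using assms(1) unfolding branch_def by auto
  note k = this
  have i: "integrable lborel k" using bounded_support_integrable[OF k(1,2,3)] by blast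
  let ?k = "\<lambda>x. k x + D' / (\<beta> - \<alpha>) * indicator {\<alpha><..<\<beta>} x"
  have "(LINT x|lborel. ?k x) = D + D' / (\<beta> - \<alpha>) * (\<beta> - \<alpha>)"
    using i k(4) assms by simp
  then have "(LINT x|lborel. ?k x) = D + D'" using assms by simp
  moreover have "(\<integral>\<^sup>+t. ennreal (cost t (?k t)) * indicator {\<alpha><..<\<gamma>} t \<partial>lborel) \<le> ennreal (c + sqrt (theta_fin \<beta>) * \<bar>D'\<bar>)"
  proof -
    have "(\<integral>\<^sup>+t. ennreal (cost t (?k t)) * indicator {\<alpha><..<\<gamma>} t \<partial>lborel) \<le>
       (\<integral>\<^sup>+t. ennreal (cost t (k t)) * indicator {\<alpha><..<\<gamma>} t \<partial>lborel) + ennreal (sqrt (theta_fin \<beta>) * \<bar>D'\<bar>)"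
      by (rule nn_integral_perturb) (use assms theta_fin_mono in \<open>auto simp: less_imp_le\<close>)
    also have "\<dots> \<le> ennreal c + ennreal (sqrt (theta_fin \<beta>) * \<bar>D'\<bar>)" by (intro add_right_mono k)
    finally show ?thesis using k(6) by (simp add: theta_fin_nonneg)
  qed
  moreover have "\<bar>?k x\<bar> \<le> B + \<bar>D' / (\<beta> - \<alpha>)\<bar>" for x
  proof -
    have "\<bar>D' / (\<beta> - \<alpha>) * indicator {\<alpha><..<\<beta>} x\<bar> \<le> \<bar>D' / (\<beta> - \<alpha>)\<bar>"
      by (auto split: split_indicator)
    then show ?thesis using k(2)[of x] by linarith
  qed
  moreover have "?k x = 0" if "x \<notin> {\<alpha><..<\<gamma>}" for x
    using k(3)[of x] that assms by (auto split: split_indicator)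
  ultimately show ?thesis unfolding branch_def using k(6) theta_fin_nonneg[of \<beta>]
    by (intro conjI bexI[of _ ?k]) auto
qed

section \<open>From branches to competitors of \<open>G\<close>\<close>

lemma G_eq:
  assumes m: "0 < m" "m < 1" and k [measurable]: "k \<in> borel_measurable borel"
    and "AE t in lebesgue_on {2 * m - 1<..<1}. weak_deriv (2 * m - 1) 1 f t = k t"
  shows "G l Q \<omega> m f = (\<integral>\<^sup>+t. ennreal (cost (m + \<bar>t - m\<bar>) (k t)) * indicator {2 * m - 1<..<1} t \<partial>lborel)"
  unfolding G_def
proof (rule nn_integral_open_interval)
  have "AE t in lebesgue_on {2 * m - 1<..<1}. t \<in> {2*m-1<..<1}"
    by (simp add: AE_open_interval)
  then show "AE t in lebesgue_on {2 * m - 1<..<1}.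
     ennreal_sqrt (theta_ext l Q \<omega> m t * ennreal (\<bar>weak_deriv (2 * m - 1) 1 f t\<bar>\<^sup>2) + ennreal (omega_ext \<omega> m (1 - t))) =
     ennreal (cost (m + \<bar>t - m\<bar>) (k t))"
    using assms(4)
  proof eventually_elim
    case (elim t)
    let ?r = "m + \<bar>t - m\<bar>"
    \<comment> \<open>On the open interval the level stays below 1, so the possibly infinite value
      of \<theta> at 1 never enters \<open>G\<close>.\<close>
    have r: "0 \<le> ?r" "?r < 1" using elim(1) m by auto
    have 1: "theta_ext l Q \<omega> m t = ennreal (theta_fin ?r)" using theta_eq[OF r] by (simp add: theta_ext_def)
    have "1 - m - \<bar>(1 - (1 - t)) - m\<bar> = 1 - ?r" by simp
    then have 2: "omega_ext \<omega> m (1 - t) = omega_refl ?r" using r omega_refl_eq[of ?r] unfolding omega_ext_def by (simp only:)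
    show ?case unfolding 1 2 elim(2)
      using theta_fin_nonneg[of ?r] omega_refl_nonneg[of ?r]
      by (simp add: cost_def ennreal_mult'[symmetric] ennreal_plus[symmetric] ennreal_sqrt_ennreal del: ennreal_plus)
  qed
qed measurable

definition inf_G :: "real \<Rightarrow> ennreal" where
  "inf_G s = (INF m\<in>{0<..<1}. INF f\<in>{(\<lambda>t. zeta m s t + h t) | h. h \<in> W11_0 (2 * m - 1) 1}. G l Q \<omega> m f)"

text \<open>After subtraction of the slope s / (2 * (1 - m)) of \<open>zeta\<close>, the function k
  has mean zero, so the primitive of the difference lies in \<open>W11_0\<close>; adding it to
  \<open>zeta\<close> gives a competitor with derivative k.\<close>

lemma inf_G_le:
  assumes m: "0 < m" "m < 1" and k [measurable]: "k \<in> borel_measurable borel" and B: "\<And>x. \<bar>k x\<bar> \<le> B"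
    and z: "\<And>x. x \<notin> {2 * m - 1<..<1} \<Longrightarrow> k x = 0" and s: "(LINT x|lborel. k x) = s"
  shows "inf_G s \<le> (\<integral>\<^sup>+t. ennreal (cost (m + \<bar>t - m\<bar>) (k t)) * indicator {2 * m - 1<..<1} t \<partial>lborel)"
proof -
  let ?a = "2 * m - 1"
  have a: "?a < 1" using m by simp
  define c where "c = s / (2 * (1 - m))"
  define j where "j x = c * indicator {?a<..<1} x" for x :: real
  have j [measurable]: "j \<in> borel_measurable borel" unfolding j_def[abs_def] by measurable
  have ji: "integrable lborel j" unfolding j_def[abs_def] using a by (intro integrable_mult_right integrable_real_indicator) auto
  have jz: "j x = 0" if "x \<notin> {?a<..<1}" for x using that by (simp add: j_def)
  have jI: "(LINT x|lborel. j x) = s"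
  proof -
    have "(LINT x|lborel. j x) = c * (1 - ?a)" unfolding j_def using m by simp
    also have "\<dots> = s" using m by (simp add: c_def field_simps)
    finally show ?thesis .
  qed
  have ki: "integrable lborel k" using bounded_support_integrable[OF k B z] by blast
  define f where "f x = k x - j x" for x
  have f [measurable]: "f \<in> borel_measurable borel" unfolding f_def[abs_def] by measurable
  have "\<bar>f x\<bar> \<le> B + \<bar>c\<bar>" for x
    using B[of x] by (auto simp: f_def j_def split: split_indicator)
  moreover have "f x = 0" if "x \<notin> {?a<..<1}" for x using z[OF that] jz[OF that] by (simp add: f_def)
  moreover have "(LINT x|lborel. f x) = 0" unfolding f_def using ki ji jI s by simp
  ultimately have h: "primitive f \<in> W11_0 ?a 1" using a by (intro primitive_in_W11_0) auto
  let ?f = "\<lambda>t. zeta m s t + primitive f t"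
  have fk: "?f t = 0 + primitive k t" if "t \<in> {?a<..<1}" for t
  proof -
    have "primitive j t = c * max 0 (min t 1 - ?a)"
      unfolding j_def using a by (intro primitive_indicator) auto
    also have "\<dots> = zeta m s t" using that by (simp add: zeta_def c_def field_simps)
    finally show ?thesis using primitive_sub[OF ki ji, of t] by (simp add: f_def[abs_def])
  qed
  have wd: "has_weak_deriv ?a 1 ?f k" using ki z a fk by (rule has_weak_deriv_prim)
  have "inf_G s \<le> G l Q \<omega> m ?f"
    unfolding inf_G_def by (intro INF_lower2[of m] INF_lower) (use m h in auto)
  also have "\<dots> = (\<integral>\<^sup>+t. ennreal (cost (m + \<bar>t - m\<bar>) (k t)) * indicator {?a<..<1} t \<partial>lborel)"
    by (rule G_eq[OF m k weak_deriv_AE(2)[OF a wd ki z]])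
  finally show ?thesis .
qed

text \<open>The second branch is reflected by t \<mapsto> 2 * m - t and fills the left half. Its
  derivative is reflected without a change of sign, so the two increments add up, and the point m is
  a null set.\<close>

lemma branch_combine:
  assumes m: "0 < m" "m < 1" and "branch m 1 D c" "branch m 1 D' c'" "D + D' = s"
  shows "inf_G s \<le> ennreal (c + c')"
proof -
  obtain k B where k [measurable]: "k \<in> borel_measurable borel" and "\<And>x. \<bar>k x\<bar> \<le> B" "\<And>x. x \<notin> {m<..<1} \<Longrightarrow> k x = 0"
    "(LINT x|lborel. k x) = D" "(\<integral>\<^sup>+t. ennreal (cost t (k t)) * indicator {m<..<1} t \<partial>lborel) \<le> ennreal c" "0 \<le> c"
    using assms(3) unfolding branch_def by auto
  note k = this
  obtain k' B' where k' [measurable]: "k' \<in> borel_measurable borel" and "\<And>x. \<bar>k' x\<bar> \<le> B'" "\<And>x. x \<notin> {m<..<1} \<Longrightarrow> k' x = 0"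
    "(LINT x|lborel. k' x) = D'" "(\<integral>\<^sup>+t. ennreal (cost t (k' t)) * indicator {m<..<1} t \<partial>lborel) \<le> ennreal c'" "0 \<le> c'"
    using assms(4) unfolding branch_def by auto
  note k' = this
  have i: "integrable lborel k" "integrable lborel k'"
    using bounded_support_integrable[OF k(1,2,3)] bounded_support_integrable[OF k'(1,2,3)] by blast+
  have i': "integrable lborel (\<lambda>t. k' (2 * m - t))"
    using lborel_integrable_real_affine[OF i(2), of "-1" "2*m"] by simp
  define K where "K t = k t + k' (2 * m - t)" for t
  have [measurable]: "K \<in> borel_measurable borel" unfolding K_def[abs_def] by measurable
  have "inf_G s \<le> (\<integral>\<^sup>+t. ennreal (cost (m + \<bar>t - m\<bar>) (K t)) * indicator {2 * m - 1<..<1} t \<partial>lborel)"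
  proof (rule inf_G_le[OF m])
    show "\<bar>K x\<bar> \<le> B + B'" for x using k(2)[of x] k'(2)[of "2 * m - x"] by (simp add: K_def)
    show "K x = 0" if "x \<notin> {2 * m - 1<..<1}" for x
      using k(3)[of x] k'(3)[of "2 * m - x"] that m by (force simp: K_def)
    show "(LINT x|lborel. K x) = s"
      unfolding K_def using i i' k(4) k'(4) assms(5) LINT_reflect[of k' "2 * m"] by simp
  qed measurable
  also have "\<dots> = (\<integral>\<^sup>+t. ennreal (cost t (k t)) * indicator {m<..<1} t +
      ennreal (cost (2 * m - t) (k' (2 * m - t))) * indicator {m<..<1} (2 * m - t) \<partial>lborel)"
  proof (rule nn_integral_cong_AE)
    show "AE t in lborel. ennreal (cost (m + \<bar>t - m\<bar>) (K t)) * indicator {2 * m - 1<..<1} t = ennreal (cost t (k t)) * indicator {m<..<1} t +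
      ennreal (cost (2 * m - t) (k' (2 * m - t))) * indicator {m<..<1} (2 * m - t)"
      using AE_lborel_singleton[of m]
    proof eventually_elim
      case (elim t)
      show ?case
      proof (cases "m < t")
        case True
        then have "k' (2 * m - t) = 0" "indicator {m<..<1} (2 * m - t) = (0::ennreal)" using k'(3) by auto
        then show ?thesis using True m by (auto simp: K_def split: split_indicator)
      next
        case False
        then have "k t = 0" "indicator {m<..<1} t = (0::ennreal)" "m + \<bar>t - m\<bar> = 2 * m - t" using k(3) by auto
        then show ?thesis using False elim m by (auto simp: K_def split: split_indicator)
      qed
    qed
  qed
  also have "\<dots> = (\<integral>\<^sup>+t. ennreal (cost t (k t)) * indicator {m<..<1} t \<partial>lborel) +
      (\<integral>\<^sup>+t. ennreal (cost (2 * m - t) (k' (2 * m - t))) * indicator {m<..<1} (2 * m - t) \<partial>lborel)"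
    by (rule nn_integral_add) measurable
  also have "(\<integral>\<^sup>+t. ennreal (cost (2 * m - t) (k' (2 * m - t))) * indicator {m<..<1} (2 * m - t) \<partial>lborel) =
      (\<integral>\<^sup>+t. ennreal (cost t (k' t)) * indicator {m<..<1} t \<partial>lborel)"
    using nn_integral_real_affine[of "\<lambda>t. ennreal (cost t (k' t)) * indicator {m<..<1} t" "-1" "2*m"] by simp
  also have "(\<integral>\<^sup>+t. ennreal (cost t (k t)) * indicator {m<..<1} t \<partial>lborel) + \<dots> \<le> ennreal c + ennreal c'"
    by (intro add_mono k k')
  finally show ?thesis using k(6) k'(6) by simp
qed

section \<open>Rearrangement along the levels of v\<close>

lemma branch_chain:
  assumes t: "\<And>i. i \<le> n + 1 \<Longrightarrow> t i \<in> {0..1}" "\<And>i. i \<le> n \<Longrightarrow> t (Suc i) < t i" "t 0 = 1"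
    and Om: "\<And>i. i \<le> n \<Longrightarrow> Omega (t i) - Omega (t (Suc i)) = \<delta>"
    and "j \<le> n"
  shows "branch (t (Suc j)) 1 (\<Sum>i<j. D i) (\<delta> + (\<Sum>i<j. sqrt (theta_fin (t (Suc i)) * (D i)\<^sup>2 + \<delta>\<^sup>2)))"
  using \<open>j \<le> n\<close>
proof (induction j)
  case 0
  \<comment> \<open>The topmost interval stays without slope, because \<open>branch_seg\<close>
    requires an upper end below 1. This is the source of the additional \<delta>.\<close>
  have "branch (t 1) 1 0 (Omega 1 - Omega (t 1))" using t(1)[of 1] by (intro branch_zero) auto
  then show ?case using Om[of 0] t(3) by simp
next
  case (Suc j)
  \<comment> \<open>The increment with index j is placed between the levels with indices j + 2 and j
    + 1. The bound on \<theta> is thus taken at level j + 1, the value that the estimate along the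
    curve provides for the same index.\<close>
  have "branch (t (Suc (Suc j))) (t (Suc j)) (D j) (sqrt (theta_fin (t (Suc j)) * (D j)\<^sup>2 + (Omega (t (Suc j)) - Omega (t (Suc (Suc j))))\<^sup>2))"
    using Suc.prems t(1)[of "Suc (Suc j)"] t(2)[of "Suc j"] t(1)[of j] t(2)[of j] by (intro branch_seg) auto
  then have "branch (t (Suc (Suc j))) (t (Suc j)) (D j) (sqrt (theta_fin (t (Suc j)) * (D j)\<^sup>2 + \<delta>\<^sup>2))"
    using Om[of "Suc j"] Suc.prems by simp
  then have "branch (t (Suc (Suc j))) 1 (D j + (\<Sum>i<j. D i)) (sqrt (theta_fin (t (Suc j)) * (D j)\<^sup>2 + \<delta>\<^sup>2) + (\<delta> + (\<Sum>i<j. sqrt (theta_fin (t (Suc i)) * (D i)\<^sup>2 + \<delta>\<^sup>2))))"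
    using Suc t(1)[of "Suc j"] t(2)[of "Suc j"] by (intro branch_glue[of _ "t (Suc j)"]) auto
  then show ?case by (simp add: algebra_simps)
qed

text \<open>The intermediate value theorem for \<open>Omega\<close>. Index n + 1 is a spare level
  below \<mu> that will serve as m; the bound on the step keeps \<open>Omega\<close> positive there,
  hence the level itself.\<close>

lemma levels:
  assumes "0 < \<mu>" "\<mu> < 1" "0 < n" "(Omega 1 - Omega \<mu>) / real n < Omega \<mu>"
  obtains t where "\<And>i. i \<le> n + 1 \<Longrightarrow> t i \<in> {0..1}" "\<And>i. i \<le> n \<Longrightarrow> t (Suc i) < t i" "t 0 = 1" "t n = \<mu>"
    "\<And>i. i \<le> n \<Longrightarrow> Omega (t i) - Omega (t (Suc i)) = (Omega 1 - Omega \<mu>) / real n"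
    "0 < t (Suc n)"
proof -
  define \<delta> where "\<delta> = (Omega 1 - Omega \<mu>) / real n"
  have \<delta>: "0 < \<delta>" using Omega_strict[of \<mu> 1] assms by (simp add: \<delta>_def)
  have n\<delta>: "Omega 1 - real n * \<delta> = Omega \<mu>" using assms by (simp add: \<delta>_def)
  have "\<exists>x\<in>{0..1}. Omega x = Omega 1 - real i * \<delta>" if "i \<le> n + 1" for i
  proof -
    have "real i * \<delta> \<le> real (n + 1) * \<delta>" using that \<delta> by (intro mult_right_mono) auto
    also have "\<dots> = Omega 1 - Omega \<mu> + \<delta>" using n\<delta> by (simp add: algebra_simps)
    also have "\<dots> < Omega 1" using assms(4) by (simp add: \<delta>_def)
    finally have "Omega 0 \<le> Omega 1 - real i * \<delta>" by (simp add: Omega_0)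
    moreover have "Omega 1 - real i * \<delta> \<le> Omega 1" using \<delta> by simp
    ultimately have "\<exists>x\<ge>0. x \<le> 1 \<and> Omega x = Omega 1 - real i * \<delta>" by (intro IVT' Omega_cont) auto
    then show ?thesis by auto
  qed
  then obtain t where t: "\<And>i. i \<le> n + 1 \<Longrightarrow> t i \<in> {0..1}" "\<And>i. i \<le> n + 1 \<Longrightarrow> Omega (t i) = Omega 1 - real i * \<delta>"
    by metis
  have inj: "x = y" if "x \<in> {0..1}" "y \<in> {0..1}" "Omega x = Omega y" for x y
    using Omega_strict_iff[of x y] Omega_strict_iff[of y x] that by (cases x y rule: linorder_cases) auto
  show thesis
  proof (rule that[of t])
    show "t (Suc i) < t i" if "i \<le> n" for i
    proof -
      have "Omega (t (Suc i)) < Omega (t i)" using t(2)[of i] t(2)[of "Suc i"] that \<delta> by (simp add: algebra_simps)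
      then show ?thesis using Omega_strict_iff t(1) that by simp
    qed
    show "t 0 = 1" by (rule inj) (use t(1)[of 0] t(2)[of 0] in auto)
    show "t n = \<mu>" by (rule inj) (use t(1)[of n] t(2)[of n] n\<delta> assms in auto)
    show "Omega (t i) - Omega (t (Suc i)) = (Omega 1 - Omega \<mu>) / real n" if "i \<le> n" for i
      using t(2)[of i] t(2)[of "Suc i"] that unfolding \<delta>_def[symmetric] by (simp add: algebra_simps)
    have "Omega (t (Suc n)) = Omega \<mu> - \<delta>" using t(2)[of "Suc n"] n\<delta> by (simp add: algebra_simps)
    then have "Omega 0 < Omega (t (Suc n))" using assms(4) unfolding \<delta>_def[symmetric] by (simp add: Omega_0)
    then show "0 < t (Suc n)" using Omega_strict_iff[of 0 "t (Suc n)"] t(1)[of "Suc n"] by simp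
  qed (use t in auto)
qed

text \<open>Closedness turns the infimum into a minimum. A value below \<tau> at X would produce,
  starting from v 0 = 1, an earlier point with value \<tau>.\<close>

lemma first_hit:
  fixes v :: "real \<Rightarrow> real"
  assumes v: "continuous_on {0..a} v" "v 0 = 1" "0 \<le> a" "v a \<le> \<tau>" "\<tau> \<le> 1"
  defines "X \<equiv> Inf {x\<in>{0..a}. v x \<le> \<tau>}"
  shows "X \<in> {0..a}" "v X = \<tau>" "\<And>x. 0 \<le> x \<Longrightarrow> x \<le> X \<Longrightarrow> \<tau> \<le> v x"
proof -
  let ?S = "{x\<in>{0..a}. v x \<le> \<tau>}"
  have "closed ({0..a} \<inter> v -` {..\<tau>})" using v(1) by (intro continuous_closed_preimage) auto
  moreover have "{0..a} \<inter> v -` {..\<tau>} = ?S" by auto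
  ultimately have cl: "closed ?S" by simp
  have "X \<in> ?S" unfolding X_def using v cl by (intro closed_contains_Inf) (auto intro!: bdd_belowI[of _ 0])
  then show X: "X \<in> {0..a}" by simp
  have lt: "\<tau> < v x" if "0 \<le> x" "x < X" for x
  proof (rule ccontr)
    assume "\<not> \<tau> < v x"
    then have "x \<in> ?S" using that X by auto
    then have "X \<le> x" unfolding X_def by (intro cInf_lower) (auto intro!: bdd_belowI[of _ 0])
    then show False using that by simp
  qed
  show eq: "v X = \<tau>"
  proof (rule ccontr)
    assume "v X \<noteq> \<tau>"
    then have "v X < \<tau>" using \<open>X \<in> ?S\<close> by simp
    moreover have "\<exists>x. 0 \<le> x \<and> x \<le> X \<and> v x = \<tau>"
      using X v \<open>v X < \<tau>\<close> by (intro IVT2') (auto intro: continuous_on_subset)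
    ultimately show False using lt by (metis less_le less_irrefl)
  qed
  show "\<tau> \<le> v x" if "0 \<le> x" "x \<le> X" for x
    using lt[of x] eq that by (cases "x = X") auto
qed

text \<open>The increment of \<open>u\<close> accumulated while \<open>v\<close> descends from \<open>t i\<close> to \<open>t (i+1)\<close> is moved to the
  next lower level interval, where \<open>theta_fin\<close> is smaller, and the levels are equidistant with respect to \<open>Omega\<close>.
  Hence nothing is lost except for the cost \<open>\<delta>\<close> of one additional interval.\<close>

lemma branch_descent:
  fixes u v C :: "real \<Rightarrow> real"
  assumes v: "continuous_on {0..a} v" "v 0 = 1" "0 \<le> a" "v a = \<mu>" "\<And>x. x \<in> {0..a} \<Longrightarrow> \<mu> \<le> v x"
    and \<mu>: "0 < \<mu>" "\<mu> < 1" and n: "0 < n" "(Omega 1 - Omega \<mu>) / real n < Omega \<mu>"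
    and C: "\<And>x y \<tau>. 0 \<le> x \<Longrightarrow> x \<le> y \<Longrightarrow> y \<le> a \<Longrightarrow> 0 \<le> \<tau> \<Longrightarrow> \<tau> < 1 \<Longrightarrow> (\<And>z. x \<le> z \<Longrightarrow> z \<le> y \<Longrightarrow> \<tau> \<le> v z) \<Longrightarrow>
       sqrt (theta_fin \<tau> * (u y - u x)\<^sup>2 + (Omega (v y) - Omega (v x))\<^sup>2) \<le> C y - C x"
  obtains m where "0 < m" "m < \<mu>" "Omega m = Omega \<mu> - (Omega 1 - Omega \<mu>) / real n"
    "branch m 1 (u a - u 0) ((Omega 1 - Omega \<mu>) / real n + (C a - C 0))"
proof -
  define \<delta> where "\<delta> = (Omega 1 - Omega \<mu>) / real n"
  obtain t where t: "\<And>i. i \<le> n + 1 \<Longrightarrow> t i \<in> {0..1}" "\<And>i. i \<le> n \<Longrightarrow> t (Suc i) < t i" "t 0 = 1" "t n = \<mu>"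
    "\<And>i. i \<le> n \<Longrightarrow> Omega (t i) - Omega (t (Suc i)) = \<delta>" "0 < t (Suc n)"
    unfolding \<delta>_def by (rule levels[OF \<mu> n]) blast
  have tmono: "t j \<le> t i" if "i \<le> j" "j \<le> n" for i j
    using that
  proof (induction j rule: dec_induct)
    case (step j)
    then show ?case using t(2)[of j] by simp
  qed simp
  \<comment> \<open>The last time is a itself and not the first time at level \<mu>, which may be
    earlier: the increments of u have to add up to u a - u 0.\<close>
  define X where "X i = (if i = n then a else Inf {x\<in>{0..a}. v x \<le> t i})" for i
  have hit: "X i \<in> {0..a} \<and> v (X i) = t i \<and> (\<forall>x. 0 \<le> x \<longrightarrow> x \<le> X i \<longrightarrow> t i \<le> v x)" if "i \<le> n" for i
  proof (cases "i = n")
    case True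
    then show ?thesis using v t(4) by (auto simp: X_def)
  next
    case False
    have "v a \<le> t i" using tmono[OF that] t(4) v(4) by simp
    moreover have "t i \<le> 1" using t(1)[of i] that by simp
    ultimately show ?thesis using first_hit[OF v(1,2,3), of "t i"] False by (auto simp: X_def)
  qed
  have X0: "X 0 = 0"
  proof -
    have "Inf {x\<in>{0..a}. v x \<le> t 0} \<le> 0"
      using v t(3) by (intro cInf_lower) (auto intro!: bdd_belowI[of _ 0])
    then show ?thesis using hit[of 0] n by (auto simp: X_def)
  qed
  have Xmono: "X i \<le> X (Suc i)" if "i < n" for i
  proof (rule ccontr)
    assume "\<not> X i \<le> X (Suc i)"
    then have "t i \<le> v (X (Suc i))" using hit[of i] hit[of "Suc i"] that by auto
    then show False using hit[of "Suc i"] t(2)[of i] that by auto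
  qed
  define D where "D i = u (X (Suc i)) - u (X i)" for i
  have cost: "sqrt (theta_fin (t (Suc i)) * (D i)\<^sup>2 + \<delta>\<^sup>2) \<le> C (X (Suc i)) - C (X i)" if "i < n" for i
  proof -
    have "sqrt (theta_fin (t (Suc i)) * (u (X (Suc i)) - u (X i))\<^sup>2 + (Omega (v (X (Suc i))) - Omega (v (X i)))\<^sup>2) \<le> C (X (Suc i)) - C (X i)"
    proof (rule C)
      show "t (Suc i) < 1" using t(2)[of i] t(1)[of i] that by auto
      \<comment> \<open>The lower bound holds from time 0 up to X (i+1), so v may well rise above t
        i in between.\<close>
      show "t (Suc i) \<le> v z" if "X i \<le> z" "z \<le> X (Suc i)" for z
        using hit[of "Suc i"] hit[of i] that \<open>i < n\<close> by auto
    qed (use hit[of i] hit[of "Suc i"] Xmono[OF that] that t(1)[of "Suc i"] in auto)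
    moreover have "(Omega (v (X (Suc i))) - Omega (v (X i)))\<^sup>2 = \<delta>\<^sup>2"
      using hit[of i] hit[of "Suc i"] t(5)[of i] that by (simp add: power2_commute)
    ultimately show ?thesis by (simp add: D_def)
  qed
  have "branch (t (Suc n)) 1 (\<Sum>i<n. D i) (\<delta> + (\<Sum>i<n. sqrt (theta_fin (t (Suc i)) * (D i)\<^sup>2 + \<delta>\<^sup>2)))"
    using t by (intro branch_chain[where n=n]) auto
  moreover have "(\<Sum>i<n. D i) = u a - u 0"
    unfolding D_def using sum_lessThan_telescope[of "\<lambda>i. u (X i)" n] X0 by (simp add: X_def)
  moreover have "(\<Sum>i<n. sqrt (theta_fin (t (Suc i)) * (D i)\<^sup>2 + \<delta>\<^sup>2)) \<le> (\<Sum>i<n. C (X (Suc i)) - C (X i))"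
    by (intro sum_mono cost) auto
  moreover have "(\<Sum>i<n. C (X (Suc i)) - C (X i)) = C a - C 0"
    using sum_lessThan_telescope[of "\<lambda>i. C (X i)" n] X0 by (simp add: X_def)
  ultimately have "branch (t (Suc n)) 1 (u a - u 0) (\<delta> + (C a - C 0))"
    by (auto elim: branch_mono)
  moreover have "Omega (t (Suc n)) = Omega \<mu> - \<delta>" using t(4) t(5)[of n] by simp
  moreover have "t (Suc n) < \<mu>" using t(2)[of n] t(4) by simp
  ultimately show thesis using that[of "t (Suc n)"] t(6) by (simp add: \<delta>_def)
qed

section \<open>Chain rule for \<open>Omega\<close> and the energy spent along a curve\<close>

lemma Omega_linear:
  assumes "p \<in> {0..1}" "q \<in> {0..1}" "\<And>\<tau>. min p q \<le> \<tau> \<Longrightarrow> \<tau> \<le> max p q \<Longrightarrow> \<bar>sqrt (omega_refl \<tau>) - c\<bar> \<le> \<epsilon>"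
  shows "\<bar>Omega q - Omega p - c * (q - p)\<bar> \<le> \<epsilon> * \<bar>q - p\<bar>"
proof -
  have *: "\<bar>Omega q - Omega p - c * (q - p)\<bar> \<le> \<epsilon> * (q - p)"
    if "p \<le> q" "\<And>\<tau>. p \<le> \<tau> \<Longrightarrow> \<tau> \<le> q \<Longrightarrow> \<bar>sqrt (omega_refl \<tau>) - c\<bar> \<le> \<epsilon>" for p q
  proof -
    let ?I = "\<lambda>t::real. indicator {p<..q} t :: real"
    have i: "integrable lborel ?I" using that(1) by (intro integrable_real_indicator) auto
    have "integrable lborel (\<lambda>t. sqrt (omega_refl t) * ?I t)"
      using integrable_indicator_mult[OF sqrt_omega_refl_integrable, of "{p<..q}"] by (simp add: mult.commute)
    from LINT_freeze_coefficient[OF i this, of "{p<..q}" c \<epsilon>] that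
    have "\<bar>(LINT t|lborel. ?I t * (sqrt (omega_refl t) * ?I t)) - c * (LINT t|lborel. ?I t * ?I t)\<bar>
      \<le> \<epsilon> * (LINT t|lborel. ?I t * \<bar>?I t\<bar>)" by auto
    moreover have "?I t * (sqrt (omega_refl t) * ?I t) = ?I t * sqrt (omega_refl t)" "?I t * ?I t = ?I t" "?I t * \<bar>?I t\<bar> = ?I t" for t
      by (auto split: split_indicator)
    ultimately show ?thesis using that(1) by (simp add: Omega_diff)
  qed
  show ?thesis
  proof (cases "p \<le> q")
    case True
    then show ?thesis using *[of p q] assms(3) by simp
  next
    case False
    then have "\<bar>Omega p - Omega q - c * (p - q)\<bar> \<le> \<epsilon> * (p - q)" using assms(3) by (intro *) auto
    moreover have "Omega q - Omega p - c * (q - p) = - (Omega p - Omega q - c * (p - q))" by (simp add: algebra_simps)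
    ultimately show ?thesis using False by simp
  qed
qed

text \<open>On short intervals both sides are compared with the same linearization ?c * (v q - v p),
  whose coefficient is frozen at p. Each comparison costs \<epsilon> times the integral of |k|,
  which is additive, so the local bounds add up and \<epsilon> can be sent to 0.\<close>

lemma Omega_chain_rule:
  fixes v k :: "real \<Rightarrow> real"
  assumes v: "continuous_on {0..1} v" "\<And>x. x \<in> {0..1} \<Longrightarrow> v x \<in> {0..1}"
    and k: "integrable lborel k" "\<And>x y. x \<in> {0..1} \<Longrightarrow> y \<in> {0..1} \<Longrightarrow> v y - v x = primitive k y - primitive k x"
    and h: "integrable lborel (\<lambda>t. h t * k t)" "\<And>t. t \<in> {0..1} \<Longrightarrow> h t = sqrt (omega_refl (v t))"
    and xy: "0 \<le> x" "x \<le> y" "y \<le> 1"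
  shows "Omega (v y) - Omega (v x) = primitive (\<lambda>t. h t * k t) y - primitive (\<lambda>t. h t * k t) x"
proof -
  define H where "H = primitive (\<lambda>t. h t * k t)"
  define K where "K = primitive (\<lambda>t. \<bar>k t\<bar>)"
  define A where "A z = Omega (v z) - H z" for z
  have ik: "integrable lborel (\<lambda>t. \<bar>k t\<bar>)" using k(1) by auto
  have main: "\<bar>A y - A x\<bar> \<le> 2 * \<epsilon> * K y - 2 * \<epsilon> * K x" if "\<epsilon> > 0" for \<epsilon>
  proof -
    have "continuous_on {0..1} (\<lambda>t. sqrt (omega_refl t))" by (intro continuous_intros omega_refl_cont)
    then have "uniformly_continuous_on {0..1} (\<lambda>t. sqrt (omega_refl t))" by (intro compact_uniformly_continuous) auto
    then obtain \<eta> where \<eta>: "\<eta> > 0" "\<And>p q. p \<in> {0..1} \<Longrightarrow> q \<in> {0..1} \<Longrightarrow> \<bar>q - p\<bar> < \<eta> \<Longrightarrow> \<bar>sqrt (omega_refl q) - sqrt (omega_refl p)\<bar> < \<epsilon>"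
      using \<open>\<epsilon> > 0\<close> unfolding uniformly_continuous_on_def dist_real_def by metis
    have "uniformly_continuous_on {0..1} v" using v(1) by (intro compact_uniformly_continuous) auto
    then obtain \<delta> where \<delta>: "\<delta> > 0" "\<And>p q. p \<in> {0..1} \<Longrightarrow> q \<in> {0..1} \<Longrightarrow> \<bar>q - p\<bar> < \<delta> \<Longrightarrow> \<bar>v q - v p\<bar> < \<eta>"
      using \<eta>(1) unfolding uniformly_continuous_on_def dist_real_def by metis
    show ?thesis
    proof (rule increment_le_of_local[of x y "\<delta> / 2" A "\<lambda>z. 2 * \<epsilon> * K z"])
      fix p q assume pq: "x \<le> p" "p \<le> q" "q \<le> y" "q \<le> p + \<delta> / 2"
      then have in01: "p \<in> {0..1}" "q \<in> {0..1}" using xy by auto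
      let ?c = "sqrt (omega_refl (v p))"
      have near: "\<bar>v z - v p\<bar> < \<eta>" if "p \<le> z" "z \<le> q" for z
        using that pq \<delta> in01 by (intro \<delta>(2)) auto
      have Kd: "K q - K p = (LINT t|lborel. indicator {p<..q} t * \<bar>k t\<bar>)"
        unfolding K_def by (rule primitive_diff[OF ik pq(2)])
      have vd: "v q - v p = (LINT t|lborel. indicator {p<..q} t * k t)"
        unfolding k(2)[OF in01] by (rule primitive_diff[OF k(1) pq(2)])
      have vK: "\<bar>v q - v p\<bar> \<le> K q - K p"
      proof -
        have "\<bar>LINT t|lborel. indicator {p<..q} t * k t\<bar> \<le> (LINT t|lborel. \<bar>indicator {p<..q} t * k t\<bar>)"
          by (rule integral_abs_bound)
        also have "\<dots> = K q - K p" unfolding Kd by (simp add: abs_mult)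
        finally show ?thesis unfolding vd .
      qed
      have 1: "\<bar>Omega (v q) - Omega (v p) - ?c * (v q - v p)\<bar> \<le> \<epsilon> * \<bar>v q - v p\<bar>"
      proof (rule Omega_linear)
        fix \<tau> assume \<tau>: "min (v p) (v q) \<le> \<tau>" "\<tau> \<le> max (v p) (v q)"
        have "\<tau> \<in> {0..1}" using \<tau> v(2)[OF in01(1)] v(2)[OF in01(2)] by auto
        moreover have "\<bar>\<tau> - v p\<bar> < \<eta>" using \<tau> near[of q] near[of p] pq by (auto simp: min_def max_def split: if_splits)
        ultimately show "\<bar>sqrt (omega_refl \<tau>) - ?c\<bar> \<le> \<epsilon>" using \<eta>(2)[of "v p" \<tau>] v(2)[OF in01(1)] by auto
      qed (use v in01 in auto)
      have 2: "\<bar>(LINT t|lborel. indicator {p<..q} t * (h t * k t)) - ?c * (LINT t|lborel. indicator {p<..q} t * k t)\<bar>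
        \<le> \<epsilon> * (LINT t|lborel. indicator {p<..q} t * \<bar>k t\<bar>)"
      proof (rule LINT_freeze_coefficient[OF k(1) h(1)])
        fix t assume t: "t \<in> {p<..q}"
        then have t01: "t \<in> {0..1}" using in01 by auto
        then show "\<bar>h t - ?c\<bar> \<le> \<epsilon>"
          using \<eta>(2)[OF v(2)[OF in01(1)] v(2)[OF t01]] near[of t] t h(2)[OF t01] by auto
      qed auto
      have "H q - H p = (LINT t|lborel. indicator {p<..q} t * (h t * k t))"
        unfolding H_def by (rule primitive_diff[OF h(1) pq(2)])
      then have 3: "\<bar>H q - H p - ?c * (v q - v p)\<bar> \<le> \<epsilon> * (K q - K p)"
        using 2 vd Kd by simp
      have "\<epsilon> * \<bar>v q - v p\<bar> \<le> \<epsilon> * (K q - K p)" using vK \<open>\<epsilon> > 0\<close> by (intro mult_left_mono) auto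
      then have "\<bar>(Omega (v q) - H q) - (Omega (v p) - H p)\<bar> \<le> 2 * (\<epsilon> * (K q - K p))" using 1 3 by linarith
      then show "\<bar>A q - A p\<bar> \<le> 2 * \<epsilon> * K q - 2 * \<epsilon> * K p" by (simp add: A_def algebra_simps)
    qed (use xy \<delta> in auto)
  qed
  have "\<bar>A y - A x\<bar> \<le> 0"
  proof (rule field_le_epsilon)
    fix e :: real assume "e > 0"
    \<comment> \<open>The added 1 only prevents a division by zero.\<close>
    define M where "M = \<bar>K y - K x\<bar> + 1"
    have "\<bar>A y - A x\<bar> \<le> 2 * (e / (2 * M)) * K y - 2 * (e / (2 * M)) * K x"
      using \<open>e > 0\<close> by (intro main divide_pos_pos) (auto simp: M_def intro!: add_nonneg_pos)
    also have "\<dots> = e / M * (K y - K x)" by (simp add: algebra_simps)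
    also have "\<dots> \<le> e / M * M" using \<open>e > 0\<close> by (intro mult_left_mono) (auto simp: M_def)
    also have "\<dots> = e" by (auto simp: M_def)
    finally show "\<bar>A y - A x\<bar> \<le> 0 + e" by simp
  qed
  then show ?thesis by (simp add: A_def H_def)
qed

text \<open>C x is the energy spent up to time x, finite because the total is e; its additivity
  allows telescoping over any subdivision. The inequality bounds the chord of the plane curve (sqrt
  (\<theta>(\<tau>)) * u, \<open>Omega\<close> of v) by its length, and \<theta>(v) \<ge>
  \<theta>(\<tau>) bounds that length by the energy.\<close>

lemma competitor_cost:
  assumes "(u, v) \<in> g_competitors s"
    and e: "(\<integral>\<^sup>+ x. ennreal_sqrt (theta l Q \<omega> (v x) * ennreal (\<bar>weak_deriv 0 1 u x\<bar>\<^sup>2)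
       + ennreal (\<omega> (1 - v x) * \<bar>weak_deriv 0 1 v x\<bar>\<^sup>2)) \<partial>lebesgue_on {0<..<1}) = ennreal e" "0 \<le> e"
  obtains C where "C 1 - C 0 = e"
    "\<And>x y \<tau>. 0 \<le> x \<Longrightarrow> x \<le> y \<Longrightarrow> y \<le> 1 \<Longrightarrow> 0 \<le> \<tau> \<Longrightarrow> \<tau> < 1 \<Longrightarrow> (\<And>z. x \<le> z \<Longrightarrow> z \<le> y \<Longrightarrow> \<tau> \<le> v z) \<Longrightarrow>
       sqrt (theta_fin \<tau> * (u y - u x)\<^sup>2 + (Omega (v y) - Omega (v x))\<^sup>2) \<le> C y - C x"
proof -
  have uv: "u \<in> H1 0 1" "v \<in> H1 0 1" "continuous_on {0..1} u" "continuous_on {0..1} v"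
    "u 0 = 0" "u 1 = s" "\<And>x. x \<in> {0..1} \<Longrightarrow> v x \<in> {0..1}" "v 0 = 1" "v 1 = 1"
    using assms(1) unfolding g_competitors_def by auto
  obtain ku where ku: "integrable lborel ku" "\<And>x. x \<notin> {0<..<1} \<Longrightarrow> ku x = 0"
    "has_weak_deriv 0 1 u ku" "AE x in lebesgue_on {0<..<1}. weak_deriv 0 1 u x = ku x"
    using sobolev1_representative[OF _ uv(1)] by (metis zero_less_one)
  obtain kv where kv: "integrable lborel kv" "\<And>x. x \<notin> {0<..<1} \<Longrightarrow> kv x = 0"
    "has_weak_deriv 0 1 v kv" "AE x in lebesgue_on {0<..<1}. weak_deriv 0 1 v x = kv x"
    using sobolev1_representative[OF _ uv(2)] by (metis zero_less_one)
  have [measurable]: "ku \<in> borel_measurable borel" "kv \<in> borel_measurable borel" using ku kv by auto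
  have ui: "u y - u x = primitive ku y - primitive ku x" if "x \<in> {0..1}" "y \<in> {0..1}" for x y
    using weak_deriv_increment[OF uv(3) ku(3) ku(1,2)] that by blast
  have vi: "v y - v x = primitive kv y - primitive kv x" if "x \<in> {0..1}" "y \<in> {0..1}" for x y
    using weak_deriv_increment[OF uv(4) kv(3) kv(1,2)] that by blast
  \<comment> \<open>Continuity of v is known on [0,1] only; clamping the argument makes the
    integrand Borel on the line.\<close>
  define vt where "vt t = v (max 0 (min 1 t))" for t
  have vtc: "continuous_on UNIV vt"
    unfolding vt_def by (intro continuous_on_compose2[OF uv(4)] continuous_intros) auto
  then have [measurable]: "vt \<in> borel_measurable borel" by (rule borel_measurable_continuous_onI)
  have vt01: "vt t \<in> {0..1}" for t unfolding vt_def by (intro uv(7)) auto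
  have vt: "vt t = v t" if "t \<in> {0..1}" for t using that by (simp add: vt_def)
  define h where "h t = sqrt (omega_refl (vt t))" for t
  have [measurable]: "h \<in> borel_measurable borel" unfolding h_def[abs_def] by measurable
  obtain B where B: "0 \<le> B" "\<And>t. sqrt (omega_refl t) \<le> B" using omega_refl_bounded by blast
  have ih: "integrable lborel (\<lambda>t. h t * kv t)"
    using kv(1) by (rule integrable_bounded_mult[where B=B]) (use B omega_refl_nonneg in \<open>auto simp: h_def\<close>)
  \<comment> \<open>A Borel version of the integrand of \<open>g\<close>. The set where v = 1 is
    kept apart, since \<open>theta_fin\<close> is 0 there.\<close>
  define F where "F t = ennreal_sqrt ((if vt t < 1 then ennreal (theta_fin (vt t)) else theta l Q \<omega> 1) * ennreal ((ku t)\<^sup>2)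
       + ennreal (omega_refl (vt t) * (kv t)\<^sup>2))" for t
  have [measurable]: "F \<in> borel_measurable borel" unfolding F_def[abs_def] by measurable
  have "ennreal e = (\<integral>\<^sup>+ x. F x * indicator {0<..<1} x \<partial>lborel)"
    unfolding e(1)[symmetric]
  proof (rule nn_integral_open_interval)
    have "AE t in lebesgue_on {0<..<1}. t \<in> {0<..<1::real}" by (simp add: AE_open_interval)
    then show "AE x in lebesgue_on {0<..<1}. ennreal_sqrt (theta l Q \<omega> (v x) * ennreal (\<bar>weak_deriv 0 1 u x\<bar>\<^sup>2)
       + ennreal (\<omega> (1 - v x) * \<bar>weak_deriv 0 1 v x\<bar>\<^sup>2)) = F x"
      using ku(4) kv(4)
    proof eventually_elim
      case (elim x)
      have v: "vt x = v x" "v x \<in> {0..1}" using elim(1) uv(7)[of x] by (auto simp: vt)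
      have 1: "theta l Q \<omega> (v x) = (if vt x < 1 then ennreal (theta_fin (vt x)) else theta l Q \<omega> 1)"
        using v theta_eq[of "v x"] by (cases "v x = 1") auto
      have 2: "\<omega> (1 - v x) = omega_refl (vt x)" using v omega_refl_eq[of "v x"] by auto
      show ?case unfolding F_def 1 2 elim(2,3) by simp
    qed
  qed measurable
  also have "\<dots> = (\<integral>\<^sup>+ x. F x * indicator {0<..1} x \<partial>lborel)"
  proof (rule nn_integral_cong_AE)
    show "AE x in lborel. F x * indicator {0<..<1} x = F x * indicator {0<..1} x"
      using AE_lborel_singleton[of "1::real"] by eventually_elim (auto split: split_indicator)
  qed
  finally have tot: "(\<integral>\<^sup>+ x. F x * indicator {0<..1} x \<partial>lborel) = ennreal e" by simp
  have fin: "(\<integral>\<^sup>+ t. F t * indicator {x<..y} t \<partial>lborel) < \<infinity>" if "0 \<le> x" "y \<le> 1" for x y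
  proof -
    have "(\<integral>\<^sup>+ t. F t * indicator {x<..y} t \<partial>lborel) \<le> ennreal e"
      unfolding tot[symmetric] using that by (intro nn_integral_mono) (auto split: split_indicator)
    then show ?thesis by (auto simp: less_top[symmetric] top_unique)
  qed
  define C where "C x = enn2real (\<integral>\<^sup>+ t. F t * indicator {0<..x} t \<partial>lborel)" for x
  have Cd: "ennreal (C y - C x) = (\<integral>\<^sup>+ t. F t * indicator {x<..y} t \<partial>lborel) \<and> C x \<le> C y" if "0 \<le> x" "x \<le> y" "y \<le> 1" for x y
  proof -
    have "(\<integral>\<^sup>+ t. F t * indicator ({0<..x} \<union> {x<..y}) t \<partial>lborel) =
      (\<integral>\<^sup>+ t. F t * indicator {0<..x} t \<partial>lborel) + (\<integral>\<^sup>+ t. F t * indicator {x<..y} t \<partial>lborel)"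
      by (rule nn_integral_disjoint_pair) auto
    also have "{0<..x} \<union> {x<..y} = {0<..y}" using that by auto
    finally have *: "C y = C x + enn2real (\<integral>\<^sup>+ t. F t * indicator {x<..y} t \<partial>lborel)"
      unfolding C_def using fin[of 0 x] fin[of x y] that by (simp add: enn2real_plus)
    then have "C y - C x = enn2real (\<integral>\<^sup>+ t. F t * indicator {x<..y} t \<partial>lborel)" by simp
    then show ?thesis using * fin[of x y] that by auto
  qed
  show thesis
  proof (rule that[of C])
    show "C 1 - C 0 = e" using tot e(2) by (simp add: C_def)
  next
    fix x y \<tau> assume xy: "0 \<le> x" "x \<le> y" "y \<le> 1" and \<tau>: "0 \<le> \<tau>" "\<tau> < 1" "\<And>z. x \<le> z \<Longrightarrow> z \<le> y \<Longrightarrow> \<tau> \<le> v z"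
    let ?I = "\<lambda>t::real. indicator {x<..y} t :: real"
    define a where "a t = ?I t * (sqrt (theta_fin \<tau>) * ku t)" for t
    define b where "b t = ?I t * (h t * kv t)" for t
    have ia: "integrable lborel a" "integrable lborel b"
      unfolding a_def[abs_def] b_def[abs_def] using ku(1) ih by (auto intro!: integrable_indicator_mult)
    have "u y - u x = (LINT t|lborel. ?I t * ku t)"
      using ui[of x y] primitive_diff[OF ku(1) xy(2)] xy by simp
    moreover have "a = (\<lambda>t. sqrt (theta_fin \<tau>) * (?I t * ku t))" by (simp add: a_def fun_eq_iff)
    ultimately have La: "(LINT t|lborel. a t) = sqrt (theta_fin \<tau>) * (u y - u x)" by simp
    have Lb: "(LINT t|lborel. b t) = Omega (v y) - Omega (v x)"
      unfolding b_def using Omega_chain_rule[OF uv(4,7) kv(1) vi ih _ xy] primitive_diff[OF ih xy(2)] by (simp add: h_def vt)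
    have "ennreal (sqrt (theta_fin \<tau> * (u y - u x)\<^sup>2 + (Omega (v y) - Omega (v x))\<^sup>2)) = ennreal (sqrt ((LINT t|lborel. a t)\<^sup>2 + (LINT t|lborel. b t)\<^sup>2))"
      unfolding La Lb by (simp add: power_mult_distrib theta_fin_nonneg)
    also have "\<dots> \<le> ennreal (LINT t|lborel. sqrt ((a t)\<^sup>2 + (b t)\<^sup>2))"
      by (intro ennreal_leI sqrt_integral_le ia)
    also have "\<dots> = (\<integral>\<^sup>+ t. ennreal (sqrt ((a t)\<^sup>2 + (b t)\<^sup>2)) \<partial>lborel)"
      by (intro nn_integral_eq_integral[symmetric] sqrt_integral_le ia) auto
    also have "\<dots> \<le> (\<integral>\<^sup>+ t. F t * indicator {x<..y} t \<partial>lborel)"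
    proof (rule nn_integral_mono)
      fix t
      show "ennreal (sqrt ((a t)\<^sup>2 + (b t)\<^sup>2)) \<le> F t * indicator {x<..y} t"
      proof (cases "t \<in> {x<..y}")
        case True
        then have v: "vt t = v t" "v t \<in> {0..1}" "\<tau> \<le> v t" using xy \<tau>(3)[of t] uv(7)[of t] by (auto simp: vt)
        have "ennreal (theta_fin \<tau>) \<le> theta l Q \<omega> (v t)" using \<tau> v by (intro theta_ge) auto
        also have "\<dots> = (if vt t < 1 then ennreal (theta_fin (vt t)) else theta l Q \<omega> 1)"
          using v theta_eq[of "v t"] by (cases "v t = 1") auto
        finally have T: "ennreal (theta_fin \<tau>) \<le> (if vt t < 1 then ennreal (theta_fin (vt t)) else theta l Q \<omega> 1)" .
        have "(a t)\<^sup>2 + (b t)\<^sup>2 = theta_fin \<tau> * (ku t)\<^sup>2 + omega_refl (vt t) * (kv t)\<^sup>2"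
          using True theta_fin_nonneg omega_refl_nonneg by (simp add: a_def b_def h_def power_mult_distrib)
        then have "ennreal (sqrt ((a t)\<^sup>2 + (b t)\<^sup>2)) = ennreal_sqrt (ennreal (theta_fin \<tau> * (ku t)\<^sup>2 + omega_refl (vt t) * (kv t)\<^sup>2))"
          by (subst ennreal_sqrt_ennreal) (auto simp: theta_fin_nonneg omega_refl_nonneg)
        also have "\<dots> = ennreal_sqrt (ennreal (theta_fin \<tau>) * ennreal ((ku t)\<^sup>2) + ennreal (omega_refl (vt t) * (kv t)\<^sup>2))"
          by (simp add: theta_fin_nonneg omega_refl_nonneg ennreal_mult)
        also have "\<dots> \<le> F t" unfolding F_def
          by (intro ennreal_sqrt_mono add_right_mono mult_right_mono T) auto
        finally show ?thesis using True by simp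
      qed (simp add: a_def b_def)
    qed
    also have "\<dots> = ennreal (C y - C x)" using Cd[OF xy] by simp
    finally show "sqrt (theta_fin \<tau> * (u y - u x)\<^sup>2 + (Omega (v y) - Omega (v x))\<^sup>2) \<le> C y - C x"
      using Cd[OF xy] by (subst (asm) ennreal_le_iff) auto
  qed
qed

section \<open>The infimum of \<open>G\<close> is at most \<open>g\<close>\<close>

lemma inf_G_le_of_cost:
  fixes u v C :: "real \<Rightarrow> real"
  assumes v: "continuous_on {0..1} v" "v 0 = 1" "v 1 = 1"
    and \<mu>: "0 < \<mu>" "\<mu> < 1"
    and ab: "0 \<le> a" "a \<le> b" "b \<le> 1" "v a = \<mu>" "v b = \<mu>"
      "\<And>x. x \<in> {0..a} \<Longrightarrow> \<mu> \<le> v x" "\<And>x. x \<in> {b..1} \<Longrightarrow> \<mu> \<le> v x"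
    and u: "u 1 - u 0 = s"
    and C: "\<And>x y \<tau>. 0 \<le> x \<Longrightarrow> x \<le> y \<Longrightarrow> y \<le> 1 \<Longrightarrow> 0 \<le> \<tau> \<Longrightarrow> \<tau> < 1 \<Longrightarrow> (\<And>z. x \<le> z \<Longrightarrow> z \<le> y \<Longrightarrow> \<tau> \<le> v z) \<Longrightarrow>
       sqrt (theta_fin \<tau> * (u y - u x)\<^sup>2 + (Omega (v y) - Omega (v x))\<^sup>2) \<le> C y - C x"
  shows "inf_G s \<le> ennreal (C a - C 0 + sqrt (theta_fin \<mu>) * \<bar>u b - u a\<bar> + (C 1 - C b))"
proof (rule ennreal_le_epsilon)
  fix e :: real assume "0 < e"
  have Om\<mu>: "0 < Omega \<mu>" using Omega_strict[of 0 \<mu>] \<mu> Omega_0 by simp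
  \<comment> \<open>Each branch pays for one spare interval of cost \<delta>, so \<delta> < e / 2 is
    enough; \<delta> < \<open>Omega \<mu>\<close> leaves room for the spare level above 0.\<close>
  define e' where "e' = min (e / 2) (Omega \<mu>)"
  have e': "0 < e'" "e' \<le> e / 2" "e' \<le> Omega \<mu>" using \<open>0 < e\<close> Om\<mu> by (auto simp: e'_def)
  obtain n where n': "(Omega 1 - Omega \<mu>) / e' < real n" using reals_Archimedean2 by blast
  have "0 \<le> (Omega 1 - Omega \<mu>) / e'" using e' Omega_mono[of \<mu> 1] \<mu> by simp
  then have n: "0 < n" using n' by (cases n) auto
  define \<delta> where "\<delta> = (Omega 1 - Omega \<mu>) / real n"
  have \<delta>: "\<delta> < e'" using n n' e' by (simp add: \<delta>_def field_simps)
  have n2: "(Omega 1 - Omega \<mu>) / real n < Omega \<mu>" using \<delta> e' by (simp add: \<delta>_def)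
  obtain m where m: "0 < m" "m < \<mu>" "Omega m = Omega \<mu> - \<delta>" "branch m 1 (u a - u 0) (\<delta> + (C a - C 0))"
    unfolding \<delta>_def
  proof (rule branch_descent[of a v \<mu> n u C])
    show "continuous_on {0..a} v" using v ab by (auto intro: continuous_on_subset)
    show "\<mu> \<le> v x" if "x \<in> {0..a}" for x using ab(6) that .
    show "sqrt (theta_fin \<tau> * (u y - u x)\<^sup>2 + (Omega (v y) - Omega (v x))\<^sup>2) \<le> C y - C x"
      if "0 \<le> x" "x \<le> y" "y \<le> a" "0 \<le> \<tau>" "\<tau> < 1" "\<And>z. x \<le> z \<Longrightarrow> z \<le> y \<Longrightarrow> \<tau> \<le> v z" for x y \<tau>
      using that ab by (intro C) auto
  qed (use v ab \<mu> n n2 in auto)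
  \<comment> \<open>The right branch is a descent for reversed time. The minus sign keeps C'
    nondecreasing and preserves the increments of u.\<close>
  define v' where "v' x = v (1 - x)" for x
  define u' where "u' x = - u (1 - x)" for x
  define C' where "C' x = - C (1 - x)" for x
  obtain m' where m': "0 < m'" "m' < \<mu>" "Omega m' = Omega \<mu> - \<delta>" "branch m' 1 (u' (1 - b) - u' 0) (\<delta> + (C' (1 - b) - C' 0))"
    unfolding \<delta>_def
  proof (rule branch_descent[of "1 - b" v' \<mu> n u' C'])
    show "continuous_on {0..1-b} v'" unfolding v'_def
      using ab by (intro continuous_on_compose2[OF v(1)] continuous_intros) auto
    show "\<mu> \<le> v' x" if "x \<in> {0..1-b}" for x unfolding v'_def using ab(7)[of "1 - x"] that ab by auto
    show "sqrt (theta_fin \<tau> * (u' y - u' x)\<^sup>2 + (Omega (v' y) - Omega (v' x))\<^sup>2) \<le> C' y - C' x"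
      if "0 \<le> x" "x \<le> y" "y \<le> 1 - b" "0 \<le> \<tau>" "\<tau> < 1" "\<And>z. x \<le> z \<Longrightarrow> z \<le> y \<Longrightarrow> \<tau> \<le> v' z" for x y \<tau>
    proof -
      have "sqrt (theta_fin \<tau> * (u (1 - x) - u (1 - y))\<^sup>2 + (Omega (v (1 - x)) - Omega (v (1 - y)))\<^sup>2) \<le> C (1 - x) - C (1 - y)"
      proof (rule C)
        show "\<tau> \<le> v z" if "1 - y \<le> z" "z \<le> 1 - x" for z
          using \<open>\<And>z. x \<le> z \<Longrightarrow> z \<le> y \<Longrightarrow> \<tau> \<le> v' z\<close>[of "1 - z"] that by (simp add: v'_def)
      qed (use that ab in auto)
      then show ?thesis by (simp add: u'_def v'_def C'_def power2_commute)
    qed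
  qed (use v ab \<mu> n n2 in \<open>auto simp: v'_def\<close>)
  \<comment> \<open>Both spare levels have the same value of \<open>Omega\<close>, because \<mu> and
    n are shared; only for this reason can the branches be joined.\<close>
  have "m' = m"
    using m m' \<mu> Omega_strict[of m m'] Omega_strict[of m' m] by (cases m m' rule: linorder_cases) auto
  then have r: "branch m 1 (u 1 - u b) (\<delta> + (C 1 - C b))" using m'(4) by (simp add: u'_def C'_def)
  \<comment> \<open>The part of the curve between a and b is charged to the left branch, as an
    increment on the levels between m and \<mu>.\<close>
  have l: "branch m 1 (u a - u 0 + (u b - u a)) (\<delta> + (C a - C 0) + sqrt (theta_fin \<mu>) * \<bar>u b - u a\<bar>)"
    using m \<mu> by (intro branch_perturb) auto
  have "inf_G s \<le> ennreal (\<delta> + (C a - C 0) + sqrt (theta_fin \<mu>) * \<bar>u b - u a\<bar> + (\<delta> + (C 1 - C b)))"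
    by (rule branch_combine[OF _ _ l r]) (use m \<mu> u in auto)
  also have "\<dots> \<le> ennreal (C a - C 0 + sqrt (theta_fin \<mu>) * \<bar>u b - u a\<bar> + (C 1 - C b) + e)"
    using \<delta> e' by (intro ennreal_leI) auto
  also have "\<dots> = ennreal (C a - C 0 + sqrt (theta_fin \<mu>) * \<bar>u b - u a\<bar> + (C 1 - C b)) + ennreal e"
  proof (rule ennreal_plus)
    have "0 \<le> C a - C 0"
    proof -
      have "0 \<le> sqrt (theta_fin \<mu> * (u a - u 0)\<^sup>2 + (Omega (v a) - Omega (v 0))\<^sup>2)" using theta_fin_nonneg by simp
      also have "\<dots> \<le> C a - C 0" using ab \<mu> by (intro C) auto
      finally show ?thesis .
    qed
    moreover have "0 \<le> C 1 - C b"
    proof -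
      have "0 \<le> sqrt (theta_fin \<mu> * (u 1 - u b)\<^sup>2 + (Omega (v 1) - Omega (v b))\<^sup>2)" using theta_fin_nonneg by simp
      also have "\<dots> \<le> C 1 - C b" using ab \<mu> by (intro C) auto
      finally show ?thesis .
    qed
    ultimately show "0 \<le> C a - C 0 + sqrt (theta_fin \<mu>) * \<bar>u b - u a\<bar> + (C 1 - C b)"
      using theta_fin_nonneg[of \<mu>] by simp
  qed (use \<open>0 < e\<close> in auto)
  finally show "inf_G s \<le> ennreal (C a - C 0 + sqrt (theta_fin \<mu>) * \<bar>u b - u a\<bar> + (C 1 - C b)) + ennreal e" .
qed

lemma inf_G_le_energy:
  assumes "(u, v) \<in> g_competitors s"
  shows "inf_G s \<le> (\<integral>\<^sup>+ x. ennreal_sqrt (theta l Q \<omega> (v x) * ennreal (\<bar>weak_deriv 0 1 u x\<bar>\<^sup>2)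
       + ennreal (\<omega> (1 - v x) * \<bar>weak_deriv 0 1 v x\<bar>\<^sup>2)) \<partial>lebesgue_on {0<..<1})" (is "_ \<le> ?I")
proof (cases "?I = \<infinity>")
  case True
  then show ?thesis by simp
next
  case False
  then obtain e where e: "?I = ennreal e" "0 \<le> e" by (cases ?I rule: ennreal_cases) auto
  have uv: "continuous_on {0..1} u" "continuous_on {0..1} v"
    "u 0 = 0" "u 1 = s" "\<And>x. x \<in> {0..1} \<Longrightarrow> v x \<in> {0..1}" "v 0 = 1" "v 1 = 1"
    using assms(1) unfolding g_competitors_def by auto
  obtain C where Ce: "C 1 - C 0 = e" and
    C: "\<And>x y \<tau>. 0 \<le> x \<Longrightarrow> x \<le> y \<Longrightarrow> y \<le> 1 \<Longrightarrow> 0 \<le> \<tau> \<Longrightarrow> \<tau> < 1 \<Longrightarrow> (\<And>z. x \<le> z \<Longrightarrow> z \<le> y \<Longrightarrow> \<tau> \<le> v z) \<Longrightarrow>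
       sqrt (theta_fin \<tau> * (u y - u x)\<^sup>2 + (Omega (v y) - Omega (v x))\<^sup>2) \<le> C y - C x"
    using competitor_cost[OF assms e] by blast
  have thx0: "theta_fin 0 = 0" using theta0_0 by (simp add: theta_fin_def)
  have Cmono: "C x \<le> C y" if "0 \<le> x" "x \<le> y" "y \<le> 1" for x y
  proof -
    have "0 \<le> sqrt (theta_fin 0 * (u y - u x)\<^sup>2 + (Omega (v y) - Omega (v x))\<^sup>2)" by (simp add: thx0)
    also have "\<dots> \<le> C y - C x" using that uv(5) by (intro C) auto
    finally show ?thesis by simp
  qed
  have "compact (v ` {0..1})" using uv by (intro compact_continuous_image) auto
  then obtain x0 where x0: "x0 \<in> {0..1}" "\<And>x. x \<in> {0..1} \<Longrightarrow> v x0 \<le> v x"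
    using continuous_attains_inf[of "{0..1::real}" v] uv by auto
  consider "v x0 = 1" | "0 < v x0" "v x0 < 1" | "v x0 = 0" using uv(5)[OF x0(1)] by fastforce
  then have "inf_G s \<le> ennreal e"
  proof cases
    case 1
    \<comment> \<open>Without any descent there is no level below 1 to cut at. Competitors with m
      close to 1 are used instead: both branches cost little, and the whole increment s is put on
      one of them.\<close>
    have v1: "v x = 1" if "x \<in> {0..1}" for x using x0(2)[OF that] uv(5)[OF that] 1 by simp
    show ?thesis
    proof (rule ennreal_le_epsilon)
      fix \<epsilon> :: real assume "0 < \<epsilon>"
      have "(Omega \<longlongrightarrow> Omega 1) (at_left 1)"
        using Omega_cont[of UNIV] by (auto simp: continuous_on_eq_continuous_at isCont_def intro: filterlim_at_split[THEN iffD1, THEN conjunct1])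
      then have "eventually (\<lambda>m. Omega 1 - \<epsilon> / 2 < Omega m) (at_left 1)"
        using \<open>0 < \<epsilon>\<close> by (intro order_tendstoD(1)) auto
      moreover have "eventually (\<lambda>m::real. m \<in> {0<..<1}) (at_left 1)"
        by (intro eventually_at_leftI[of 0]) auto
      ultimately have "eventually (\<lambda>m. m \<in> {0<..<1} \<and> Omega 1 - \<epsilon> / 2 < Omega m) (at_left (1::real))" by eventually_elim auto
      then obtain m where m: "0 < m" "m < 1" "Omega 1 - Omega m < \<epsilon> / 2"
        by (force dest: eventually_happens'[rotated])
      \<comment> \<open>Any level strictly between m and 1 would do.\<close>
      define \<tau> where "\<tau> = (m + 1) / 2"
      have \<tau>: "m < \<tau>" "\<tau> < 1" using m by (auto simp: \<tau>_def)
      have z: "branch m 1 0 (Omega 1 - Omega m)" using m by (intro branch_zero) auto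
      have "branch m 1 (0 + s) (Omega 1 - Omega m + sqrt (theta_fin \<tau>) * \<bar>s\<bar>)"
        using z m \<tau> by (intro branch_perturb) auto
      then have "inf_G s \<le> ennreal (Omega 1 - Omega m + sqrt (theta_fin \<tau>) * \<bar>s\<bar> + (Omega 1 - Omega m))"
        using z m by (intro branch_combine[of m]) auto
      \<comment> \<open>The curve stays at level 1 and pays at least the price of any level \<tau> <
        1 for its increment s.\<close>
      also have "sqrt (theta_fin \<tau>) * \<bar>s\<bar> \<le> e"
      proof -
        have "sqrt (theta_fin \<tau> * (u 1 - u 0)\<^sup>2 + (Omega (v 1) - Omega (v 0))\<^sup>2) \<le> C 1 - C 0"
          using m \<tau> v1 by (intro C) auto
        then show ?thesis using uv Ce by (simp add: real_sqrt_mult)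
      qed
      then have "ennreal (Omega 1 - Omega m + sqrt (theta_fin \<tau>) * \<bar>s\<bar> + (Omega 1 - Omega m)) \<le> ennreal (e + \<epsilon>)"
        using m by (intro ennreal_leI) auto
      finally show "inf_G s \<le> ennreal e + ennreal \<epsilon>" using e \<open>0 < \<epsilon>\<close> by simp
    qed
  next
    case 2
    \<comment> \<open>With a = b = x0 there is no middle part and the perturbation term
      vanishes.\<close>
    have "inf_G s \<le> ennreal (C x0 - C 0 + sqrt (theta_fin (v x0)) * \<bar>u x0 - u x0\<bar> + (C 1 - C x0))"
      using x0 uv 2 by (intro inf_G_le_of_cost[where v=v and u=u and a=x0 and b=x0]) (auto intro: C)
    then show ?thesis using Ce by simp
  next
    case 3
    \<comment> \<open>A bound U for |u| limits the increment that the jump at level \<mu> has to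
      carry, uniformly in \<mu>.\<close>
    have "compact (u ` {0..1})" using uv by (intro compact_continuous_image) auto
    then obtain U where U: "\<And>x. x \<in> {0..1} \<Longrightarrow> \<bar>u x\<bar> \<le> U"
      by (force dest!: compact_imp_bounded simp: bounded_iff)
    have bd: "inf_G s \<le> ennreal (e + sqrt (theta_fin \<mu>) * (2 * U))" if \<mu>: "0 < \<mu>" "\<mu> < 1" for \<mu>
    proof -
      have v0: "continuous_on {0..x0} v" "v 0 = 1" "0 \<le> x0" "v x0 \<le> \<mu>" "\<mu> \<le> 1"
        using uv x0 3 \<mu> by (auto intro: continuous_on_subset)
      define a where "a = Inf {x \<in> {0..x0}. v x \<le> \<mu>}"
      have a: "a \<in> {0..x0}" "v a = \<mu>" "\<And>x. 0 \<le> x \<Longrightarrow> x \<le> a \<Longrightarrow> \<mu> \<le> v x"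
        unfolding a_def using first_hit[OF v0] by blast+
      have "continuous_on {0..1 - x0} (\<lambda>x. v (1 - x))"
        using x0(1) by (intro continuous_on_compose2[OF uv(2)] continuous_intros) auto
      note v1 = this _ _ _ v0(5)
      \<comment> \<open>The last time at level \<mu> is a first hitting time of the reversed
        function.\<close>
      define b' where "b' = Inf {x \<in> {0..1 - x0}. v (1 - x) \<le> \<mu>}"
      have b': "b' \<in> {0..1 - x0}" "v (1 - b') = \<mu>" "\<And>x. 0 \<le> x \<Longrightarrow> x \<le> b' \<Longrightarrow> \<mu> \<le> v (1 - x)"
        unfolding b'_def using first_hit[of "1 - x0" "\<lambda>x. v (1 - x)" \<mu>, OF v1] uv(7) x0(1) v0(4) by simp_all
      define b where "b = 1 - b'"
      have b: "x0 \<le> b" "b \<le> 1" "v b = \<mu>" using b' by (auto simp: b_def)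
      have bb: "\<mu> \<le> v x" if "x \<in> {b..1}" for x using b'(3)[of "1 - x"] that by (auto simp: b_def)
      have "inf_G s \<le> ennreal (C a - C 0 + sqrt (theta_fin \<mu>) * \<bar>u b - u a\<bar> + (C 1 - C b))"
        using uv \<mu> a b bb x0 by (intro inf_G_le_of_cost[where v=v and u=u]) (auto intro: C)
      also have "\<dots> \<le> ennreal (e + sqrt (theta_fin \<mu>) * (2 * U))"
      proof (rule ennreal_leI)
        have "C a \<le> C b" using a b x0 by (intro Cmono) auto
        moreover have "\<bar>u b - u a\<bar> \<le> 2 * U" using U[of a] U[of b] a b x0 by auto
        then have "sqrt (theta_fin \<mu>) * \<bar>u b - u a\<bar> \<le> sqrt (theta_fin \<mu>) * (2 * U)"
          using theta_fin_nonneg by (intro mult_left_mono) auto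
        ultimately show "C a - C 0 + sqrt (theta_fin \<mu>) * \<bar>u b - u a\<bar> + (C 1 - C b) \<le> e + sqrt (theta_fin \<mu>) * (2 * U)"
          using Ce by linarith
      qed
      finally show ?thesis .
    qed
    \<comment> \<open>The jump becomes free as \<mu> tends to 0, since \<theta> is continuous at 0
      with value 0.\<close>
    have "((\<lambda>\<mu>. ennreal (e + sqrt (theta_fin \<mu>) * (2 * U))) \<longlongrightarrow> ennreal (e + sqrt 0 * (2 * U))) (at_right 0)"
    proof (intro tendsto_intros)
      have "(theta0 l Q \<omega> \<longlongrightarrow> theta0 l Q \<omega> 0) (at 0 within {0..<1})"
        using theta0_cont by (simp add: continuous_on_def)
      then have "(theta0 l Q \<omega> \<longlongrightarrow> 0) (at 0 within {0<..<1})"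
        unfolding theta0_0 by (rule tendsto_within_subset) auto
      moreover have "at 0 within {0<..<1} = at_right (0::real)"
        by (rule at_within_nhd[of _ "{-1<..<1}"]) auto
      ultimately have "(theta0 l Q \<omega> \<longlongrightarrow> 0) (at_right 0)" by simp
      moreover have "eventually (\<lambda>t. theta0 l Q \<omega> t = theta_fin t) (at_right 0)"
        by (intro eventually_at_rightI[of 0 1]) (auto simp: theta_fin_eq)
      ultimately show "(theta_fin \<longlongrightarrow> 0) (at_right 0)" by (rule Lim_transform_eventually)
    qed
    moreover have "eventually (\<lambda>\<mu>. inf_G s \<le> ennreal (e + sqrt (theta_fin \<mu>) * (2 * U))) (at_right 0)"
      by (intro eventually_at_rightI[of 0 1]) (auto simp: bd)
    ultimately have "inf_G s \<le> ennreal (e + sqrt 0 * (2 * U))"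
      by (intro tendsto_lowerbound) auto
    then show ?thesis by simp
  qed
  then show ?thesis using e by simp
qed

lemma inf_G_le_g: "inf_G s \<le> g l Q \<omega> s"
  unfolding g_def using inf_G_le_energy by (auto intro!: INF_greatest)

section \<open>\<open>g\<close> is at most the infimum of \<open>G\<close>\<close>

lemma g_le:
  assumes m: "0 < m" "m < 1" and k [measurable]: "k \<in> borel_measurable borel" and B: "\<And>x. \<bar>k x\<bar> \<le> B"
    and z: "\<And>x. x \<notin> {2 * m - 1<..<1} \<Longrightarrow> k x = 0" and s: "(LINT x|lborel. k x) = s"
  shows "g l Q \<omega> s \<le> (\<integral>\<^sup>+t. ennreal (cost (m + \<bar>t - m\<bar>) (k t)) * indicator {2 * m - 1<..<1} t \<partial>lborel)"
proof -
  define r where "r = 2 * (1 - m)"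
  have r: "0 < r" using m by (simp add: r_def)
  \<comment> \<open>The affine map of (0,1) onto (2 * m - 1, 1), an interval of length r. With v = m
    + |\<xi> - m| one has |v'| = r almost everywhere, homogeneity takes r out of the root, and the
    substitution absorbs it.\<close>
  define \<xi> where "\<xi> x = (2 * m - 1) + r * x" for x
  have [measurable]: "\<xi> \<in> borel_measurable borel" unfolding \<xi>_def[abs_def] by measurable
  have \<xi>: "\<xi> x \<in> {2 * m - 1<..<1} \<longleftrightarrow> x \<in> {0<..<1}" for x
  proof -
    have "\<xi> x < 1 \<longleftrightarrow> r * x < r * 1" by (simp add: \<xi>_def r_def algebra_simps)
    then have "\<xi> x < 1 \<longleftrightarrow> x < 1" using r by (simp only: mult_less_cancel_left_pos)
    moreover have "2 * m - 1 < \<xi> x \<longleftrightarrow> 0 < x" using r by (simp add: \<xi>_def zero_less_mult_iff)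
    ultimately show ?thesis by auto
  qed
  define ku where "ku x = r * k (\<xi> x)" for x
  have [measurable]: "ku \<in> borel_measurable borel" unfolding ku_def[abs_def] by measurable
  have kuB: "\<bar>ku x\<bar> \<le> r * B" for x using r B by (simp add: ku_def abs_mult)
  have kuz: "ku x = 0" if "x \<notin> {0<..<1}" for x 
  proof -
    have "k (\<xi> x) = 0" using that by (intro z) (simp only: \<xi> not_False_eq_True)
    then show ?thesis by (simp add: ku_def)
  qed
  have kui: "integrable lborel ku" using bounded_support_integrable[of ku, OF _ kuB kuz] by simp
  have kus: "(LINT x|lborel. ku x) = s"
    using lborel_integral_real_affine[of r k "2 * m - 1"] r s by (simp add: ku_def \<xi>_def)
  define kv where "kv x = r * indicator {1/2<..<1} x - r * indicator {0<..<1/2} x" for x :: real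
  have [measurable]: "kv \<in> borel_measurable borel" unfolding kv_def[abs_def] by measurable
  have kvB: "\<bar>kv x\<bar> \<le> r" for x using r by (auto simp: kv_def split: split_indicator)
  have kvz: "kv x = 0" if "x \<notin> {0<..<1}" for x using that by (auto simp: kv_def split: split_indicator)
  have kvi: "integrable lborel kv" using bounded_support_integrable[of kv, OF _ kvB kvz] by simp
  have ind: "integrable lborel (indicator {p<..<q} :: real \<Rightarrow> real)" if "p \<le> q" for p q :: real
    using that by (intro integrable_real_indicator) auto
  have pkv: "1 + primitive kv x = m + \<bar>\<xi> x - m\<bar>" if "x \<in> {0..1}" for x
  proof -
    have "primitive kv x = r * max 0 (min x 1 - 1/2) - r * max 0 (min x (1/2) - 0)"
      unfolding kv_def[abs_def]
      by (subst primitive_sub) (auto simp: primitive_indicator intro!: integrable_mult_right ind)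
    also have "\<dots> = r * \<bar>x - 1/2\<bar> - r / 2"
      using that by (auto simp: max_def min_def abs_if algebra_simps)
    also have "r * \<bar>x - 1/2\<bar> = \<bar>r * (x - 1/2)\<bar>" using r by (simp add: abs_mult)
    also have "r * (x - 1/2) = \<xi> x - m" by (simp add: \<xi>_def r_def algebra_simps)
    finally show ?thesis by (simp add: r_def field_simps)
  qed
  define u where "u x = 0 + primitive ku x" for x
  define v where "v x = 1 + primitive kv x" for x
  have u0: "primitive ku 0 = 0"
  proof -
    have "(\<lambda>t. indicator {..0} t * ku t) = (\<lambda>t. 0)" using kuz by (auto simp: fun_eq_iff split: split_indicator)
    then show ?thesis unfolding primitive_def by (simp only: Bochner_Integration.integral_zero)
  qed
  have u1: "primitive ku 1 = s"
  proof -
    have "(\<lambda>t. indicator {..1} t * ku t) = ku" using kuz by (auto simp: fun_eq_iff split: split_indicator)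
    then show ?thesis unfolding primitive_def using kus by (simp only:)
  qed
  have vx: "v x = m + \<bar>\<xi> x - m\<bar>" if "x \<in> {0..1}" for x using pkv[OF that] by (simp add: v_def)
  have \<xi>01: "\<xi> x \<in> {2 * m - 1..1}" if "x \<in> {0..1}" for x
  proof -
    have "0 \<le> r * x" "r * x \<le> r * 1" using r that by (auto intro!: mult_nonneg_nonneg mult_left_mono)
    then show ?thesis by (simp add: \<xi>_def r_def)
  qed
  have "(u, v) \<in> g_competitors s"
  proof -
    have "u \<in> H1 0 1" unfolding u_def by (rule sobolev1_prim[OF _ kuB kuz]) auto
    moreover have "v \<in> H1 0 1" unfolding v_def by (rule sobolev1_prim[OF _ kvB kvz]) auto
    moreover have "continuous_on {0..1} u" "continuous_on {0..1} v"
      unfolding u_def v_def by (intro continuous_intros continuous_on_subset[OF primitive_continuous] kui kvi subset_UNIV)+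
    moreover have "0 \<le> v x \<and> v x \<le> 1" if "x \<in> {0..1}" for x
      using vx[OF that] \<xi>01[OF that] m by (auto simp: abs_if)
    moreover have "v 0 = 1" "v 1 = 1" using vx[of 0] vx[of 1] m by (auto simp: \<xi>_def r_def)
    ultimately show ?thesis unfolding g_competitors_def using u0 u1 by (auto simp: u_def)
  qed
  then have "g l Q \<omega> s \<le> (\<integral>\<^sup>+ x. ennreal_sqrt (theta l Q \<omega> (v x) * ennreal (\<bar>weak_deriv 0 1 u x\<bar>\<^sup>2)
       + ennreal (\<omega> (1 - v x) * \<bar>weak_deriv 0 1 v x\<bar>\<^sup>2)) \<partial>lebesgue_on {0<..<1})"
    unfolding g_def by (intro INF_lower2[of "(u, v)"]) auto
  also have "\<dots> = (\<integral>\<^sup>+ x. ennreal (r * cost (m + \<bar>\<xi> x - m\<bar>) (k (\<xi> x))) * indicator {0<..<1} x \<partial>lborel)"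
  proof (rule nn_integral_open_interval)
    have wu: "has_weak_deriv 0 1 u ku" using kui kuz zero_less_one u_def by (rule has_weak_deriv_prim)
    have wv: "has_weak_deriv 0 1 v kv" using kvi kvz zero_less_one v_def by (rule has_weak_deriv_prim)
    have wdu: "AE x in lebesgue_on {0<..<1}. weak_deriv 0 1 u x = ku x"
      using zero_less_one wu kui kuz by (rule weak_deriv_AE(2))
    have wdv: "AE x in lebesgue_on {0<..<1}. weak_deriv 0 1 v x = kv x"
      using zero_less_one wv kvi kvz by (rule weak_deriv_AE(2))
    \<comment> \<open>At the kink 1/2, where v attains m, \<open>kv\<close> has the value 0 in place
      of a slope of modulus r.\<close>
    have "AE t in lebesgue_on {0<..<1}. t \<in> {0<..<1::real} \<and> t \<noteq> 1/2"
      using AE_lborel_singleton[of "1/2::real"] unfolding AE_open_interval by eventually_elim auto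
    then show "AE x in lebesgue_on {0<..<1}. ennreal_sqrt (theta l Q \<omega> (v x) * ennreal (\<bar>weak_deriv 0 1 u x\<bar>\<^sup>2)
       + ennreal (\<omega> (1 - v x) * \<bar>weak_deriv 0 1 v x\<bar>\<^sup>2)) = ennreal (r * cost (m + \<bar>\<xi> x - m\<bar>) (k (\<xi> x)))"
      using wdu wdv
    proof eventually_elim
      case (elim x)
      have x: "x \<in> {0<..<1}" "x \<noteq> 1/2" using elim(1) by auto
      then have v: "v x = m + \<bar>\<xi> x - m\<bar>" by (intro vx) auto
      have v01: "0 \<le> v x" "v x < 1" using v \<xi>[of x] x m by (auto simp: abs_if)
      have kv: "\<bar>kv x\<bar>\<^sup>2 = r\<^sup>2" using x by (auto simp: kv_def split: split_indicator)
      have "ennreal_sqrt (theta l Q \<omega> (v x) * ennreal (\<bar>weak_deriv 0 1 u x\<bar>\<^sup>2)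
         + ennreal (\<omega> (1 - v x) * \<bar>weak_deriv 0 1 v x\<bar>\<^sup>2)) = ennreal_sqrt (ennreal (theta_fin (v x)) * ennreal ((ku x)\<^sup>2) + ennreal (omega_refl (v x) * r\<^sup>2))"
        unfolding elim(2,3) kv using theta_eq[OF v01] omega_refl_eq[of "v x"] v01 by simp
      also have "\<dots> = ennreal_sqrt (ennreal (theta_fin (v x) * (ku x)\<^sup>2 + omega_refl (v x) * r\<^sup>2))"
        by (simp add: theta_fin_nonneg omega_refl_nonneg ennreal_mult)
      also have "\<dots> = ennreal (sqrt (theta_fin (v x) * (ku x)\<^sup>2 + omega_refl (v x) * r\<^sup>2))"
        by (intro ennreal_sqrt_ennreal) (simp add: theta_fin_nonneg omega_refl_nonneg)
      also have "theta_fin (v x) * (ku x)\<^sup>2 + omega_refl (v x) * r\<^sup>2 = r\<^sup>2 * (theta_fin (v x) * (k (\<xi> x))\<^sup>2 + omega_refl (v x))"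
        by (simp add: ku_def power_mult_distrib algebra_simps)
      also have "sqrt \<dots> = r * cost (v x) (k (\<xi> x))" using r by (simp add: cost_def real_sqrt_mult)
      finally show ?case using v by simp
    qed
  qed measurable
  also have "\<dots> = (\<integral>\<^sup>+ x. ennreal r * (ennreal (cost (m + \<bar>\<xi> x - m\<bar>) (k (\<xi> x))) * indicator {2 * m - 1<..<1} (\<xi> x)) \<partial>lborel)"
  proof (rule nn_integral_cong)
    fix x :: real
    have "(indicator {2 * m - 1<..<1} (\<xi> x) :: ennreal) = indicator {0<..<1} x" using \<xi>[of x] by (simp add: indicator_def)
    then show "ennreal (r * cost (m + \<bar>\<xi> x - m\<bar>) (k (\<xi> x))) * indicator {0<..<1} x =
      ennreal r * (ennreal (cost (m + \<bar>\<xi> x - m\<bar>) (k (\<xi> x))) * indicator {2 * m - 1<..<1} (\<xi> x))"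
      using r by (simp add: ennreal_mult' cost_nonneg mult.assoc)
  qed
  also have "\<dots> = ennreal r * (\<integral>\<^sup>+ x. ennreal (cost (m + \<bar>\<xi> x - m\<bar>) (k (\<xi> x))) * indicator {2 * m - 1<..<1} (\<xi> x) \<partial>lborel)"
    by (rule nn_integral_cmult) measurable
  also have "\<dots> = (\<integral>\<^sup>+t. ennreal (cost (m + \<bar>t - m\<bar>) (k t)) * indicator {2 * m - 1<..<1} t \<partial>lborel)"
    using nn_integral_real_affine[of "\<lambda>t. ennreal (cost (m + \<bar>t - m\<bar>) (k t)) * indicator {2 * m - 1<..<1} t" r "2 * m - 1"] r
    by (simp add: \<xi>_def)
  finally show ?thesis .
qed

lemma g_le_G:
  assumes m: "0 < m" "m < 1" and h: "h \<in> W11_0 (2 * m - 1) 1"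
  shows "g l Q \<omega> s \<le> G l Q \<omega> m (\<lambda>t. zeta m s t + h t)"
proof -
  let ?a = "2 * m - 1"
  have a: "?a < 1" using m by simp
  define c where "c = s / (2 * (1 - m))"
  \<comment> \<open>The sign is negative because the rule at hand treats differences:
    \<open>zeta\<close> is added by subtracting its negative.\<close>
  define j where "j x = - c * indicator {?a<..<1} x" for x :: real
  have ji: "integrable lborel j" unfolding j_def[abs_def] using a by (intro integrable_mult_right integrable_real_indicator) auto
  have jz: "j x = 0" if "x \<notin> {?a<..<1}" for x using that by (simp add: j_def)
  have jI: "(LINT x|lborel. j x) = - s"
  proof -
    have "(LINT x|lborel. j x) = - c * (1 - ?a)" unfolding j_def using m by simp
    also have "\<dots> = - s" using m by (simp add: c_def field_simps)
    finally show ?thesis .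
  qed
  have zj: "- zeta m s t = 0 + primitive j t" if "t \<in> {?a<..<1}" for t
  proof -
    have "primitive j t = - c * max 0 (min t 1 - ?a)"
      unfolding j_def using a by (intro primitive_indicator) auto
    also have "\<dots> = - zeta m s t" using that by (simp add: zeta_def c_def field_simps)
    finally show ?thesis by simp
  qed
  have hW: "h \<in> W11 ?a 1" using h by (simp add: W11_0_def)
  obtain kh where kh: "integrable lborel kh" "\<And>x. x \<notin> {?a<..<1} \<Longrightarrow> kh x = 0" "has_weak_deriv ?a 1 h kh"
    using sobolev1_representative[OF a hW] by metis
  have kh0: "(LINT x|lborel. kh x) = 0" by (rule W11_0_integral[OF a h kh(3,1,2)])
  have wj: "has_weak_deriv ?a 1 (\<lambda>t. - zeta m s t) j" using ji jz a zj by (rule has_weak_deriv_prim)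
  define p where "p x = kh x - j x" for x
  have pi: "integrable lborel p" unfolding p_def[abs_def] using kh ji by simp
  have [measurable]: "p \<in> borel_measurable borel" using pi by auto
  have pz: "p x = 0" if "x \<notin> {?a<..<1}" for x using kh(2)[OF that] jz[OF that] by (simp add: p_def)
  have pI: "(LINT x|lborel. p x) = s" unfolding p_def using kh ji kh0 jI by simp
  have zl: "(\<lambda>t. - zeta m s t) \<in> Lp_on 1 ?a 1"
  proof (rule Lp_on_bounded[where B="\<bar>c\<bar> * (1 - ?a)"])
    show "(\<lambda>t. - zeta m s t) \<in> borel_measurable borel" unfolding zeta_def[abs_def] by measurable
    fix t assume t: "t \<in> {?a<..<1}"
    have "- zeta m s t = - c * (t - ?a)" using m by (simp add: zeta_def c_def field_simps)
    then have "\<bar>- zeta m s t\<bar> = \<bar>c\<bar> * (t - ?a)" using t by (simp add: abs_mult)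
    also have "\<dots> \<le> \<bar>c\<bar> * (1 - ?a)" using t by (intro mult_left_mono) auto
    finally show "\<bar>- zeta m s t\<bar> \<le> \<bar>c\<bar> * (1 - ?a)" .
  qed simp
  have hl: "h \<in> Lp_on 1 ?a 1" using hW by (simp add: sobolev1_def)
  have "has_weak_deriv ?a 1 (\<lambda>t. h t - - zeta m s t) (\<lambda>x. kh x - j x)"
    by (rule has_weak_deriv_diff[OF hl zl integrable_in_Lp_on_1[OF kh(1)] integrable_in_Lp_on_1[OF ji] kh(3) wj])
  then have wp: "has_weak_deriv ?a 1 (\<lambda>t. zeta m s t + h t) p" by (simp add: p_def[abs_def] add.commute)
  have G: "G l Q \<omega> m (\<lambda>t. zeta m s t + h t) = (\<integral>\<^sup>+t. ennreal (cost (m + \<bar>t - m\<bar>) (p t)) * indicator {?a<..<1} t \<partial>lborel)"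
    by (rule G_eq[OF m _ weak_deriv_AE(2)[OF a wp pi pz]]) measurable
  \<comment> \<open>Truncation gives the bounded derivative that \<open>g_le\<close> asks for. Since
    |q n| \<le> |p| pointwise the energy does not grow, and dominated convergence sends the defect d
    n of the integral to 0.\<close>
  define q where "q n x = max (- real n) (min (real n) (p x))" for n :: nat and x
  have [measurable]: "q n \<in> borel_measurable borel" for n unfolding q_def[abs_def] by measurable
  have qp: "\<bar>q n x\<bar> \<le> \<bar>p x\<bar>" for n x by (auto simp: q_def)
  have qB: "\<bar>q n x\<bar> \<le> real n" for n x by (auto simp: q_def)
  have qz: "q n x = 0" if "x \<notin> {?a<..<1}" for n x using pz[OF that] by (simp add: q_def)
  have qi: "integrable lborel (q n)" for n using bounded_support_integrable[of "q n", OF _ qB qz] by simp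
  define d where "d n = s - (LINT x|lborel. q n x)" for n
  have "(\<lambda>n. LINT x|lborel. q n x) \<longlonglongrightarrow> (LINT x|lborel. p x)"
  proof (rule integral_dominated_convergence[where w="\<lambda>x. \<bar>p x\<bar>"])
    have "(\<lambda>n. q n x) \<longlonglongrightarrow> p x" for x
    proof (rule tendsto_eventually)
      show "eventually (\<lambda>n. q n x = p x) sequentially"
        using eventually_ge_at_top[of "nat \<lceil>\<bar>p x\<bar>\<rceil>"]
      proof eventually_elim
        case (elim n)
        then have "\<bar>p x\<bar> \<le> real n" by (simp add: nat_le_iff ceiling_le_iff)
        then show ?case by (simp add: q_def)
      qed
    qed
    then show "AE x in lborel. (\<lambda>n. q n x) \<longlonglongrightarrow> p x" by blast
  qed (use qp pi in auto)
  then have d0: "d \<longlonglongrightarrow> 0" unfolding d_def pI by (intro tendsto_eq_intros) auto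
  \<comment> \<open>The defect is repaired on (m, \<beta>). Any \<beta> strictly between m and 1
    would do, as \<theta> is bounded by its finite value at \<beta> there.\<close>
  define \<beta> where "\<beta> = (m + 1) / 2"
  have \<beta>: "m < \<beta>" "\<beta> < 1" using m by (auto simp: \<beta>_def)
  have bd: "g l Q \<omega> s \<le> G l Q \<omega> m (\<lambda>t. zeta m s t + h t) + ennreal (sqrt (theta_fin \<beta>) * \<bar>d n\<bar>)" for n
  proof -
    let ?k = "\<lambda>t. q n t + d n / (\<beta> - m) * indicator {m<..<\<beta>} t"
    have "g l Q \<omega> s \<le> (\<integral>\<^sup>+t. ennreal (cost (m + \<bar>t - m\<bar>) (?k t)) * indicator {?a<..<1} t \<partial>lborel)"
    proof (rule g_le[OF m])
      show "\<bar>?k x\<bar> \<le> real n + \<bar>d n / (\<beta> - m)\<bar>" for x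
      proof -
        have "\<bar>d n / (\<beta> - m) * indicator {m<..<\<beta>} x\<bar> \<le> \<bar>d n / (\<beta> - m)\<bar>" by (auto split: split_indicator)
        then show ?thesis using qB[of n x] by linarith
      qed
      show "?k x = 0" if "x \<notin> {?a<..<1}" for x using qz[OF that] that \<beta> m by (auto split: split_indicator)
      have "(LINT x|lborel. ?k x) = (LINT x|lborel. q n x) + d n / (\<beta> - m) * (\<beta> - m)"
        using qi[of n] \<beta> by simp
      then show "(LINT x|lborel. ?k x) = s" using \<beta> by (simp add: d_def)
    qed measurable
    also have "\<dots> \<le> (\<integral>\<^sup>+t. ennreal (cost (m + \<bar>t - m\<bar>) (q n t)) * indicator {?a<..<1} t \<partial>lborel) + ennreal (sqrt (theta_fin \<beta>) * \<bar>d n\<bar>)"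
    proof (rule nn_integral_perturb)
      show "sqrt (theta_fin (m + \<bar>t - m\<bar>)) \<le> sqrt (theta_fin \<beta>)" if "t \<in> {m<..<\<beta>}" for t
        using that m \<beta> by (intro real_sqrt_le_mono theta_fin_mono) auto
    qed (use m \<beta> in auto)
    also have "(\<integral>\<^sup>+t. ennreal (cost (m + \<bar>t - m\<bar>) (q n t)) * indicator {?a<..<1} t \<partial>lborel) \<le> G l Q \<omega> m (\<lambda>t. zeta m s t + h t)"
      unfolding G
    proof (intro nn_integral_mono mult_right_mono ennreal_leI)
      fix t
      have "(q n t)\<^sup>2 \<le> (p t)\<^sup>2" using qp[of n t] by (simp add: abs_le_square_iff)
      then show "cost (m + \<bar>t - m\<bar>) (q n t) \<le> cost (m + \<bar>t - m\<bar>) (p t)"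
        unfolding cost_def by (intro real_sqrt_le_mono add_right_mono mult_left_mono) (auto simp: theta_fin_nonneg)
    qed auto
    finally show ?thesis by (simp add: add_right_mono)
  qed
  have "(\<lambda>n. G l Q \<omega> m (\<lambda>t. zeta m s t + h t) + ennreal (sqrt (theta_fin \<beta>) * \<bar>d n\<bar>)) \<longlonglongrightarrow>
      G l Q \<omega> m (\<lambda>t. zeta m s t + h t) + ennreal (sqrt (theta_fin \<beta>) * \<bar>0\<bar>)"
    by (intro tendsto_intros d0)
  then have "g l Q \<omega> s \<le> G l Q \<omega> m (\<lambda>t. zeta m s t + h t) + ennreal (sqrt (theta_fin \<beta>) * \<bar>0\<bar>)"
    using bd by (intro LIMSEQ_le_const) auto
  then show ?thesis by simp
qed

lemma g_le_inf_G: "g l Q \<omega> s \<le> inf_G s"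
  unfolding inf_G_def using g_le_G by (auto intro!: INF_greatest)

end

theorem proposition2p5:
  fixes l Q \<omega> \<phi> :: "real \<Rightarrow> real" and s :: real
  assumes "admissible_data l Q \<omega> \<phi>"
    and "0 \<le> s"
  shows "g l Q \<omega> s =
    (INF m\<in>{0<..<1}. INF w\<in>{(\<lambda>t. zeta m s t + h t) | h. h \<in> W11_0 (2 * m - 1) 1}. G l Q \<omega> m w)"
proof -
  interpret admissible_data l Q \<omega> \<phi> by fact
  show ?thesis
    using g_le_inf_G[of s] inf_G_le_g[of s] unfolding inf_G_def by (rule antisym)
qed

end
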